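(* Let $\theta$ be the unique positive real solution of $W(\theta)=1$, where $W(x)=\sum_{n\ge1}\frac{\mathcal{W}_2(1,n)}{n!}x^n$, and let $\nu = 1/\theta = 1.7521819\ldots$. Then $$M_2(n)/n! \le \nu^n$$ for all $n\ge 1$, and the constant is optimal: we have the more precise asymptotic formula $$M_2(n)/n! \sim \lambda\, n^{-1/2}\,\nu^n \quad (n\to\infty)$$ with a constant $\lambda = 0.2769343\ldots$.
   Context: $\mathbb{N}_0$ denotes the nonnegative integers. For positive integers $\ell,n$, let $$\mathcal{U}_2(\ell,n)=\#\{(a_1,\ldots,a_n)\in\mathbb{N}_0^n : 2^{a_1}+\cdots+2^{a_n}=\ell\}.$$ For a positive integer $s$, $\mathcal{W}_2(s,n)$ is the maximum of $\mathcal{U}_2(\ell,n)$ over all positive integers $\ell$ whose binary sum of digits equals $s$. Further, $$M_2(n)=\max_{\ell\ge1}\,\mathcal{U}_2(\ell,n)=\max_{s\ge1}\,\mathcal{W}_2(s,n)$$ is the maximum number of representations of a positive integer as an ordered sum of exactly $n$ powers of $2$. *)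

theory Defs
  imports "HOL-Analysis.Analysis" "HOL-Library.Landau_Symbols"
begin

definition reps2 :: "nat \<Rightarrow> nat \<Rightarrow> nat list set"
  where "reps2 l n = {a. length a = n \<and> (\<Sum>e\<leftarrow>a. 2 ^ e) = l}"

definition U2 :: "nat \<Rightarrow> nat \<Rightarrow> nat"
  where "U2 l n = card (reps2 l n)"

fun bin_digit_sum :: "nat \<Rightarrow> nat"
  where "bin_digit_sum l = (if l = 0 then 0 else l mod 2 + bin_digit_sum (l div 2))"

declare bin_digit_sum.simps [simp del]

(* Although infinitely many l are considered, only finitely many values occur
   (see finite_range_U2), so these are genuine maxima; W2 is meant for s > 0. *)

definition W2 :: "nat \<Rightarrow> nat \<Rightarrow> nat"
  where "W2 s n = Max {U2 l n | l. l > 0 \<and> bin_digit_sum l = s}"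

definition M2 :: "nat \<Rightarrow> nat"
  where "M2 n = Max {U2 l n | l. l > 0}"

lemma reps2_Suc_subset:
  "reps2 l (Suc n) \<subseteq>
     (\<Union>(i, e)\<in>{..n} \<times> {e. 2 ^ e \<le> l \<and> l \<le> Suc n * 2 ^ e}.
        (\<lambda>b. take i b @ e # drop i b) ` reps2 (l - 2 ^ e) n)"
proof
  fix a assume "a \<in> reps2 l (Suc n)"
  then have len: "length a = Suc n" and sum: "(\<Sum>e\<leftarrow>a. 2 ^ e) = l"
    by (auto simp: reps2_def)
  define m where "m = Max (set a)"
  have ne: "a \<noteq> []" using len by auto
  then have "m \<in> set a" by (simp add: m_def)
  then obtain i where i: "i < length a" "a ! i = m" by (auto simp: in_set_conv_nth)
  define b where "b = take i a @ drop (Suc i) a"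
  have a_split: "a = take i a @ m # drop (Suc i) a"
    using i id_take_nth_drop by metis
  have "l = (\<Sum>e\<leftarrow>take i a @ m # drop (Suc i) a. 2 ^ e)"
    using sum a_split by metis
  also have "\<dots> = (\<Sum>e\<leftarrow>b. 2 ^ e) + 2 ^ m" by (simp add: b_def)
  finally have lb: "l = (\<Sum>e\<leftarrow>b. 2 ^ e) + 2 ^ m" .
  have "(\<Sum>e\<leftarrow>a. (2::nat) ^ e) \<le> (\<Sum>e\<leftarrow>a. 2 ^ m)"
    by (rule sum_list_mono) (simp add: m_def)
  then have up: "l \<le> Suc n * 2 ^ m"
    using sum len by (simp add: sum_list_triv)
  have "length b = n" using len i by (simp add: b_def)
  then have "b \<in> reps2 (l - 2 ^ m) n" using lb by (simp add: reps2_def)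
  moreover have "a = take i b @ m # drop i b"
    using a_split i by (simp add: b_def)
  moreover have "(i, m) \<in> {..n} \<times> {e. 2 ^ e \<le> l \<and> l \<le> Suc n * 2 ^ e}"
    using i len lb up by auto
  ultimately show "a \<in> (\<Union>(i, e)\<in>{..n} \<times> {e. 2 ^ e \<le> l \<and> l \<le> Suc n * 2 ^ e}.
        (\<lambda>b. take i b @ e # drop i b) ` reps2 (l - 2 ^ e) n)"
    by blast
qed

lemma admissible_max_exponents:
  "\<exists>k. {e. 2 ^ e \<le> (l::nat) \<and> l \<le> Suc n * 2 ^ e} \<subseteq> {k..k + n}"
proof (cases "\<exists>e. 2 ^ e \<le> l \<and> l \<le> Suc n * 2 ^ e")
  case True
  define k where "k = (LEAST e. 2 ^ e \<le> l \<and> l \<le> Suc n * 2 ^ e)"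
  have k: "l \<le> Suc n * 2 ^ k"
    using LeastI_ex[OF True] by (simp add: k_def)
  have "e \<in> {k..k + n}" if e: "2 ^ e \<le> l" "l \<le> Suc n * 2 ^ e" for e
  proof -
    have "k \<le> e" unfolding k_def using e by (intro Least_le) simp
    moreover have "2 ^ e \<le> (2::nat) ^ (k + n)"
    proof -
      have "Suc n \<le> 2 ^ n" by (rule Suc_leI) (rule less_exp)
      then have "Suc n * 2 ^ k \<le> 2 ^ n * 2 ^ k" by (rule mult_le_mono1)
      with e(1) k show ?thesis by (simp add: power_add mult.commute)
    qed
    then have "e \<le> k + n" by simp
    ultimately show ?thesis by simp
  qed
  then show ?thesis by blast
qed auto

lemma reps2_finite_bounded: "\<exists>B. \<forall>l. finite (reps2 l n) \<and> U2 l n \<le> B"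
proof (induction n)
  case 0
  have "reps2 l 0 \<subseteq> {[]}" for l by (auto simp: reps2_def)
  moreover from this have "U2 l 0 \<le> 1" for l
    unfolding U2_def using card_mono[of "{[]}" "reps2 l 0"] by simp
  ultimately show ?case using finite_subset by blast
next
  case (Suc n)
  then obtain B where fin: "\<And>l. finite (reps2 l n)" and B: "\<And>l. card (reps2 l n) \<le> B"
    by (auto simp: U2_def)
  have "finite (reps2 l (Suc n)) \<and> U2 l (Suc n) \<le> Suc n * Suc n * B" for l
  proof -
    let ?E = "{e. 2 ^ e \<le> l \<and> l \<le> Suc n * 2 ^ e}"
    let ?F = "\<lambda>(i, e). (\<lambda>b. take i b @ e # drop i b) ` reps2 (l - 2 ^ e) n"
    obtain k where k: "?E \<subseteq> {k..k + n}" using admissible_max_exponents by blast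
    then have finE: "finite ?E" using finite_subset by blast
    have "card ?E \<le> Suc n" using card_mono[OF _ k] by simp
    then have cardI: "card ({..n} \<times> ?E) \<le> Suc n * Suc n"
      unfolding card_cartesian_product card_atMost by (rule mult_le_mono2)
    have finI: "finite ({..n} \<times> ?E)" using finE by simp
    have finF: "finite (\<Union>(?F ` ({..n} \<times> ?E)))" using finI fin by auto
    have cF: "card (?F p) \<le> B" for p
      using card_image_le[OF fin] B by (cases p) (auto intro: order_trans)
    have "card (reps2 l (Suc n)) \<le> card (\<Union>(?F ` ({..n} \<times> ?E)))"
      by (rule card_mono[OF finF reps2_Suc_subset])
    also have "\<dots> \<le> (\<Sum>p\<in>{..n} \<times> ?E. card (?F p))"
      by (rule card_UN_le[OF finI])
    also have "\<dots> \<le> card ({..n} \<times> ?E) * B"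
      using sum_bounded_above[of "{..n} \<times> ?E" "\<lambda>p. card (?F p)" B] cF by simp
    also have "\<dots> \<le> Suc n * Suc n * B" by (rule mult_le_mono1[OF cardI])
    finally show ?thesis
      using finite_subset[OF reps2_Suc_subset finF] by (simp add: U2_def)
  qed
  then show ?case by blast
qed

lemma finite_reps2: "finite (reps2 l n)"
  using reps2_finite_bounded by blast

lemma finite_range_U2: "finite (range (\<lambda>l. U2 l n))"
proof -
  obtain B where "\<And>l. U2 l n \<le> B" using reps2_finite_bounded by blast
  then have "range (\<lambda>l. U2 l n) \<subseteq> {..B}" by auto
  then show ?thesis by (rule finite_subset) simp
qed

end

theory Submission
  imports Defs "HOL-Probability.Probability" "HOL-Combinatorics.Multiset_Permutations"
begin

text \<open>
  Sorting the summands of a representation of \<open>\<ell>\<close> in decreasing order, some partial sum equals the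
  largest power of two not exceeding \<open>\<ell>\<close>; inductively, the summands can be grouped along the binary
  digits of \<open>\<ell>\<close>. If these digits are far apart, such groups can conversely be chosen
  independently. Therefore \<open>M2 n / n!\<close> is the maximum over \<open>s \<ge> 1\<close> of the coefficient of
  \<open>x ^ n\<close> in \<open>W(x) ^ s\<close>. The numbers \<open>p k = W2 1 k / k! * \<theta> ^ k\<close> form a
  probability distribution, and \<open>\<theta> ^ n\<close> times that coefficient is the probability that a sum of \<open>s\<close>
  independent copies equals \<open>n\<close>. It is at most 1, and by the local limit theorem its maximum over
  \<open>s\<close>, attained near \<open>s = n / \<mu>\<close>, is asymptotic to \<open>sqrt (\<mu> / (2 \<pi> \<sigma>\<^sup>2 n))\<close>.

  For the numerical values, count the representations of \<open>j\<close> units by powers of two not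
  exceeding the unit, and split off the \<open>i\<close> summands equal to the unit: the generating functions
  \<open>F j\<close> satisfy \<open>F j = (\<Sum>i\<le>j. x ^ i / i! * F (2 * (j - i)))\<close>. As \<open>F j\<close> decays very rapidly in \<open>j\<close>,
  a finite part of this linear system determines \<open>W = F 1\<close> and its moments with high precision.
\<close>

section \<open>Weighted multisets of powers of two\<close>

text \<open>Dividing by \<open>n!\<close> turns tuples into multisets weighted by the reciprocal
  factorials of their multiplicities. This weight is submultiplicative under union, and
  multiplicative when no part is shared: the first fact bounds every number by a coefficient of a
  power of W, the second lets widely spaced digits attain it. The system for the F j is infinite,
  and row j involves indices up to 2 j, so truncating it requires an a priori bound. A nonnegative
  supersolution provides one: it dominates the solution by induction on the number of halvings of
  the unit. It is built at 13/20, strictly beyond \<theta>, and this one choice yields convergence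
  past \<theta>, hence the moments and exponential tail bounds, and also the truncation errors of
  the numerical systems. In the maximum over s the obstacle is uniformity, as the best s may depend
  on n in any way. Integrating the modulus of the Fourier integrand bounds the probabilities of all
  n at once, with the sharp constant; the s well below n / \<mu>, where that bound is too weak, are
  exponentially negligible. Periodicity cannot interfere because x and x^2 both occur in W.\<close>

definition mset_weight :: "'a multiset \<Rightarrow> real"
  where "mset_weight M = (\<Prod>x\<in>set_mset M. 1 / fact (count M x))"

text \<open>The cap \<open>L\<close> makes the depth of subdivision explicit: in a sum
  \<open>j * 2 ^ L\<close> the part \<open>2 ^ L\<close> is the unit, and raising \<open>L\<close>
  admits finer fractions of it.\<close>

definition msets_upto :: "nat \<Rightarrow> nat \<Rightarrow> nat \<Rightarrow> nat multiset set"
  where "msets_upto L l n =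
    {M. size M = n \<and> (\<Sum>x\<in>#M. 2 ^ x) = l \<and> set_mset M \<subseteq> {..L}}"

definition weighted_count :: "nat \<Rightarrow> nat \<Rightarrow> nat \<Rightarrow> real"
  where "weighted_count L l n = (\<Sum>M\<in>msets_upto L l n. mset_weight M)"

lemma mset_weight_superset:
  assumes "finite A" "set_mset M \<subseteq> A"
  shows "mset_weight M = (\<Prod>x\<in>A. 1 / fact (count M x))"
  unfolding mset_weight_def
  by (rule prod.mono_neutral_left) (use assms in \<open>auto simp: not_in_iff\<close>)

lemma mset_weight_nonneg: "mset_weight M \<ge> 0"
  unfolding mset_weight_def by (intro prod_nonneg) auto

text \<open>For each part the two sides differ by a binomial coefficient
  \<open>(a + b) choose a\<close>, which is at least 1.\<close>

lemma mset_weight_add_le: "mset_weight (A + B) \<le> mset_weight A * mset_weight B"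
proof -
  let ?S = "set_mset (A + B)"
  have le: "fact a * fact b \<le> (fact (a + b) :: real)" for a b
  proof -
    have "fact a * fact b dvd (fact (a + b) :: nat)"
      using choose_dvd[of a "a + b"] by simp
    then have "fact a * fact b \<le> (fact (a + b) :: nat)"
      by (rule dvd_imp_le) simp
    then have "real (fact a * fact b) \<le> real (fact (a + b))"
      by (rule of_nat_mono)
    then show ?thesis by simp
  qed
  have "mset_weight (A + B) = (\<Prod>x\<in>?S. 1 / fact (count (A + B) x))"
    by (simp add: mset_weight_def)
  also have "\<dots> \<le> (\<Prod>x\<in>?S. (1 / fact (count A x)) * (1 / fact (count B x)))"
    using le by (intro prod_mono) (auto intro!: divide_left_mono)
  also have "\<dots> = mset_weight A * mset_weight B"
    by (simp only: prod.distrib) (simp add: mset_weight_superset[of ?S A] mset_weight_superset[of ?S B])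
  finally show ?thesis .
qed

lemma mset_weight_add_disjoint:
  assumes "set_mset A \<inter> set_mset B = {}"
  shows "mset_weight (A + B) = mset_weight A * mset_weight B"
proof -
  have "mset_weight (A + B) = (\<Prod>x\<in>set_mset A \<union> set_mset B. 1 / fact (count (A + B) x))"
    by (simp add: mset_weight_def)
  also have "\<dots> = (\<Prod>x\<in>set_mset A. 1 / fact (count (A + B) x)) *
      (\<Prod>x\<in>set_mset B. 1 / fact (count (A + B) x))"
    using assms by (intro prod.union_disjoint) auto
  also have "(\<Prod>x\<in>set_mset A. 1 / fact (count (A + B) x)) = mset_weight A"
    unfolding mset_weight_def using assms
    by (intro prod.cong) (auto simp: disjoint_iff not_in_iff)
  also have "(\<Prod>x\<in>set_mset B. 1 / fact (count (A + B) x)) = mset_weight B"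
    unfolding mset_weight_def
  proof (intro prod.cong refl)
    fix x assume "x \<in># B"
    with assms have "count A x = 0" by (meson disjoint_iff count_eq_zero_iff)
    then show "1 / fact (count (A + B) x) = (1 / fact (count B x) :: real)" by simp
  qed
  finally show ?thesis .
qed

lemma mset_weight_replicate [simp]: "mset_weight (replicate_mset i x) = 1 / fact i"
  by (cases "i = 0") (auto simp: mset_weight_def)

lemma mset_weight_image:
  assumes "inj f"
  shows "mset_weight (image_mset f M) = mset_weight M"
proof -
  have "count (image_mset f M) (f x) = count M x" for x
    using assms by (induction M) (auto simp: inj_eq)
  then show ?thesis
    unfolding mset_weight_def using assms
    by (simp add: prod.reindex inj_on_subset)
qed

lemma finite_msets_upto: "finite (msets_upto L l n)"
proof (rule finite_subset)
  show "msets_upto L l n \<subseteq> mset ` {xs. set xs \<subseteq> {..L} \<and> length xs = n}"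
  proof
    fix M assume M: "M \<in> msets_upto L l n"
    obtain xs where "mset xs = M" using ex_mset by blast
    with M show "M \<in> mset ` {xs. set xs \<subseteq> {..L} \<and> length xs = n}"
      by (auto simp: msets_upto_def image_iff intro!: exI[of _ xs])
  qed
  show "finite (mset ` {xs. set xs \<subseteq> {..L} \<and> length xs = n})"
    using finite_lists_length_eq by auto
qed

lemma weighted_count_nonneg: "weighted_count L l n \<ge> 0"
  unfolding weighted_count_def by (intro sum_nonneg mset_weight_nonneg)

lemma exponent_bound:
  assumes "x \<in># M" "(\<Sum>x\<in>#M. 2 ^ x) = (l::nat)"
  shows "2 ^ x \<le> l"
proof -
  have "(\<Sum>y\<in>#M. (2::nat) ^ y) = 2 ^ x + (\<Sum>y\<in>#M - {#x#}. 2 ^ y)"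
    using assms(1) by (metis insert_DiffM image_mset_add_mset sum_mset.add_mset)
  with assms(2) show ?thesis by simp
qed

text \<open>Equal parts may be permuted among themselves, so \<open>mset_weight\<close> is the
  fraction of the \<open>fact (size M)\<close> arrangements that remain distinct.\<close>

lemma real_card_permutations_of_multiset:
  "real (card (permutations_of_multiset M)) = fact (size M) * mset_weight M"
proof -
  have "card (permutations_of_multiset M) * (\<Prod>x\<in>set_mset M. fact (count M x)) = fact (size M)"
    by (rule card_permutations_of_multiset_aux)
  then have "real (card (permutations_of_multiset M) * (\<Prod>x\<in>set_mset M. fact (count M x)))
      = fact (size M)"
    by simp
  then have "real (card (permutations_of_multiset M)) * (\<Prod>x\<in>set_mset M. fact (count M x))
      = fact (size M)"
    by simp
  then show ?thesis
    by (simp add: mset_weight_def prod_dividef field_simps)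
qed

lemma card_lists_upto:
  "real (card {a. length a = n \<and> (\<Sum>e\<leftarrow>a. 2 ^ e) = l \<and> set a \<subseteq> {..L}}) =
    fact n * weighted_count L l n"
proof -
  have "{a. length a = n \<and> (\<Sum>e\<leftarrow>a. 2 ^ e) = l \<and> set a \<subseteq> {..L}} =
      (\<Union>M\<in>msets_upto L l n. permutations_of_multiset M)"
    by (auto simp: msets_upto_def permutations_of_multiset_def sum_mset_sum_list[symmetric])
  moreover have "card (\<Union>M\<in>msets_upto L l n. permutations_of_multiset M) =
      (\<Sum>M\<in>msets_upto L l n. card (permutations_of_multiset M))"
    by (intro card_UN_disjoint finite_msets_upto)
      (use finite_permutations_of_multiset in blast, auto simp: permutations_of_multiset_def)
  ultimately have "real (card {a. length a = n \<and> (\<Sum>e\<leftarrow>a. 2 ^ e) = l \<and> set a \<subseteq> {..L}}) =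
      (\<Sum>M\<in>msets_upto L l n. fact (size M) * mset_weight M)"
    by (simp add: real_card_permutations_of_multiset)
  also have "\<dots> = fact n * weighted_count L l n"
    unfolding weighted_count_def sum_distrib_left
    by (intro sum.cong) (auto simp: msets_upto_def)
  finally show ?thesis .
qed

lemma list_exponent_bound:
  assumes "(\<Sum>e\<leftarrow>a. 2 ^ e) = (l::nat)" "l < 2 ^ Suc L"
  shows "set a \<subseteq> {..L}"
proof
  fix x assume "x \<in> set a"
  then have "x \<in># mset a" by simp
  then have "2 ^ x \<le> l"
    using assms(1) by (intro exponent_bound[of x "mset a"]) (auto simp: sum_mset_sum_list[symmetric])
  then have "(2::nat) ^ x < 2 ^ Suc L" using assms(2) by linarith
  then show "x \<in> {..L}" by (metis lessThan_iff lessThan_Suc_atMost nat_power_less_imp_less zero_less_numeral)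
qed

lemma weighted_count_eq_U2:
  assumes "l < 2 ^ Suc L"
  shows "weighted_count L l n = real (U2 l n) / fact n"
proof -
  have "{a. length a = n \<and> (\<Sum>e\<leftarrow>a. 2 ^ e) = l \<and> set a \<subseteq> {..L}} = reps2 l n"
    using list_exponent_bound[OF _ assms] by (auto simp: reps2_def)
  then show ?thesis
    using card_lists_upto[of n l L] by (simp add: U2_def)
qed

lemma weighted_count_le_U2: "weighted_count L l n \<le> real (U2 l n) / fact n"
proof -
  have "card {a. length a = n \<and> (\<Sum>e\<leftarrow>a. 2 ^ e) = l \<and> set a \<subseteq> {..L}} \<le> U2 l n"
    unfolding U2_def by (intro card_mono finite_reps2) (auto simp: reps2_def)
  then have "fact n * weighted_count L l n \<le> real (U2 l n)"
    unfolding card_lists_upto[symmetric] by simp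
  then show ?thesis by (simp add: field_simps)
qed

section \<open>Splitting and merging along the binary digits\<close>

text \<open>Either \<open>2 ^ Suc e\<close> is itself a part, or all parts are at most
  \<open>2 ^ e\<close> and two submultisets of sum \<open>2 ^ e\<close> can be removed one after the
  other.\<close>

lemma submultiset_sum_pow2:
  assumes "set_mset M \<subseteq> {..e}" "(\<Sum>x\<in>#M. 2 ^ x) \<ge> (2::nat) ^ e"
  shows "\<exists>A. A \<subseteq># M \<and> (\<Sum>x\<in>#A. 2 ^ x) = (2::nat) ^ e"
  using assms
proof (induction e arbitrary: M)
  case 0
  then have "M \<noteq> {#}" by auto
  then obtain x where x: "x \<in># M" by blast
  with 0 show ?case by (intro exI[of _ "{#x#}"]) auto
next
  case (Suc e)
  show ?case
  proof (cases "Suc e \<in># M")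
    case True
    then show ?thesis by (intro exI[of _ "{#Suc e#}"]) auto
  next
    case False
    have sub: "set_mset M \<subseteq> {..e}"
    proof
      fix x assume "x \<in># M"
      with False Suc.prems(1) have "x \<le> Suc e" "x \<noteq> Suc e" by auto
      then show "x \<in> {..e}" by simp
    qed
    obtain A where A: "A \<subseteq># M" "(\<Sum>x\<in>#A. 2 ^ x) = (2::nat) ^ e"
      using Suc.IH[OF sub] Suc.prems(2) by auto
    have M: "M = A + (M - A)" using A(1) by simp
    have "(\<Sum>x\<in>#M. (2::nat) ^ x) = 2 ^ e + (\<Sum>x\<in>#M - A. 2 ^ x)"
      by (subst M) (simp add: A(2) del: subset_mset.add_diff_inverse)
    then have "(\<Sum>x\<in>#M - A. (2::nat) ^ x) \<ge> 2 ^ e" using Suc.prems(2) by simp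
    moreover have "set_mset (M - A) \<subseteq> {..e}" using sub by (meson in_diffD subset_iff)
    ultimately obtain B where B: "B \<subseteq># M - A" "(\<Sum>x\<in>#B. 2 ^ x) = (2::nat) ^ e"
      using Suc.IH by blast
    have "A + B \<subseteq># M" using A(1) B(1) by (metis M subset_mset.add_left_mono)
    with A(2) B(2) show ?thesis by (intro exI[of _ "A + B"]) auto
  qed
qed

text \<open>For each \<open>M\<close> one submultiset of sum \<open>2 ^ e\<close> is chosen;
  \<open>M\<close> is the sum of the two pieces, so the map is injective. Pairs missed by the choice
  and parts shared by the pieces only enlarge the right-hand side.\<close>

lemma weighted_count_split_top:
  assumes "l < 2 ^ e"
  shows "weighted_count e (2 ^ e + l) n \<le>
    (\<Sum>k\<le>n. weighted_count e (2 ^ e) k * weighted_count e l (n - k))"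
proof -
  let ?S = "SIGMA k:{..n}. msets_upto e (2 ^ e) k \<times> msets_upto e l (n - k)"
  have ex: "\<exists>A. A \<subseteq># M \<and> (\<Sum>x\<in>#A. 2 ^ x) = (2::nat) ^ e"
    if "M \<in> msets_upto e (2 ^ e + l) n" for M
    using that submultiset_sum_pow2[of M e] by (auto simp: msets_upto_def)
  define g where "g M = (SOME A. A \<subseteq># M \<and> (\<Sum>x\<in>#A. 2 ^ x) = (2::nat) ^ e)" for M
  have g: "g M \<subseteq># M" "(\<Sum>x\<in>#g M. 2 ^ x) = (2::nat) ^ e"
    if "M \<in> msets_upto e (2 ^ e + l) n" for M
    using someI_ex[OF ex[OF that]] unfolding g_def by blast+
  let ?h = "\<lambda>M. (size (g M), g M, M - g M)"
  have split: "M = g M + (M - g M)" if "M \<in> msets_upto e (2 ^ e + l) n" for M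
    using g(1)[OF that] by simp
  have inj: "inj_on ?h (msets_upto e (2 ^ e + l) n)"
  proof (rule inj_onI)
    fix M N assume M: "M \<in> msets_upto e (2 ^ e + l) n" and N: "N \<in> msets_upto e (2 ^ e + l) n"
      and eq: "?h M = ?h N"
    then have "g M + (M - g M) = g N + (N - g N)" by (metis Pair_inject)
    then show "M = N" by (metis split[OF M] split[OF N])
  qed  have img: "?h ` msets_upto e (2 ^ e + l) n \<subseteq> ?S"
  proof (rule image_subsetI)
    fix M assume M: "M \<in> msets_upto e (2 ^ e + l) n"
    note gM = g[OF M]
    have sz: "size M = n" "(\<Sum>x\<in>#M. 2 ^ x) = 2 ^ e + l" "set_mset M \<subseteq> {..e}"
      using M by (auto simp: msets_upto_def)
    have "size (g M) \<le> n" using sz(1) gM(1) size_mset_mono by blast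
    moreover have "size (M - g M) = n - size (g M)"
      using sz(1) gM(1) by (simp add: size_Diff_submset)
    moreover have "(\<Sum>x\<in>#M. (2::nat) ^ x) = (\<Sum>x\<in>#g M. 2 ^ x) + (\<Sum>x\<in>#M - g M. 2 ^ x)"
      by (subst split[OF M]) (simp del: subset_mset.add_diff_inverse)
    then have "(\<Sum>x\<in>#M - g M. 2 ^ x) = l" using sz gM by simp
    moreover have "set_mset (g M) \<subseteq> {..e}" "set_mset (M - g M) \<subseteq> {..e}"
      using sz(3) gM(1) by (auto dest: mset_subset_eqD in_diffD)
    ultimately show "?h M \<in> ?S" using gM by (auto simp: msets_upto_def)
  qed
  have "weighted_count e (2 ^ e + l) n \<le>
      (\<Sum>M\<in>msets_upto e (2 ^ e + l) n. mset_weight (g M) * mset_weight (M - g M))"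
    unfolding weighted_count_def
  proof (intro sum_mono)
    fix M assume "M \<in> msets_upto e (2 ^ e + l) n"
    from split[OF this] show "mset_weight M \<le> mset_weight (g M) * mset_weight (M - g M)"
      using mset_weight_add_le[of "g M" "M - g M"] by simp
  qed
  also have "\<dots> = (\<Sum>(k, A, B)\<in>?h ` msets_upto e (2 ^ e + l) n. mset_weight A * mset_weight B)"
    by (simp add: sum.reindex[OF inj])
  also have "\<dots> \<le> (\<Sum>(k, A, B)\<in>?S. mset_weight A * mset_weight B)"
    using img by (intro sum_mono2)
      (auto intro!: finite_SigmaI finite_msets_upto mult_nonneg_nonneg mset_weight_nonneg)
  also have "\<dots> = (\<Sum>k\<le>n. \<Sum>(A, B)\<in>msets_upto e (2 ^ e) k \<times> msets_upto e l (n - k).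
      mset_weight A * mset_weight B)"
    by (subst sum.Sigma) (auto intro: finite_msets_upto)
  also have "\<dots> = (\<Sum>k\<le>n. weighted_count e (2 ^ e) k * weighted_count e l (n - k))"
    unfolding weighted_count_def sum_product by (subst sum.cartesian_product) simp
  finally show ?thesis .
qed

lemma filter_mset_all: "(\<And>x. x \<in># M \<Longrightarrow> P x) \<Longrightarrow> filter_mset P M = M"
  by (induction M) auto

lemma filter_mset_none: "(\<And>x. x \<in># M \<Longrightarrow> \<not> P x) \<Longrightarrow> filter_mset P M = {#}"
  by (induction M) auto

text \<open>Since \<open>l < 2 ^ K\<close>, the exponents in \<open>B\<close> lie below
  \<open>K\<close>, and shifting \<open>A\<close> up by \<open>K\<close> separates the two.
  Filtering at \<open>K\<close> recovers both, which gives injectivity, and disjointness makes the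
  weights multiply.\<close>

lemma weighted_count_merge:
  assumes "l < 2 ^ K"
  shows "(\<Sum>k\<le>n. weighted_count L (2 ^ L) k * weighted_count K l (n - k)) \<le>
    weighted_count (K + L) (2 ^ (K + L) + l) n"
proof -
  let ?S = "SIGMA k:{..n}. msets_upto L (2 ^ L) k \<times> msets_upto K l (n - k)"
  define h where "h = (\<lambda>(k::nat, A, B). image_mset ((+) K) A + B)"
  have low: "set_mset B \<subseteq> {..<K}" if "B \<in> msets_upto K l m" for B m
  proof
    fix x assume "x \<in># B"
    then have "2 ^ x \<le> l" using that by (intro exponent_bound) (auto simp: msets_upto_def)
    then have "(2::nat) ^ x < 2 ^ K" using assms by linarith
    then show "x \<in> {..<K}" by simp
  qed
  have sep: "filter_mset (\<lambda>x. x \<ge> K) (image_mset ((+) K) A + B) = image_mset ((+) K) A"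
    "filter_mset (\<lambda>x. x < K) (image_mset ((+) K) A + B) = B"
    if "B \<in> msets_upto K l m" for A B m
  proof -
    have "filter_mset (\<lambda>x. x \<ge> K) B = {#}"
      using low[OF that] by (intro filter_mset_none) (auto simp: not_le)
    moreover have "filter_mset (\<lambda>x. x < K) B = B"
      using low[OF that] by (intro filter_mset_all) auto
    moreover have "filter_mset (\<lambda>x. x \<ge> K) (image_mset ((+) K) A) = image_mset ((+) K) A"
      by (intro filter_mset_all) auto
    moreover have "filter_mset (\<lambda>x. x < K) (image_mset ((+) K) A) = {#}"
      by (intro filter_mset_none) auto
    ultimately show "filter_mset (\<lambda>x. x \<ge> K) (image_mset ((+) K) A + B) = image_mset ((+) K) A"
      "filter_mset (\<lambda>x. x < K) (image_mset ((+) K) A + B) = B" by simp_all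
  qed
  have inj: "inj_on h ?S"
  proof (rule inj_onI, clarsimp simp: h_def)
    fix k A B k' A' B'
    assume *: "A \<in> msets_upto L (2 ^ L) k" "B \<in> msets_upto K l (n - k)"
      "A' \<in> msets_upto L (2 ^ L) k'" "B' \<in> msets_upto K l (n - k')"
      and eq: "image_mset ((+) K) A + B = image_mset ((+) K) A' + B'"
    have "image_mset ((+) K) A = image_mset ((+) K) A'" "B = B'"
      using sep[OF *(2), of A] sep[OF *(4), of A'] eq by simp_all
    moreover from this have "A = A'"
      using injD[OF multiset.inj_map[OF inj_onI[of UNIV "(+) K"]]] by simp
    ultimately show "k = k' \<and> A = A' \<and> B = B'" using * by (auto simp: msets_upto_def)
  qed
  have img: "h ` ?S \<subseteq> msets_upto (K + L) (2 ^ (K + L) + l) n"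
  proof (rule image_subsetI)
    fix p assume "p \<in> ?S"
    then obtain k A B where p: "p = (k, A, B)" "k \<le> n"
      "A \<in> msets_upto L (2 ^ L) k" "B \<in> msets_upto K l (n - k)" by auto
    have "(\<Sum>x\<in>#A. (2::nat) ^ (K + x)) = 2 ^ K * (\<Sum>x\<in>#A. 2 ^ x)"
      by (simp add: power_add sum_mset_distrib_left)
    moreover have "set_mset B \<subseteq> {..K + L}" using p(4) by (auto simp: msets_upto_def)
    ultimately show "h p \<in> msets_upto (K + L) (2 ^ (K + L) + l) n"
      using p by (auto simp: h_def msets_upto_def power_add image_mset.compositionality comp_def)
  qed
  have wt: "mset_weight (h (k, A, B)) = mset_weight A * mset_weight B"
    if "B \<in> msets_upto K l m" for k A B m
  proof -
    have "set_mset (image_mset ((+) K) A) \<inter> set_mset B = {}"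
      using low[OF that] by auto
    then show ?thesis
      by (simp add: h_def mset_weight_add_disjoint mset_weight_image)
  qed
  have "(\<Sum>k\<le>n. weighted_count L (2 ^ L) k * weighted_count K l (n - k)) =
      (\<Sum>k\<le>n. \<Sum>(A, B)\<in>msets_upto L (2 ^ L) k \<times> msets_upto K l (n - k).
        mset_weight A * mset_weight B)"
    unfolding weighted_count_def sum_product by (subst sum.cartesian_product) simp
  also have "\<dots> = (\<Sum>(k, A, B)\<in>?S. mset_weight A * mset_weight B)"
    by (subst sum.Sigma) (auto intro: finite_msets_upto)
  also have "\<dots> = (\<Sum>p\<in>?S. mset_weight (h p))"
    using wt by (intro sum.cong) auto
  also have "\<dots> = (\<Sum>M\<in>h ` ?S. mset_weight M)"
    by (simp add: sum.reindex[OF inj])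
  also have "\<dots> \<le> weighted_count (K + L) (2 ^ (K + L) + l) n"
    unfolding weighted_count_def
    by (intro sum_mono2 finite_msets_upto img mset_weight_nonneg)
  finally show ?thesis .
qed

text \<open>Doubling every part is a weight-preserving embedding; it is the source of all
  monotonicity in the level.\<close>

lemma weighted_count_shift:
  "weighted_count L l n \<le> weighted_count (Suc L) (2 * l) n"
proof -
  have inj: "inj_on (image_mset Suc) (msets_upto L l n)"
    using inj_on_subset[OF multiset.inj_map[OF inj_Suc]] by blast
  have "weighted_count L l n = (\<Sum>M\<in>image_mset Suc ` msets_upto L l n. mset_weight M)"
    unfolding weighted_count_def by (simp add: sum.reindex[OF inj] mset_weight_image)
  also have "\<dots> \<le> weighted_count (Suc L) (2 * l) n"
    unfolding weighted_count_def
    by (intro sum_mono2 finite_msets_upto mset_weight_nonneg)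
      (auto simp: msets_upto_def image_mset.compositionality comp_def sum_mset_distrib_left)
  finally show ?thesis .
qed

text \<open>The \<open>i\<close> parts equal to the unit \<open>2 ^ Suc L\<close> have weight
  \<open>1 / fact i\<close>; the other \<open>j - i\<close> units are \<open>2 * (j - i)\<close>
  half units made of parts up to \<open>2 ^ L\<close>. The range \<open>min j n\<close> keeps both
  subtractions exact.\<close>

lemma weighted_count_top_level:
  "weighted_count (Suc L) (j * 2 ^ Suc L) n =
    (\<Sum>i\<le>min j n. weighted_count L (2 * (j - i) * 2 ^ L) (n - i) / fact i)"
proof -
  let ?S = "SIGMA i:{..min j n}. msets_upto L (2 * (j - i) * 2 ^ L) (n - i)"
  define h where "h = (\<lambda>(i, B). replicate_mset i (Suc L) + B)"
  have notin: "Suc L \<notin># B" if "B \<in> msets_upto L m k" for B m k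
    using that by (auto simp: msets_upto_def)
  have inj: "inj_on h ?S"
  proof (rule inj_onI, clarsimp simp: h_def)
    fix i A k B
    assume *: "A \<in> msets_upto L (2 * (j - i) * 2 ^ L) (n - i)"
       "B \<in> msets_upto L (2 * (j - k) * 2 ^ L) (n - k)"
      and eq: "replicate_mset i (Suc L) + A = replicate_mset k (Suc L) + B"
    have "count (replicate_mset i (Suc L) + A) (Suc L) =
        count (replicate_mset k (Suc L) + B) (Suc L)" using eq by simp
    then have "i = k" using notin[OF *(1)] notin[OF *(2)] by (simp add: not_in_iff)
    then show "i = k \<and> A = B" using eq by simp
  qed
  have img: "h ` ?S = msets_upto (Suc L) (j * 2 ^ Suc L) n"
  proof (intro equalityI image_subsetI subsetI)
    fix p assume "p \<in> ?S"
    then obtain i B where p: "p = (i, B)" "i \<le> j" "i \<le> n"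
      "B \<in> msets_upto L (2 * (j - i) * 2 ^ L) (n - i)" by auto
    have "i * (2 * 2 ^ L) + 2 * (j - i) * 2 ^ L = j * (2 * (2::nat) ^ L)"
      using p(2) by (simp add: algebra_simps diff_mult_distrib2)
    then show "h p \<in> msets_upto (Suc L) (j * 2 ^ Suc L) n"
      using p by (auto simp: h_def msets_upto_def set_mset_replicate_mset_subset sum_mset_replicate_mset)
  next
    fix M assume M: "M \<in> msets_upto (Suc L) (j * 2 ^ Suc L) n"
    define i where "i = count M (Suc L)"
    define B where "B = filter_mset (\<lambda>x. x \<noteq> Suc L) M"
    have split: "M = replicate_mset i (Suc L) + B"
      unfolding i_def B_def by (rule multiset_eqI) simp
    have sz: "size M = n" "(\<Sum>x\<in>#M. 2 ^ x) = j * 2 ^ Suc L" "set_mset M \<subseteq> {..Suc L}"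
      using M by (auto simp: msets_upto_def)
    have n: "i + size B = n" using sz(1) split by simp
    have s: "i * 2 ^ Suc L + (\<Sum>x\<in>#B. 2 ^ x) = j * 2 ^ Suc L"
      using sz(2) by (subst (asm) split) simp
    then have "i * 2 ^ Suc L \<le> j * 2 ^ Suc L" by linarith
    then have ij: "i \<le> j" by simp
    have "(\<Sum>x\<in>#B. 2 ^ x) = 2 * (j - i) * 2 ^ L"
      using s ij by (simp add: algebra_simps diff_mult_distrib2)
    moreover have "set_mset B \<subseteq> {..L}"
    proof
      fix x assume "x \<in># B"
      then have "x \<in># M" "x \<noteq> Suc L" by (auto simp: B_def)
      with sz(3) show "x \<in> {..L}" by (auto simp: le_Suc_eq)
    qed
    ultimately have "(i, B) \<in> ?S" using n ij by (auto simp: msets_upto_def)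
    then show "M \<in> h ` ?S" using split by (force simp: h_def image_iff)
  qed
  have wt: "mset_weight (h (i, B)) = mset_weight B / fact i" if "B \<in> msets_upto L m k" for i B m k
    using notin[OF that] by (subst h_def)
      (simp add: mset_weight_add_disjoint set_mset_replicate_mset_subset)
  have "weighted_count (Suc L) (j * 2 ^ Suc L) n = (\<Sum>p\<in>?S. mset_weight (h p))"
    unfolding weighted_count_def img[symmetric] by (simp add: sum.reindex[OF inj])
  also have "\<dots> = (\<Sum>(i, B)\<in>?S. mset_weight B / fact i)"
    using wt by (intro sum.cong) auto
  also have "\<dots> = (\<Sum>i\<le>min j n. \<Sum>B\<in>msets_upto L (2 * (j - i) * 2 ^ L) (n - i). mset_weight B / fact i)"
    by (subst sum.Sigma) (auto intro: finite_msets_upto)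
  finally show ?thesis
    by (simp add: weighted_count_def sum_divide_distrib)
qed

section \<open>Powers of the generating function\<close>

lemma bin_digit_sum_eq_1_iff: "bin_digit_sum l = 1 \<longleftrightarrow> (\<exists>e. l = 2 ^ e)"
proof (induction l rule: less_induct)
  case (less l)
  have pos: "bin_digit_sum m = 0 \<longleftrightarrow> m = 0" for m
  proof (induction m rule: less_induct)
    case (less m)
    show ?case
    proof (cases "m = 0")
      case False
      then have "m div 2 < m" by simp
      with less False show ?thesis
        by (subst bin_digit_sum.simps) (auto simp: div_eq_0_iff less_2_cases_iff)
    qed (simp add: bin_digit_sum.simps)
  qed
  show ?case
  proof (cases "l = 0")
    case False
    then have lt: "l div 2 < l" by simp
    show ?thesis
    proof (cases "even l")
      case True
      then have "bin_digit_sum l = bin_digit_sum (l div 2)"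
        using False by (subst bin_digit_sum.simps) simp
      moreover have "(\<exists>e. l div 2 = 2 ^ e) \<longleftrightarrow> (\<exists>e. l = 2 ^ e)"
      proof
        assume "\<exists>e. l div 2 = 2 ^ e"
        then obtain e where "l div 2 = 2 ^ e" by blast
        then have "l = 2 ^ Suc e" using True by (metis dvd_mult_div_cancel power_Suc)
        then show "\<exists>e. l = 2 ^ e" by blast
      next
        assume "\<exists>e. l = 2 ^ e"
        then obtain e where "l = 2 ^ e" by blast
        then show "\<exists>e. l div 2 = 2 ^ e" using True by (cases e) auto
      qed
      ultimately show ?thesis using less[OF lt] by simp
    next
      case odd: False
      then have "bin_digit_sum l = 1 + bin_digit_sum (l div 2)"
        using False by (subst bin_digit_sum.simps) (simp add: odd_iff_mod_2_eq_one)
      then have "bin_digit_sum l = 1 \<longleftrightarrow> l div 2 = 0" using pos by simp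
      also have "\<dots> \<longleftrightarrow> (\<exists>e. l = 2 ^ e)"
      proof
        assume "l div 2 = 0"
        with False have "l = 2 ^ 0" by auto
        then show "\<exists>e. l = 2 ^ e" by blast
      next
        assume "\<exists>e. l = 2 ^ e"
        then obtain e where "l = 2 ^ e" by blast
        with odd show "l div 2 = 0" by (cases e) auto
      qed
      finally show ?thesis .
    qed
  qed (simp add: bin_digit_sum.simps)
qed

definition w2_coeff :: "nat \<Rightarrow> real"
  where "w2_coeff n = real (W2 1 n) / fact n"

lemma W2_1_eq: "W2 1 n = Max (range (\<lambda>e. U2 (2 ^ e) n))"
proof -
  have "{U2 l n |l. l > 0 \<and> bin_digit_sum l = 1} = range (\<lambda>e. U2 (2 ^ e) n)"
    unfolding bin_digit_sum_eq_1_iff by auto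
  then show ?thesis by (simp add: W2_def)
qed

lemma finite_range_U2_pow: "finite (range (\<lambda>e. U2 (2 ^ e) n))"
  by (rule finite_subset[OF _ finite_range_U2[of n]]) auto

lemma weighted_count_pow2: "weighted_count e (2 ^ e) n = real (U2 (2 ^ e) n) / fact n"
  by (rule weighted_count_eq_U2) simp

lemma weighted_count_pow2_le: "weighted_count e (2 ^ e) n \<le> w2_coeff n"
proof -
  have "U2 (2 ^ e) n \<le> W2 1 n"
    unfolding W2_1_eq by (rule Max_ge[OF finite_range_U2_pow]) simp
  then show ?thesis
    by (simp add: weighted_count_pow2 w2_coeff_def divide_right_mono)
qed

lemma weighted_count_level_mono:
  "incseq (\<lambda>L. weighted_count L (j * 2 ^ L) n)"
  by (rule incseq_SucI) (use weighted_count_shift[of _ "j * 2 ^ _"] in \<open>simp add: ac_simps\<close>)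

text \<open>Finitely many values occur, so the maximum over \<open>e\<close> is attained;
  monotonicity in the level keeps it attained from there on.\<close>

lemma weighted_count_pow2_eventually:
  "\<forall>\<^sub>F L in sequentially. weighted_count L (2 ^ L) n = w2_coeff n"
proof -
  have "W2 1 n \<in> range (\<lambda>e. U2 (2 ^ e) n)"
    unfolding W2_1_eq by (rule Max_in[OF finite_range_U2_pow]) simp
  then obtain e where e: "W2 1 n = U2 (2 ^ e) n" by blast
  have "weighted_count L (2 ^ L) n = w2_coeff n" if "e \<le> L" for L
  proof (rule antisym[OF weighted_count_pow2_le])
    have "w2_coeff n = weighted_count e (2 ^ e) n"
      using e by (simp add: weighted_count_pow2 w2_coeff_def)
    also have "\<dots> \<le> weighted_count L (2 ^ L) n"
      using incseqD[OF weighted_count_level_mono[of 1 n] that] by simp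
    finally show "w2_coeff n \<le> weighted_count L (2 ^ L) n" .
  qed
  then show ?thesis unfolding eventually_sequentially by blast
qed

lemma w2_coeff_nonneg: "w2_coeff n \<ge> 0"
  by (simp add: w2_coeff_def)

abbreviation w2_fps :: "real fps"
  where "w2_fps \<equiv> Abs_fps w2_coeff"

lemma w2_fps_power_nonneg: "fps_nth (w2_fps ^ s) n \<ge> 0"
proof (induction s arbitrary: n)
  case (Suc s)
  then show ?case by (auto simp: fps_mult_nth intro!: sum_nonneg mult_nonneg_nonneg w2_coeff_nonneg)
qed (simp add: fps_one_nth)

section \<open>Representation numbers against coefficients of powers\<close>

text \<open>The induction strips the leading binary digit, and each digit contributes one factor.
  The same \<open>s\<close> has to serve all \<open>n\<close>, because the convolution in the step
  involves all smaller sizes.\<close>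

lemma U2_le_w2_fps_power:
  assumes "l > 0"
  shows "\<exists>s\<ge>1. \<forall>n. real (U2 l n) / fact n \<le> fps_nth (w2_fps ^ s) n"
  using assms
proof (induction l rule: less_induct)
  case (less l)
  obtain e where e: "2 ^ e \<le> l" "l < 2 ^ Suc e"
    using ex_power_ivl1[of 2 l] less.prems by auto
  define m where "m = l - 2 ^ e"
  have l: "l = 2 ^ e + m" using e by (simp add: m_def)
  have m: "m < 2 ^ e" using e by (simp add: m_def)
  show ?case
  proof (cases "m = 0")
    case True
    have "real (U2 l n) / fact n \<le> fps_nth (w2_fps ^ 1) n" for n
      using weighted_count_pow2_le[of e n] by (simp add: weighted_count_pow2 l True)
    then show ?thesis by blast
  next
    case False
    have "m < l" using l by simp
    with False less.IH obtain s where
      s: "\<And>n. real (U2 m n) / fact n \<le> fps_nth (w2_fps ^ s) n" by blast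
    have "real (U2 l n) / fact n \<le> fps_nth (w2_fps ^ Suc s) n" for n
    proof -
      have "real (U2 l n) / fact n = weighted_count e (2 ^ e + m) n"
        using e(2) l by (simp add: weighted_count_eq_U2)
      also have "\<dots> \<le> (\<Sum>k\<le>n. weighted_count e (2 ^ e) k * weighted_count e m (n - k))"
        by (rule weighted_count_split_top[OF m])
      also have "\<dots> \<le> (\<Sum>k\<le>n. w2_coeff k * fps_nth (w2_fps ^ s) (n - k))"
        by (intro sum_mono mult_mono weighted_count_pow2_le weighted_count_nonneg w2_coeff_nonneg
            order_trans[OF weighted_count_le_U2 s])
      also have "\<dots> = fps_nth (w2_fps ^ Suc s) n"
        by (simp add: fps_mult_nth atMost_atLeast0)
      finally show ?thesis .
    qed
    then show ?thesis by (intro exI[of _ "Suc s"]) auto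
  qed
qed

text \<open>New digits are placed so far above \<open>l\<close> that a single digit has reached its
  limiting count for all sizes up to \<open>N\<close>. The convolution again requires one
  \<open>l\<close> for all these sizes. The clause on positivity is conditional because
  \<open>s = 0\<close> is realised by \<open>l = 0\<close>.\<close>

lemma w2_fps_power_le_U2:
  "\<exists>l. (s > 0 \<longrightarrow> l > 0) \<and> (\<forall>n\<le>N. fps_nth (w2_fps ^ s) n \<le> real (U2 l n) / fact n)"
proof (induction s)
  case 0
  have "reps2 0 0 = {[]}" by (auto simp: reps2_def)
  then have "fps_nth (w2_fps ^ 0) n \<le> real (U2 0 n) / fact n" for n
    by (cases "n = 0") (auto simp: U2_def)
  then show ?case by blast
next
  case (Suc s)
  then obtain l where l: "\<And>n. n \<le> N \<Longrightarrow> fps_nth (w2_fps ^ s) n \<le> real (U2 l n) / fact n"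
    by blast
  have "\<forall>\<^sub>F L in sequentially. \<forall>k\<in>{..N}. weighted_count L (2 ^ L) k = w2_coeff k"
    by (intro eventually_ball_finite) (auto intro: weighted_count_pow2_eventually)
  then obtain L where L: "\<And>k. k \<le> N \<Longrightarrow> weighted_count L (2 ^ L) k = w2_coeff k"
    unfolding eventually_sequentially by auto
  \<comment> \<open>The number \<open>l\<close> itself is used as a cut-off exponent lying above all
    of its own digits.\<close>
  have K: "l < 2 ^ l" by (rule less_exp)
  have "fps_nth (w2_fps ^ Suc s) n \<le> real (U2 (2 ^ (l + L) + l) n) / fact n" if "n \<le> N" for n
  proof -
    have "fps_nth (w2_fps ^ Suc s) n = (\<Sum>k\<le>n. w2_coeff k * fps_nth (w2_fps ^ s) (n - k))"
      by (simp add: fps_mult_nth atMost_atLeast0)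
    also have "\<dots> \<le> (\<Sum>k\<le>n. weighted_count L (2 ^ L) k * weighted_count l l (n - k))"
    proof (intro sum_mono mult_mono)
      fix k assume k: "k \<in> {..n}"
      show "w2_coeff k \<le> weighted_count L (2 ^ L) k" using L[of k] k that by simp
      have "weighted_count l l (n - k) = real (U2 l (n - k)) / fact (n - k)"
        by (rule weighted_count_eq_U2) (use K in \<open>unfold power_Suc, linarith\<close>)
      then show "fps_nth (w2_fps ^ s) (n - k) \<le> weighted_count l l (n - k)"
        using l[of "n - k"] that by simp
    qed (auto simp: weighted_count_nonneg w2_fps_power_nonneg)
    also have "\<dots> \<le> weighted_count (l + L) (2 ^ (l + L) + l) n"
      by (rule weighted_count_merge[OF K])
    also have "\<dots> \<le> real (U2 (2 ^ (l + L) + l) n) / fact n"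
      by (rule weighted_count_le_U2)
    finally show ?thesis .
  qed
  then show ?case by (intro exI[of _ "2 ^ (l + L) + l"]) auto
qed

lemma finite_U2_values: "finite {U2 l n |l. l > 0}"
  by (rule finite_subset[OF _ finite_range_U2[of n]]) auto

lemma w2_fps_power_le_M2:
  assumes "s \<ge> 1"
  shows "fps_nth (w2_fps ^ s) n \<le> real (M2 n) / fact n"
proof -
  obtain l where l: "l > 0" "fps_nth (w2_fps ^ s) n \<le> real (U2 l n) / fact n"
    using w2_fps_power_le_U2[of s n] assms by auto
  have "U2 l n \<le> M2 n"
    unfolding M2_def by (rule Max_ge[OF finite_U2_values]) (use l(1) in blast)
  then have "real (U2 l n) / fact n \<le> real (M2 n) / fact n" by (simp add: divide_right_mono)
  with l(2) show ?thesis by linarith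
qed

lemma M2_le_w2_fps_power: "\<exists>s\<ge>1. real (M2 n) / fact n \<le> fps_nth (w2_fps ^ s) n"
proof -
  have "M2 n \<in> {U2 l n |l. l > 0}"
    unfolding M2_def by (rule Max_in[OF finite_U2_values]) blast
  then obtain l where "l > 0" "M2 n = U2 l n" by blast
  with U2_le_w2_fps_power[of l] show ?thesis by auto
qed

lemma U2_0_right: "l > 0 \<Longrightarrow> U2 l 0 = 0"
  by (auto simp: U2_def reps2_def)

lemma w2_coeff_0 [simp]: "w2_coeff 0 = 0"
proof -
  have "range (\<lambda>e. U2 (2 ^ e) 0) = {0}" by (auto simp: U2_0_right)
  then show ?thesis unfolding w2_coeff_def W2_1_eq by simp
qed

text \<open>With the largest available power of two as the unit, \<open>open_node_coeff j n\<close> is the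
  normalised number of ways to write \<open>j\<close> as a sum of \<open>n\<close> powers \<open>2 ^ (- a)\<close>, \<open>a \<ge> 0\<close>.\<close>

definition open_node_coeff :: "nat \<Rightarrow> nat \<Rightarrow> real"
  where "open_node_coeff j n = lim (\<lambda>L. weighted_count L (j * 2 ^ L) n)"

text \<open>The sequence increases by doubling, and it is bounded because the bound on
  \<open>U2 l n\<close> is uniform in \<open>l\<close>.\<close>

lemma weighted_count_tendsto:
  "(\<lambda>L. weighted_count L (j * 2 ^ L) n) \<longlonglongrightarrow> open_node_coeff j n"
proof -
  obtain B where B: "\<And>l. U2 l n \<le> B" using reps2_finite_bounded by blast
  have "weighted_count L (j * 2 ^ L) n \<le> real B / fact n" for L
    using weighted_count_le_U2[of L "j * 2 ^ L" n] B[of "j * 2 ^ L"]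
    by (meson divide_right_mono fact_ge_zero of_nat_le_iff order_trans)
  then obtain y where "(\<lambda>L. weighted_count L (j * 2 ^ L) n) \<longlonglongrightarrow> y"
    using incseq_convergent[OF weighted_count_level_mono] by metis
  then show ?thesis unfolding open_node_coeff_def by (simp add: limI)
qed

lemma open_node_coeff_nonneg: "open_node_coeff j n \<ge> 0"
  by (rule LIMSEQ_le_const[OF weighted_count_tendsto]) (auto simp: weighted_count_nonneg)

lemma open_node_coeff_rec:
  "open_node_coeff j n = (\<Sum>i\<le>min j n. open_node_coeff (2 * (j - i)) (n - i) / fact i)"
proof (rule LIMSEQ_unique)
  show "(\<lambda>L. weighted_count (Suc L) (j * 2 ^ Suc L) n) \<longlonglongrightarrow> open_node_coeff j n"
    by (rule LIMSEQ_Suc[OF weighted_count_tendsto])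
  show "(\<lambda>L. weighted_count (Suc L) (j * 2 ^ Suc L) n) \<longlonglongrightarrow>
      (\<Sum>i\<le>min j n. open_node_coeff (2 * (j - i)) (n - i) / fact i)"
    unfolding weighted_count_top_level
    by (intro tendsto_sum tendsto_divide weighted_count_tendsto) auto
qed

lemma open_node_coeff_1: "open_node_coeff 1 n = w2_coeff n"
proof (rule LIMSEQ_unique[OF weighted_count_tendsto])
  show "(\<lambda>L. weighted_count L (1 * 2 ^ L) n) \<longlonglongrightarrow> w2_coeff n"
    by (rule tendsto_eventually) (use weighted_count_pow2_eventually[of n] in simp)
qed

lemma open_node_coeff_0: "open_node_coeff 0 n = (if n = 0 then 1 else 0)"
proof (rule LIMSEQ_unique[OF weighted_count_tendsto])
  have "reps2 0 n = (if n = 0 then {[]} else {})"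
  proof -
    have "a = []" if "(\<Sum>e\<leftarrow>a. (2::nat) ^ e) = 0" for a
      using that by (cases a) auto
    then show ?thesis by (auto simp: reps2_def)
  qed
  then have "weighted_count L (0 * 2 ^ L) n = (if n = 0 then 1 else 0)" for L
    by (simp add: weighted_count_eq_U2 U2_def)
  then show "(\<lambda>L. weighted_count L (0 * 2 ^ L) n) \<longlonglongrightarrow> (if n = 0 then 1 else 0)"
    by simp
qed

text \<open>This is the row \<open>j = 1\<close>: the unit is used whole, giving \<open>x\<close>,
  or it is halved. Thus W = x + F 2. As the recursion leads only to even indices, everything below
  concerns \<open>open_node_coeff (2 * m)\<close>.\<close>

lemma w2_coeff_eq:
  "w2_coeff n = open_node_coeff 2 n + (if n = 1 then 1 else 0)"
proof -
  have "w2_coeff n = (\<Sum>i\<le>min 1 n. open_node_coeff (2 * (1 - i)) (n - i) / fact i)"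
    using open_node_coeff_rec[of 1 n] by (simp only: open_node_coeff_1)
  also have "\<dots> = open_node_coeff 2 n + (if n = 1 then 1 else 0)"
    by (cases "n = 0") (auto simp: min_def open_node_coeff_0)
  finally show ?thesis .
qed

lemma weighted_count_0_le: "weighted_count 0 l n \<le> (if n = l then 1 / fact l else 0)"
proof -
  have "M = replicate_mset n 0" if "M \<in> msets_upto 0 l n" for M
    using that by (auto simp: msets_upto_def dest: set_mset_subset_singletonD)
  moreover have "n = l" if "replicate_mset n 0 \<in> msets_upto 0 l n"
    using that by (auto simp: msets_upto_def sum_mset_replicate_mset)
  ultimately have sub: "msets_upto 0 l n \<subseteq> (if n = l then {replicate_mset n (0::nat)} else {})" by auto
  have "weighted_count 0 l n \<le> (\<Sum>M\<in>(if n = l then {replicate_mset n (0::nat)} else {}). mset_weight M)"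
    unfolding weighted_count_def by (intro sum_mono2 sub mset_weight_nonneg) auto
  then show ?thesis by (auto split: if_splits)
qed

lemma sum_antidiagonal_le:
  fixes a :: "nat \<Rightarrow> nat \<Rightarrow> real"
  assumes "\<And>i m. i \<le> j \<Longrightarrow> a i m \<ge> 0"
  shows "(\<Sum>n\<le>N. \<Sum>i\<le>min j n. a i (n - i)) \<le> (\<Sum>i\<le>j. \<Sum>m\<le>N. a i m)"
proof -
  let ?S = "SIGMA n:{..N}. {..min j n}"
  let ?f = "\<lambda>(n, i). (i, n - i)"
  have inj: "inj_on ?f ?S" by (auto simp: inj_on_def)
  have "(\<Sum>n\<le>N. \<Sum>i\<le>min j n. a i (n - i)) = (\<Sum>(n, i)\<in>?S. a i (n - i))"
    by (subst sum.Sigma) auto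
  also have "\<dots> = (\<Sum>(i, m)\<in>?f ` ?S. a i m)"
    by (subst sum.reindex[OF inj]) (auto intro: sum.cong)
  also have "\<dots> \<le> (\<Sum>(i, m)\<in>{..j} \<times> {..N}. a i m)"
    by (rule sum_mono2) (use assms in auto)
  also have "\<dots> = (\<Sum>i\<le>j. \<Sum>m\<le>N. a i m)"
    by (subst sum.cartesian_product) simp
  finally show ?thesis .
qed

section \<open>Comparison with supersolutions\<close>

text \<open>One more level is one application of the recursion, so a supersolution stays above the
  truncated counts by induction on the level. At level 0 only \<open>2 * m\<close> whole units
  occur; this is the term \<open>i = 2 * m\<close> of the inequality, covered because
  \<open>g 0 \<ge> 1\<close>. Partial sums are compared since convergence is only a
  consequence.\<close>

lemma open_node_partial_sum_le:
  fixes g :: "nat \<Rightarrow> real"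
  assumes x: "x \<ge> 0" and g0: "g 0 \<ge> 1" and g: "\<And>m. g m \<ge> 0"
    and super: "\<And>m. m \<ge> 1 \<Longrightarrow> (\<Sum>i\<le>2 * m. x ^ i / fact i * g (2 * m - i)) \<le> g m"
  shows "(\<Sum>n\<le>N. open_node_coeff (2 * m) n * x ^ n) \<le> g m"
proof -
  have lev: "(\<Sum>n\<le>N. weighted_count L (2 * m * 2 ^ L) n * x ^ n) \<le> g m" for L
  proof (induction L arbitrary: m)
    case 0
    have "(\<Sum>n\<le>N. weighted_count 0 (2 * m * 2 ^ 0) n * x ^ n) \<le>
        (\<Sum>n\<le>N. (if n = 2 * m then 1 / fact (2 * m) else 0) * x ^ n)"
      by (intro sum_mono mult_right_mono) (use x weighted_count_0_le[of "2 * m"] in auto)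
    also have "\<dots> = (\<Sum>n\<le>N. if n = 2 * m then x ^ (2 * m) / fact (2 * m) else 0)"
      by (intro sum.cong) auto
    also have "\<dots> \<le> x ^ (2 * m) / fact (2 * m)"
      using x by (simp add: sum.delta)
    also have "\<dots> \<le> g m"
    proof (cases "m = 0")
      case False
      have "x ^ (2 * m) / fact (2 * m) \<le> x ^ (2 * m) / fact (2 * m) * g (2 * m - 2 * m)"
        using x g0 mult_left_mono[of 1 "g 0" "x ^ (2 * m) / fact (2 * m)"] by simp
      also have "\<dots> \<le> (\<Sum>i\<le>2 * m. x ^ i / fact i * g (2 * m - i))"
        by (rule member_le_sum) (use x g in auto)
      also have "\<dots> \<le> g m" by (rule super) (use False in simp)
      finally show ?thesis .
    qed (use g0 in simp)
    finally show ?case .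
  next
    case (Suc L)
    let ?a = "\<lambda>i k. x ^ i / fact i * (weighted_count L (2 * (2 * m - i) * 2 ^ L) k * x ^ k)"
    show ?case
    proof (cases "m = 0")
      case True
      have "weighted_count (Suc L) 0 n = weighted_count L 0 n" for n
        by (simp add: weighted_count_eq_U2)
      with True Suc.IH[of 0] show ?thesis by simp
    next
      case False
      have "(\<Sum>n\<le>N. weighted_count (Suc L) (2 * m * 2 ^ Suc L) n * x ^ n) =
          (\<Sum>n\<le>N. \<Sum>i\<le>min (2 * m) n. ?a i (n - i))"
        unfolding weighted_count_top_level sum_distrib_right
        by (intro sum.cong refl) (auto simp flip: power_add)
      also have "\<dots> \<le> (\<Sum>i\<le>2 * m. \<Sum>k\<le>N. ?a i k)"
        by (rule sum_antidiagonal_le) (use x in \<open>auto simp: weighted_count_nonneg\<close>)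
      also have "\<dots> \<le> (\<Sum>i\<le>2 * m. x ^ i / fact i * g (2 * m - i))"
        unfolding sum_distrib_left[symmetric]
        by (intro sum_mono mult_left_mono Suc.IH) (use x in auto)
      also have "\<dots> \<le> g m" by (rule super) (use False in simp)
      finally show ?thesis .
    qed
  qed
  show ?thesis
  proof (rule LIMSEQ_le_const2)
    show "(\<lambda>L. \<Sum>n\<le>N. weighted_count L (2 * m * 2 ^ L) n * x ^ n) \<longlonglongrightarrow>
        (\<Sum>n\<le>N. open_node_coeff (2 * m) n * x ^ n)"
      by (intro tendsto_sum tendsto_mult weighted_count_tendsto tendsto_const)
  qed (use lev in auto)
qed

lemma sums_antidiagonal:
  fixes a :: "nat \<Rightarrow> nat \<Rightarrow> real"
  assumes "\<And>i. i \<le> j \<Longrightarrow> a i sums s i"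
  shows "(\<lambda>n. \<Sum>i\<le>min j n. a i (n - i)) sums (\<Sum>i\<le>j. s i)"
proof -
  have "(\<lambda>n. if i \<le> n then a i (n - i) else 0) sums s i" if "i \<le> j" for i
    using sums_iff_shift[of "\<lambda>n. if i \<le> n then a i (n - i) else 0" i "s i"] assms[OF that]
    by simp
  then have "(\<lambda>n. \<Sum>i\<le>j. if i \<le> n then a i (n - i) else 0) sums (\<Sum>i\<le>j. s i)"
    by (intro sums_sum) auto
  moreover have "(\<Sum>i\<le>j. if i \<le> n then a i (n - i) else 0) = (\<Sum>i\<le>min j n. a i (n - i))" for n
    by (intro sum.mono_neutral_cong_right) auto
  ultimately show ?thesis by simp
qed

section \<open>A supersolution of the recursion\<close>

text \<open>An upper bound for the generating function of \<open>open_node_coeff (2 * m)\<close> at \<open>13/20\<close>: for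
  \<open>m < 6\<close> the actual values, rounded up by about 0.1 percent; beyond that they decay faster than
  any geometric sequence, so that the ratio \<open>1/20\<close> is more than enough.\<close>

definition node_bound :: "nat \<Rightarrow> real"
  where "node_bound m = (if m < 6
    then [1, 760349 / 10^6, 546608 / 10^7, 1309848 / 10^9, 1529753 / 10^11, 1047573 / 10^13] ! m
    else 5 / 10^10 * (1 / 20) ^ (m - 6))"

lemma node_bound_nonneg: "node_bound m \<ge> 0"
proof -
  have "m = 0 \<or> m = 1 \<or> m = 2 \<or> m = 3 \<or> m = 4 \<or> m = 5 \<or> m \<ge> 6" by linarith
  then show ?thesis by (auto simp: node_bound_def)
qed

lemma sum_atMost_numeral:
  fixes f :: "nat \<Rightarrow> real"
  shows "(\<Sum>i\<le>2. f i) = f 0 + f 1 + f 2"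
    "(\<Sum>i\<le>4. f i) = f 0 + f 1 + f 2 + f 3 + f 4"
    "(\<Sum>i\<le>6. f i) = f 0 + f 1 + f 2 + f 3 + f 4 + f 5 + f 6"
    "(\<Sum>i\<le>8. f i) = f 0 + f 1 + f 2 + f 3 + f 4 + f 5 + f 6 + f 7 + f 8"
    "(\<Sum>i\<le>10. f i) = f 0 + f 1 + f 2 + f 3 + f 4 + f 5 + f 6 + f 7 + f 8 + f 9 + f 10"
  by (simp_all add: eval_nat_numeral)

lemma node_bound_numeral:
  "node_bound 0 = 1" "node_bound 1 = 760349 / 10^6" "node_bound 2 = 546608 / 10^7"
  "node_bound 3 = 1309848 / 10^9" "node_bound 4 = 1529753 / 10^11"
  "node_bound 5 = 1047573 / 10^13" "node_bound 6 = 5 / 10^10" "node_bound 7 = 25 / 10^12"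
  "node_bound 8 = 125 / 10^14" "node_bound 9 = 625 / 10^16" "node_bound 10 = 3125 / 10^18"
  by (simp_all add: node_bound_def power_divide)

lemma fact_numeral_upto_10:
  "fact 0 = (1::real)" "fact 1 = (1::real)" "fact 2 = (2::real)" "fact 3 = (6::real)"
  "fact 4 = (24::real)" "fact 5 = (120::real)" "fact 6 = (720::real)" "fact 7 = (5040::real)"
  "fact 8 = (40320::real)" "fact 9 = (362880::real)" "fact 10 = (3628800::real)"
  by (simp_all add: fact_numeral)

lemma antidiagonal_sum_numeral:
  fixes f :: "nat \<Rightarrow> nat \<Rightarrow> real"
  shows "(\<Sum>i\<le>2. f i (2 - i)) = f 0 2 + f 1 1 + f 2 0"
    "(\<Sum>i\<le>4. f i (4 - i)) = f 0 4 + f 1 3 + f 2 2 + f 3 1 + f 4 0"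
    "(\<Sum>i\<le>6. f i (6 - i)) = f 0 6 + f 1 5 + f 2 4 + f 3 3 + f 4 2 + f 5 1 + f 6 0"
    "(\<Sum>i\<le>8. f i (8 - i)) =
      f 0 8 + f 1 7 + f 2 6 + f 3 5 + f 4 4 + f 5 3 + f 6 2 + f 7 1 + f 8 0"
    "(\<Sum>i\<le>10. f i (10 - i)) = f 0 10 + f 1 9 + f 2 8 + f 3 7 + f 4 6 + f 5 5 +
      f 6 4 + f 7 3 + f 8 2 + f 9 1 + f 10 0"
  by (simp_all add: sum_atMost_numeral)

text \<open>With \<open>n = 2 * m - k\<close>, raising \<open>m\<close> by one multiplies the term
  by \<open>(13/20)^2 / ((n + 1) * (n + 2))\<close>; as \<open>n \<ge> 7\<close>, this is far below
  the ratio \<open>1/20\<close> of the geometric tail.\<close>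

lemma power_fact_decay:
  assumes "m \<ge> 6" "k \<le> 5"
  shows "(13/20::real) ^ (2 * m - k) / fact (2 * m - k) \<le>
    (13/20) ^ (12 - k) / fact (12 - k) * (1/20) ^ (m - 6)"
  using assms(1)
proof (induction m rule: dec_induct)
  case base
  then show ?case by simp
next
  case (step m)
  let ?n = "2 * m - k"
  have n: "2 * Suc m - k = Suc (Suc ?n)" using step assms(2) by simp
  have big: "?n \<ge> 7" using step assms(2) by simp
  have "real (Suc (Suc ?n)) * real (Suc ?n) \<ge> 9 * 8"
    using big by (intro mult_mono) auto
  then have ratio: "(13/20)\<^sup>2 / (real (Suc (Suc ?n)) * real (Suc ?n)) \<le> 1/20"
    by (simp add: divide_le_eq power2_eq_square mult.commute)
  have "(13/20::real) ^ (2 * Suc m - k) / fact (2 * Suc m - k) =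
      (13/20) ^ ?n / fact ?n * ((13/20)\<^sup>2 / (real (Suc (Suc ?n)) * real (Suc ?n)))"
    unfolding n by (simp add: power2_eq_square mult_ac)
  also have "\<dots> \<le> (13/20) ^ ?n / fact ?n * (1/20)"
    by (intro mult_left_mono ratio) simp
  also have "\<dots> \<le> (13/20) ^ (12 - k) / fact (12 - k) * (1/20) ^ (m - 6) * (1/20)"
    using step.IH by simp
  also have "\<dots> = (13/20) ^ (12 - k) / fact (12 - k) * (1/20) ^ (Suc m - 6)"
  proof -
    have "Suc m - 6 = Suc (m - 6)" using step(1) by simp
    then show ?thesis by simp
  qed
  finally show ?case .
qed

text \<open>For \<open>r = 1/20\<close> the evaluation point is \<open>13 * r\<close>. All powers of
  \<open>r\<close> then combine to \<open>r ^ (2 * m - 6)\<close>, and a partial sum of the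
  exponential series at 13 is left.\<close>

lemma geometric_tail_sum:
  fixes r c :: real
  assumes "m \<ge> 6"
  shows "(\<Sum>k=6..2 * m. (13 * r) ^ (2 * m - k) / fact (2 * m - k) * (c * r ^ (k - 6))) =
    c * r ^ (2 * m - 6) * (\<Sum>i\<le>2 * m - 6. 13 ^ i / fact i)"
proof -
  have "(13 * r) ^ (2 * m - k) / fact (2 * m - k) * (c * r ^ (k - 6)) =
      c * r ^ (2 * m - 6) * (13 ^ (2 * m - k) / fact (2 * m - k))" if "k \<in> {6..2 * m}" for k
  proof -
    have "2 * m - 6 = (2 * m - k) + (k - 6)" using that by auto
    then have "r ^ (2 * m - 6) = r ^ (2 * m - k) * r ^ (k - 6)" by (simp only: power_add)
    then show ?thesis by (simp add: power_mult_distrib)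
  qed
  then have "(\<Sum>k=6..2 * m. (13 * r) ^ (2 * m - k) / fact (2 * m - k) * (c * r ^ (k - 6))) =
      (\<Sum>k=6..2 * m. c * r ^ (2 * m - 6) * (13 ^ (2 * m - k) / fact (2 * m - k)))"
    by (intro sum.cong) auto
  also have "\<dots> = (\<Sum>i\<le>2 * m - 6. c * r ^ (2 * m - 6) * (13 ^ i / fact i))"
    by (rule sum.reindex_bij_witness[of _ "\<lambda>k. 2 * m - k" "\<lambda>k. 2 * m - k"]) (use assms in auto)
  finally show ?thesis by (simp add: sum_distrib_left)
qed

text \<open>Rows 1 to 5 are finite checks. From row 6 on the sum is cut after \<open>k = 5\<close>:
  the tabulated values are met by factorial decay, the geometric tail by the bound on
  \<open>exp 13\<close>.\<close>

lemma node_bound_super: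
  assumes "m \<ge> 1"
  shows "(\<Sum>i\<le>2 * m. (13/20) ^ i / fact i * node_bound (2 * m - i)) \<le> node_bound m"
proof (cases "m < 6")
  case True
  with assms have "m = 1 \<or> m = 2 \<or> m = 3 \<or> m = 4 \<or> m = 5" by linarith
  then have "2 * m = 2 \<and> m = 1 \<or> 2 * m = 4 \<and> m = 2 \<or> 2 * m = 6 \<and> m = 3 \<or>
    2 * m = 8 \<and> m = 4 \<or> 2 * m = 10 \<and> m = 5" by auto
  then show ?thesis
    by (elim disjE conjE; simp only: antidiagonal_sum_numeral[of "\<lambda>i k. (13/20) ^ i / fact i * node_bound k"]
        node_bound_numeral fact_numeral_upto_10)
      (simp_all add: power_divide)
next
  case False
  then have m: "m \<ge> 6" by simp
  have arith: "(t + c * u * k) * v = t * v + c * (u * v) * k" for t c u k v :: real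
    by (simp add: algebra_simps)
  let ?x = "13/20 :: real" and ?r = "1/20 :: real" and ?C = "5 / 10^10 :: real"
  let ?L = "\<Sum>k\<le>5. ?x ^ (2 * m - k) / fact (2 * m - k) * node_bound k"
  let ?H = "\<Sum>k=6..2 * m. ?x ^ (2 * m - k) / fact (2 * m - k) * node_bound k"
  let ?T = "\<Sum>k\<le>5. ?x ^ (12 - k) / fact (12 - k) * node_bound k"
  have "(\<Sum>i\<le>2 * m. ?x ^ i / fact i * node_bound (2 * m - i)) =
      (\<Sum>k\<le>2 * m. ?x ^ (2 * m - k) / fact (2 * m - k) * node_bound k)"
    by (rule sum.reindex_bij_witness[of _ "\<lambda>k. 2 * m - k" "\<lambda>k. 2 * m - k"]) auto
  also have "\<dots> = ?L + ?H"
  proof -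
    have "{..2 * m} = {..5} \<union> {6..2 * m}" using m by auto
    then show ?thesis by (simp only:) (intro sum.union_disjoint; auto)
  qed
  finally have split: "(\<Sum>i\<le>2 * m. ?x ^ i / fact i * node_bound (2 * m - i)) = ?L + ?H" .
  have "?L \<le> (\<Sum>k\<le>5. (?x ^ (12 - k) / fact (12 - k) * ?r ^ (m - 6)) * node_bound k)"
    by (intro sum_mono mult_right_mono power_fact_decay m node_bound_nonneg) auto
  also have "\<dots> = ?T * ?r ^ (m - 6)"
    unfolding sum_distrib_right by (intro sum.cong refl) simp
  finally have L: "?L \<le> ?T * ?r ^ (m - 6)" .
  have "(\<Sum>i\<le>2 * m - 6. (13::real) ^ i /\<^sub>R fact i) \<le> (\<Sum>i. 13 ^ i /\<^sub>R fact i)"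
    by (rule sum_le_suminf[OF summable_exp_generic]) auto
  then have "(\<Sum>i\<le>2 * m - 6. (13::real) ^ i / fact i) \<le> exp 13"
    by (simp add: exp_def divide_inverse mult.commute)
  \<comment> \<open>The crude estimate \<open>3 ^ 13\<close> suffices, since it is multiplied by
    \<open>(1/20) ^ 6\<close>, giving about 0.025.\<close>
  also have "exp (13::real) = exp 1 ^ 13" by (simp flip: exp_of_nat_mult)
  also have "\<dots> \<le> 3 ^ 13" by (intro power_mono exp_le) simp
  finally have E: "(\<Sum>i\<le>2 * m - 6. (13::real) ^ i / fact i) \<le> 3 ^ 13" .
  have "?H = (\<Sum>k=6..2 * m. (13 * ?r) ^ (2 * m - k) / fact (2 * m - k) * (?C * ?r ^ (k - 6)))"
    by (intro sum.cong refl) (simp add: node_bound_def)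
  also have "\<dots> = ?C * ?r ^ (2 * m - 6) * (\<Sum>i\<le>2 * m - 6. 13 ^ i / fact i)"
    by (rule geometric_tail_sum[OF m])
  also have "\<dots> \<le> ?C * ?r ^ (2 * m - 6) * 3 ^ 13"
    by (intro mult_left_mono E) simp
  also have "\<dots> \<le> ?C * (?r ^ 6 * ?r ^ (m - 6)) * 3 ^ 13"
  proof (intro mult_right_mono mult_left_mono)
    have "2 * m - 6 \<ge> 6 + (m - 6)" using m by simp
    then have "?r ^ (2 * m - 6) \<le> ?r ^ (6 + (m - 6))" by (intro power_decreasing) auto
    then show "?r ^ (2 * m - 6) \<le> ?r ^ 6 * ?r ^ (m - 6)" by (simp only: power_add)
  qed simp_all
  finally have H: "?H \<le> ?C * (?r ^ 6 * ?r ^ (m - 6)) * 3 ^ 13" .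
  have expand: "(\<Sum>k\<le>5. f (12 - k) k) = f 12 0 + f 11 1 + f 10 2 + f 9 3 + f 8 4 + f 7 5"
    for f :: "nat \<Rightarrow> nat \<Rightarrow> real"
    by (simp add: eval_nat_numeral)
  have "fact 11 = (39916800::real)" "fact 12 = (479001600::real)" by (simp_all add: fact_numeral)
  \<comment> \<open>This inequality fixes the prefactor of the tail: the left-hand side is about
    4.82 / 10^10, just below 5 / 10^10.\<close>
  then have "?T + ?C * ?r ^ 6 * 3 ^ 13 \<le> ?C"
    by (simp only: expand[of "\<lambda>n k. ?x ^ n / fact n * node_bound k"] node_bound_numeral
        fact_numeral_upto_10) (simp add: power_divide)
  then have "(?T + ?C * ?r ^ 6 * 3 ^ 13) * ?r ^ (m - 6) \<le> ?C * ?r ^ (m - 6)"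
    by (intro mult_right_mono) auto
  then have "?T * ?r ^ (m - 6) + ?C * (?r ^ 6 * ?r ^ (m - 6)) * 3 ^ 13 \<le> ?C * ?r ^ (m - 6)"
    by (simp only: arith)
  moreover have "node_bound m = ?C * ?r ^ (m - 6)" using m by (simp add: node_bound_def)
  ultimately show ?thesis using split L H by linarith
qed

lemma open_node_summable_bound:
  shows "summable (\<lambda>n. open_node_coeff (2 * m) n * (13/20) ^ n)"
    and "(\<Sum>n. open_node_coeff (2 * m) n * (13/20) ^ n) \<le> node_bound m"
proof -
  have le: "(\<Sum>n\<le>N. open_node_coeff (2 * m) n * (13/20) ^ n) \<le> node_bound m" for N
    by (rule open_node_partial_sum_le)
      (use node_bound_super node_bound_nonneg in \<open>auto simp: node_bound_def\<close>)
  have lt: "(\<Sum>n<N. open_node_coeff (2 * m) n * (13/20) ^ n) \<le> node_bound m" for N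
    by (rule order_trans[OF sum_mono2 le[of N]]) (auto simp: open_node_coeff_nonneg)
  show "summable (\<lambda>n. open_node_coeff (2 * m) n * (13/20) ^ n)"
    by (rule summableI_nonneg_bounded[OF _ lt]) (simp add: open_node_coeff_nonneg)
  then show "(\<Sum>n. open_node_coeff (2 * m) n * (13/20) ^ n) \<le> node_bound m"
    by (rule suminf_le_const) (rule lt)
qed

section \<open>Moments of the generating functions\<close>

text \<open>Each factor \<open>n\<close> is paid for by a larger radius:
  \<open>n * (x / y) ^ n\<close> is bounded for \<open>x < y\<close>, and the induction hypothesis
  is applied at the midpoint \<open>y\<close> of \<open>x\<close> and \<open>R\<close>.\<close>

lemma summable_power_moment:
  fixes a :: "nat \<Rightarrow> real"
  assumes "\<And>n. a n \<ge> 0" "summable (\<lambda>n. a n * R ^ n)" "0 \<le> x" "x < R"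
  shows "summable (\<lambda>n. real n ^ q * (a n * x ^ n))"
  using assms(3,4)
proof (induction q arbitrary: x)
  case 0
  show ?case
    by (rule summable_comparison_test[OF _ assms(2)])
      (use 0 assms(1) in \<open>auto intro!: exI[of _ 0] mult_left_mono power_mono\<close>)
next
  case (Suc q)
  define y where "y = (x + R) / 2"
  have y: "0 < y" "x < y" "y < R" using Suc.prems by (auto simp: y_def)
  have "(\<lambda>n. real n * (x / y) ^ n) \<longlonglongrightarrow> 0"
    by (rule powser_times_n_limit_0) (use y Suc.prems in auto)
  then have "Bseq (\<lambda>n. real n * (x / y) ^ n)" by (rule convergent_imp_Bseq[OF convergentI])
  then obtain K where K: "\<And>n. norm (real n * (x / y) ^ n) \<le> K" by (auto simp: Bseq_def)
  have "norm (real n ^ Suc q * (a n * x ^ n)) \<le> K * (real n ^ q * (a n * y ^ n))" for n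
  proof -
    have "real n ^ Suc q * (a n * x ^ n) = (real n * (x / y) ^ n) * (real n ^ q * (a n * y ^ n))"
      using y by (simp add: power_divide)
    also have "\<dots> \<le> K * (real n ^ q * (a n * y ^ n))"
      using K[of n] y assms(1) by (intro mult_right_mono) auto
    finally show ?thesis using Suc.prems assms(1) by simp
  qed
  moreover have "summable (\<lambda>n. K * (real n ^ q * (a n * y ^ n)))"
    using y by (intro summable_mult Suc.IH) auto
  ultimately show ?case by (rule summable_comparison_test'[rotated])
qed

text \<open>This is the operator \<open>x * d/dx\<close>, applied \<open>q\<close> times to F (2 m)
  and not normalised. The index \<open>m\<close> refers to the even index
  \<open>2 * m\<close>.\<close>

definition node_moment :: "nat \<Rightarrow> nat \<Rightarrow> real \<Rightarrow> real"
  where "node_moment q m x = (\<Sum>n. real n ^ q * (open_node_coeff (2 * m) n * x ^ n))"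

lemma node_moment_summable:
  assumes "0 \<le> x" "x < 13/20"
  shows "summable (\<lambda>n. real n ^ q * (open_node_coeff (2 * m) n * x ^ n))"
  using summable_power_moment[OF open_node_coeff_nonneg open_node_summable_bound(1) assms] .

lemma node_moment_nonneg:
  assumes "0 \<le> x" "x < 13/20"
  shows "node_moment q m x \<ge> 0"
  unfolding node_moment_def using assms
  by (intro suminf_nonneg node_moment_summable) (auto simp: open_node_coeff_nonneg)

lemma node_moment_0: "node_moment q 0 x = (if q = 0 then 1 else 0)"
proof -
  have "node_moment q 0 x = (\<Sum>n. if n = 0 then (if q = 0 then 1 else 0) else 0)"
    unfolding node_moment_def by (intro suminf_cong) (auto simp: open_node_coeff_0)
  also have "\<dots> = (if q = 0 then 1 else 0)"
    using sums_unique[OF sums_single[of 0 "\<lambda>n. if q = 0 then 1 else (0::real)"]] by simp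
  finally show ?thesis .
qed

text \<open>The ratio is chosen so that \<open>25/22 * 143/250 = 13/20\<close>, where
  \<open>143/250\<close> slightly exceeds \<open>571/1000\<close>. The proof keeps the binomial
  expansion of \<open>(1 + 3/22) ^ n\<close> up to second order; \<open>9/968\<close> is half the
  square of \<open>3/22\<close>.\<close>

lemma geometric_moment_bound:
  "real n \<le> 8 * (25/22) ^ n" "(real n)\<^sup>2 \<le> 120 * (25/22) ^ n"
proof -
  have *: "1 + 3/22 * real n + 9/968 * (real n * (real n - 1)) \<le> (25/22) ^ n"
  proof (induction n)
    case (Suc n)
    have "0 \<le> 3/22 * (9/968) * (real n * (real n - 1))"
      by (cases n) auto
    moreover have "25/22 * (1 + 3/22 * real n + 9/968 * (real n * (real n - 1))) =
        1 + 3/22 * real (Suc n) + 9/968 * (real (Suc n) * (real (Suc n) - 1)) +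
        3/22 * (9/968) * (real n * (real n - 1))"
      by (simp add: field_simps)
    ultimately have "1 + 3/22 * real (Suc n) + 9/968 * (real (Suc n) * (real (Suc n) - 1)) \<le>
        25/22 * (1 + 3/22 * real n + 9/968 * (real n * (real n - 1)))"
      by linarith
    also have "\<dots> \<le> 25/22 * (25/22) ^ n" using Suc by simp
    finally show ?case by simp
  qed simp
  have "0 \<le> real n * (real n - 1)" by (cases n) auto
  with * show "real n \<le> 8 * (25/22) ^ n" by linarith
  then show "(real n)\<^sup>2 \<le> 120 * (25/22) ^ n"
  proof -
    have "real n * (real n - 1) = (real n)\<^sup>2 - real n"
      by (simp add: power2_eq_square algebra_simps)
    moreover have "0 \<le> (25/22 :: real) ^ n" by simp
    ultimately show ?thesis using * \<open>real n \<le> _\<close> by linarith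
  qed
qed

text \<open>The factor \<open>n ^ q\<close> is absorbed in passing from \<open>x\<close> to
  \<open>13/20\<close>, where the supersolution lives. One table thus truncates the systems for all
  three orders.\<close>

lemma node_moment_le:
  assumes x: "0 \<le> x" "x \<le> 571/1000" and K: "\<And>n. real n ^ q \<le> K * (25/22) ^ n"
  shows "node_moment q m x \<le> K * node_bound m"
proof -
  have K0: "K \<ge> 0" using K[of 0] by (cases "q = 0") (auto simp: power_0_left)
  have le: "real n ^ q * (open_node_coeff (2 * m) n * x ^ n) \<le>
      K * (open_node_coeff (2 * m) n * (13/20) ^ n)" for n
  proof -
    have "real n ^ q * x ^ n \<le> K * (25/22) ^ n * (143/250) ^ n"
      using x K K0 by (intro mult_mono power_mono) auto
    also have "\<dots> = K * (13/20) ^ n" by (simp flip: power_mult_distrib add: mult.assoc)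
    finally have "open_node_coeff (2 * m) n * (real n ^ q * x ^ n) \<le>
        open_node_coeff (2 * m) n * (K * (13/20) ^ n)"
      by (intro mult_left_mono open_node_coeff_nonneg)
    then show ?thesis by (simp add: mult_ac)
  qed
  have "node_moment q m x \<le> (\<Sum>n. K * (open_node_coeff (2 * m) n * (13/20) ^ n))"
    unfolding node_moment_def
    by (intro suminf_le le node_moment_summable summable_mult open_node_summable_bound) (use x in auto)
  also have "\<dots> = K * (\<Sum>n. open_node_coeff (2 * m) n * (13/20) ^ n)"
    by (intro suminf_mult open_node_summable_bound)
  also have "\<dots> \<le> K * node_bound m"
    by (intro mult_left_mono open_node_summable_bound K0)
  finally show ?thesis .
qed

text \<open>In the \<open>i\<close>-th term of the recursion the exponent is
  \<open>(n - i) + i\<close>. Hence \<open>s k\<close> is a moment about a shifted origin, with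
  shift \<open>2 * m - k = i\<close> for \<open>k = 2 * m - i\<close>.\<close>

lemma node_moment_rec_aux:
  assumes "\<And>k. (\<lambda>n. real (n + (2 * m - k)) ^ q * (open_node_coeff (2 * k) n * x ^ n)) sums s k"
  shows "node_moment q m x = (\<Sum>i\<le>2 * m. x ^ i / fact i * s (2 * m - i))"
proof -
  let ?a = "\<lambda>i n. x ^ i / fact i * (real (n + i) ^ q * (open_node_coeff (2 * (2 * m - i)) n * x ^ n))"
  have "(\<lambda>n. \<Sum>i\<le>min (2 * m) n. ?a i (n - i)) sums (\<Sum>i\<le>2 * m. x ^ i / fact i * s (2 * m - i))"
  proof (rule sums_antidiagonal)
    fix i assume "i \<le> 2 * m"
    then show "?a i sums (x ^ i / fact i * s (2 * m - i))"
      using sums_mult[OF assms[of "2 * m - i"], of "x ^ i / fact i"] by simp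
  qed
  moreover have "(\<Sum>i\<le>min (2 * m) n. ?a i (n - i)) =
      real n ^ q * (open_node_coeff (2 * m) n * x ^ n)" for n
    unfolding open_node_coeff_rec[of "2 * m" n] sum_distrib_left sum_distrib_right
  proof (intro sum.cong refl)
    fix i assume "i \<in> {..min (2 * m) n}"
    then have "x ^ i * x ^ (n - i) = x ^ n" by (simp flip: power_add)
    moreover have "n - i + i = n" using \<open>i \<in> _\<close> by simp
    ultimately show "?a i (n - i) =
        real n ^ q * (open_node_coeff (2 * (2 * m - i)) (n - i) / fact i * x ^ n)"
      by simp
  qed
  ultimately show ?thesis unfolding node_moment_def by (simp add: sums_iff)
qed

lemma node_moment_sums:
  assumes "0 \<le> x" "x < 13/20"
  shows "(\<lambda>n. real n ^ q * (open_node_coeff (2 * m) n * x ^ n)) sums node_moment q m x"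
  unfolding node_moment_def by (rule summable_sums[OF node_moment_summable[OF assms]])

text \<open>Expanding \<open>(n + i) ^ q\<close> brings in only orders up to \<open>q\<close>, so
  the systems are block triangular and can be solved order by order.\<close>

lemma node_moment_rec:
  assumes x: "0 \<le> x" "x < 13/20"
  shows "node_moment 0 m x = (\<Sum>i\<le>2 * m. x ^ i / fact i * node_moment 0 (2 * m - i) x)"
    and "node_moment 1 m x = (\<Sum>i\<le>2 * m. x ^ i / fact i *
      (node_moment 1 (2 * m - i) x + real i * node_moment 0 (2 * m - i) x))"
    and "node_moment 2 m x = (\<Sum>i\<le>2 * m. x ^ i / fact i *
      (node_moment 2 (2 * m - i) x + 2 * real i * node_moment 1 (2 * m - i) x +
       (real i)\<^sup>2 * node_moment 0 (2 * m - i) x))"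
proof -
  note s = node_moment_sums[OF x]
  show "node_moment 0 m x = (\<Sum>i\<le>2 * m. x ^ i / fact i * node_moment 0 (2 * m - i) x)"
    by (rule node_moment_rec_aux) (use s[of 0] in simp)
  have "(\<lambda>n. real (n + (2 * m - k)) ^ 1 * (open_node_coeff (2 * k) n * x ^ n)) sums
      (node_moment 1 k x + real (2 * m - k) * node_moment 0 k x)" for k
    using sums_add[OF s[of 1 k] sums_mult[OF s[of 0 k], of "real (2 * m - k)"]]
    by (simp add: algebra_simps)
  from node_moment_rec_aux[OF this]
  show "node_moment 1 m x = (\<Sum>i\<le>2 * m. x ^ i / fact i *
      (node_moment 1 (2 * m - i) x + real i * node_moment 0 (2 * m - i) x))" by simp
  have "(\<lambda>n. real (n + (2 * m - k)) ^ 2 * (open_node_coeff (2 * k) n * x ^ n)) sums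
      (node_moment 2 k x + 2 * real (2 * m - k) * node_moment 1 k x +
       (real (2 * m - k))\<^sup>2 * node_moment 0 k x)" for k
    using sums_add[OF sums_add[OF s[of 2 k] sums_mult[OF s[of 1 k], of "2 * real (2 * m - k)"]]
        sums_mult[OF s[of 0 k], of "(real (2 * m - k))\<^sup>2"]]
    by (simp add: algebra_simps power2_eq_square)
  from node_moment_rec_aux[OF this]
  show "node_moment 2 m x = (\<Sum>i\<le>2 * m. x ^ i / fact i *
      (node_moment 2 (2 * m - i) x + 2 * real i * node_moment 1 (2 * m - i) x +
       (real i)\<^sup>2 * node_moment 0 (2 * m - i) x))" by simp
qed

section \<open>Numerical bounds\<close>

lemma node_moment_row_upper:
  assumes x: "0 \<le> x" "x < 13/20" and m: "m \<le> 5"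
    and c: "\<And>i. i \<le> 10 \<Longrightarrow> x ^ i / fact i \<le> c i"
  shows "node_moment 0 m x \<le> (\<Sum>i\<le>2 * m. c i * node_moment 0 (2 * m - i) x)"
    and "node_moment 1 m x \<le> (\<Sum>i\<le>2 * m. c i *
      (node_moment 1 (2 * m - i) x + real i * node_moment 0 (2 * m - i) x))"
    and "node_moment 2 m x \<le> (\<Sum>i\<le>2 * m. c i *
      (node_moment 2 (2 * m - i) x + 2 * real i * node_moment 1 (2 * m - i) x +
       (real i)\<^sup>2 * node_moment 0 (2 * m - i) x))"
proof -
  note nonneg = node_moment_nonneg[OF x]
  have c': "x ^ i / fact i \<le> c i" if "i \<in> {..2 * m}" for i
    using c[of i] that m by simp
  show "node_moment 0 m x \<le> (\<Sum>i\<le>2 * m. c i * node_moment 0 (2 * m - i) x)"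
    by (subst node_moment_rec(1)[OF x]) (intro sum_mono mult_right_mono c' nonneg)
  show "node_moment 1 m x \<le> (\<Sum>i\<le>2 * m. c i *
      (node_moment 1 (2 * m - i) x + real i * node_moment 0 (2 * m - i) x))"
    by (subst node_moment_rec(2)[OF x])
      (intro sum_mono mult_right_mono add_nonneg_nonneg mult_nonneg_nonneg c' nonneg; simp)
  show "node_moment 2 m x \<le> (\<Sum>i\<le>2 * m. c i *
      (node_moment 2 (2 * m - i) x + 2 * real i * node_moment 1 (2 * m - i) x +
       (real i)\<^sup>2 * node_moment 0 (2 * m - i) x))"
    by (subst node_moment_rec(3)[OF x])
      (intro sum_mono mult_right_mono add_nonneg_nonneg mult_nonneg_nonneg c' nonneg; simp)
qed

lemma node_moment_row_lower:
  assumes x: "0 \<le> x" "x < 13/20" and m: "m \<le> 5"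
    and c: "\<And>i. i \<le> 10 \<Longrightarrow> c i \<le> x ^ i / fact i"
  shows "(\<Sum>i\<le>2 * m. c i * node_moment 0 (2 * m - i) x) \<le> node_moment 0 m x"
    and "(\<Sum>i\<le>2 * m. c i *
      (node_moment 1 (2 * m - i) x + real i * node_moment 0 (2 * m - i) x)) \<le> node_moment 1 m x"
    and "(\<Sum>i\<le>2 * m. c i *
      (node_moment 2 (2 * m - i) x + 2 * real i * node_moment 1 (2 * m - i) x +
       (real i)\<^sup>2 * node_moment 0 (2 * m - i) x)) \<le> node_moment 2 m x"
proof -
  note nonneg = node_moment_nonneg[OF x]
  have c': "c i \<le> x ^ i / fact i" if "i \<in> {..2 * m}" for i
    using c[of i] that m by simp
  show "(\<Sum>i\<le>2 * m. c i * node_moment 0 (2 * m - i) x) \<le> node_moment 0 m x"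
    by (subst (2) node_moment_rec(1)[OF x]) (intro sum_mono mult_right_mono c' nonneg)
  show "(\<Sum>i\<le>2 * m. c i *
      (node_moment 1 (2 * m - i) x + real i * node_moment 0 (2 * m - i) x)) \<le> node_moment 1 m x"
    by (subst node_moment_rec(2)[OF x, of m])
      (intro sum_mono mult_right_mono add_nonneg_nonneg mult_nonneg_nonneg c' nonneg; simp)
  show "(\<Sum>i\<le>2 * m. c i *
      (node_moment 2 (2 * m - i) x + 2 * real i * node_moment 1 (2 * m - i) x +
       (real i)\<^sup>2 * node_moment 0 (2 * m - i) x)) \<le> node_moment 2 m x"
    by (subst node_moment_rec(3)[OF x, of m])
      (intro sum_mono mult_right_mono add_nonneg_nonneg mult_nonneg_nonneg c' nonneg; simp)
qed

lemma node_moment_tail: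
  assumes "0 \<le> x" "x \<le> 571/1000"
  shows "node_moment 0 m x \<le> node_bound m" "node_moment 1 m x \<le> 8 * node_bound m"
    "node_moment 2 m x \<le> 120 * node_bound m"
  using node_moment_le[OF assms, of 0 1] node_moment_le[OF assms, of 1 8]
    node_moment_le[OF assms, of 2 120] geometric_moment_bound
  by simp_all

lemma le_10_cases:
  "i \<le> 10 \<Longrightarrow> i = 0 \<or> i = 1 \<or> i = 2 \<or> i = 3 \<or> i = 4 \<or> i = 5 \<or> i = 6 \<or> i = 7 \<or> i = 8 \<or>
    i = 9 \<or> i = (10::nat)"
  by (auto simp: numeral_eq_Suc le_Suc_eq)

text \<open>For \<open>m \<le> 5\<close> the recursion is a linear system for the moments with coefficients
  \<open>x ^ i / fact i\<close>; its matrix has the form \<open>I - A\<close> with \<open>A \<ge> 0\<close>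
  and nonnegative inverse. Rounding the coefficients outwards and bounding the moments with
  \<open>m \<ge> 6\<close> by \<open>0\<close> and multiples of \<open>node_bound\<close> therefore gives two-sided bounds.\<close>

definition hi_upper :: "nat \<Rightarrow> real"
  where "hi_upper i = [1,
    570716984/1000000000,
    1628589379131/10000000000000,
    309821206211/10000000000000,
    44205056097/10000000000000,
    5045715259/10000000000000,
    4799459/100000000000,
    39130469/10000000000000,
    2791553/10000000000000,
    177021/10000000000000,
    10103/10000000000000] ! i"

lemma hi_upper_numeral:
  "hi_upper 0 = 1"
  "hi_upper 1 = 570716984/1000000000"
  "hi_upper 2 = 1628589379131/10000000000000"
  "hi_upper 3 = 309821206211/10000000000000"
  "hi_upper 4 = 44205056097/10000000000000"
  "hi_upper 5 = 5045715259/10000000000000"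
  "hi_upper 6 = 4799459/100000000000"
  "hi_upper 7 = 39130469/10000000000000"
  "hi_upper 8 = 2791553/10000000000000"
  "hi_upper 9 = 177021/10000000000000"
  "hi_upper 10 = 10103/10000000000000"
  by (simp_all add: hi_upper_def)

lemma hi_upper_bound:
  assumes "0 \<le> x" "x \<le> 570716984 / 1000000000" "i \<le> 10"
  shows "x ^ i / fact i \<le> hi_upper i"
proof -
  have num: "(570716984 / 1000000000) ^ i / fact i \<le> hi_upper i"
    using le_10_cases[OF \<open>i \<le> 10\<close>]
    by (elim disjE; simp only: hi_upper_numeral fact_numeral_upto_10) (simp_all add: power_divide)

  have "x ^ i / fact i \<le> (570716984 / 1000000000) ^ i / fact i"
    by (intro divide_right_mono power_mono) (use assms in auto)
  also note num
  finally show ?thesis .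
qed

text \<open>In the names of the four tables the first word is the end point of the interval for
  \<theta> and the second the direction of rounding. \<open>hi_upper\<close> and
  \<open>lo_lower\<close> are valid throughout the interval; \<open>lo_upper\<close> and
  \<open>hi_lower\<close> are used at the end points, where W is shown to be below and above
  1.\<close>

definition lo_lower :: "nat \<Rightarrow> real"
  where "lo_lower i = [1,
    570716981/1000000000,
    1628589362008/10000000000000,
    309821201324/10000000000000,
    44205055167/10000000000000,
    5045715126/10000000000000,
    479945883/10000000000000,
    39130466/10000000000000,
    2791552/10000000000000,
    17702/1000000000000,
    10102/10000000000000] ! i"

lemma lo_lower_numeral:
  "lo_lower 0 = 1"
  "lo_lower 1 = 570716981/1000000000"
  "lo_lower 2 = 1628589362008/10000000000000"
  "lo_lower 3 = 309821201324/10000000000000"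
  "lo_lower 4 = 44205055167/10000000000000"
  "lo_lower 5 = 5045715126/10000000000000"
  "lo_lower 6 = 479945883/10000000000000"
  "lo_lower 7 = 39130466/10000000000000"
  "lo_lower 8 = 2791552/10000000000000"
  "lo_lower 9 = 17702/1000000000000"
  "lo_lower 10 = 10102/10000000000000"
  by (simp_all add: lo_lower_def)

lemma lo_lower_bound:
  assumes "570716981 / 1000000000 \<le> x" "i \<le> 10"
  shows "lo_lower i \<le> x ^ i / fact i"
proof -
  have num: "lo_lower i \<le> (570716981 / 1000000000) ^ i / fact i"
    using le_10_cases[OF \<open>i \<le> 10\<close>]
    by (elim disjE; simp only: lo_lower_numeral fact_numeral_upto_10) (simp_all add: power_divide)

  note num
  also have "(570716981 / 1000000000) ^ i / fact i \<le> x ^ i / fact i"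
    by (intro divide_right_mono power_mono) (use assms in auto)
  finally show ?thesis .
qed

definition lo_upper :: "nat \<Rightarrow> real"
  where "lo_upper i = [1,
    570716981/1000000000,
    1628589362009/10000000000000,
    309821201325/10000000000000,
    44205055168/10000000000000,
    5045715127/10000000000000,
    479945884/10000000000000,
    39130467/10000000000000,
    2791553/10000000000000,
    177021/10000000000000,
    10103/10000000000000] ! i"

lemma lo_upper_numeral:
  "lo_upper 0 = 1"
  "lo_upper 1 = 570716981/1000000000"
  "lo_upper 2 = 1628589362009/10000000000000"
  "lo_upper 3 = 309821201325/10000000000000"
  "lo_upper 4 = 44205055168/10000000000000"
  "lo_upper 5 = 5045715127/10000000000000"
  "lo_upper 6 = 479945884/10000000000000"
  "lo_upper 7 = 39130467/10000000000000"
  "lo_upper 8 = 2791553/10000000000000"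
  "lo_upper 9 = 177021/10000000000000"
  "lo_upper 10 = 10103/10000000000000"
  by (simp_all add: lo_upper_def)

lemma lo_upper_bound:
  assumes "0 \<le> x" "x \<le> 570716981 / 1000000000" "i \<le> 10"
  shows "x ^ i / fact i \<le> lo_upper i"
proof -
  have num: "(570716981 / 1000000000) ^ i / fact i \<le> lo_upper i"
    using le_10_cases[OF \<open>i \<le> 10\<close>]
    by (elim disjE; simp only: lo_upper_numeral fact_numeral_upto_10) (simp_all add: power_divide)

  have "x ^ i / fact i \<le> (570716981 / 1000000000) ^ i / fact i"
    by (intro divide_right_mono power_mono) (use assms in auto)
  also note num
  finally show ?thesis .
qed

definition hi_lower :: "nat \<Rightarrow> real"
  where "hi_lower i = [1,
    570716984/1000000000,
    162858937913/1000000000000,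
    30982120621/1000000000000,
    44205056096/10000000000000,
    5045715258/10000000000000,
    479945899/10000000000000,
    39130468/10000000000000,
    2791552/10000000000000,
    17702/1000000000000,
    10102/10000000000000] ! i"

lemma hi_lower_numeral:
  "hi_lower 0 = 1"
  "hi_lower 1 = 570716984/1000000000"
  "hi_lower 2 = 162858937913/1000000000000"
  "hi_lower 3 = 30982120621/1000000000000"
  "hi_lower 4 = 44205056096/10000000000000"
  "hi_lower 5 = 5045715258/10000000000000"
  "hi_lower 6 = 479945899/10000000000000"
  "hi_lower 7 = 39130468/10000000000000"
  "hi_lower 8 = 2791552/10000000000000"
  "hi_lower 9 = 17702/1000000000000"
  "hi_lower 10 = 10102/10000000000000"
  by (simp_all add: hi_lower_def)

lemma hi_lower_bound:
  assumes "570716984 / 1000000000 \<le> x" "i \<le> 10"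
  shows "hi_lower i \<le> x ^ i / fact i"
proof -
  have num: "hi_lower i \<le> (570716984 / 1000000000) ^ i / fact i"
    using le_10_cases[OF \<open>i \<le> 10\<close>]
    by (elim disjE; simp only: hi_lower_numeral fact_numeral_upto_10) (simp_all add: power_divide)

  note num
  also have "(570716984 / 1000000000) ^ i / fact i \<le> x ^ i / fact i"
    by (intro divide_right_mono power_mono) (use assms in auto)
  finally show ?thesis .
qed

section \<open>Enclosure of the root and of the moments there\<close>

text \<open>Since W(x) = x + F 2, this says W < 1 at the left end. In the five rows, rounded
  upwards, the unknowns with index 6 to 10 are replaced by their bounds; a nonnegative combination
  of the rows then eliminates all unknowns but \<open>h1\<close>.\<close>

lemma node_moment_below_root:
  "node_moment 0 1 (570716981 / 1000000000) < 1 - 570716981 / 1000000000"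
proof -
  define x :: real where "x = 570716981 / 1000000000"
  have x: "0 \<le> x" "x < 13/20" and x': "x \<le> 571/1000" and xr: "x \<le> 570716981 / 1000000000"
    by (simp_all add: x_def)
  define h1 where "h1 = node_moment 0 1 x"
  define h2 where "h2 = node_moment 0 2 x"
  define h3 where "h3 = node_moment 0 3 x"
  define h4 where "h4 = node_moment 0 4 x"
  define h5 where "h5 = node_moment 0 5 x"
  define h6 where "h6 = node_moment 0 6 x"
  define h7 where "h7 = node_moment 0 7 x"
  define h8 where "h8 = node_moment 0 8 x"
  define h9 where "h9 = node_moment 0 9 x"
  define h10 where "h10 = node_moment 0 10 x"
  note defs = h1_def[symmetric] h2_def[symmetric] h3_def[symmetric] h4_def[symmetric]
    h5_def[symmetric] h6_def[symmetric] h7_def[symmetric] h8_def[symmetric] h9_def[symmetric]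
    h10_def[symmetric]
  have pos0: "0 \<le> h1" "0 \<le> h2" "0 \<le> h3" "0 \<le> h4" "0 \<le> h5" "0 \<le> h6" "0 \<le> h7" "0 \<le> h8" "0 \<le> h9"
    "0 \<le> h10"
    using node_moment_nonneg[OF x] by (simp_all add: h1_def h2_def h3_def h4_def h5_def h6_def
      h7_def h8_def h9_def h10_def)
  have tail0: "h6 \<le> 5/10000000000" "h7 \<le> 25/1000000000000" "h8 \<le> 125/100000000000000"
    "h9 \<le> 625/10000000000000000" "h10 \<le> 3125/1000000000000000000"
    using node_moment_tail(1)[OF x(1) x', of 6] node_moment_tail(1)[OF x(1) x', of 7]
      node_moment_tail(1)[OF x(1) x', of 8] node_moment_tail(1)[OF x(1) x', of 9]
      node_moment_tail(1)[OF x(1) x', of 10]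
    by (simp_all add: node_bound_numeral defs del: One_nat_def)
  have u01: "h1 \<le> 1 * h2 +
      570716981/1000000000 * h1 +
      1628589362009/10000000000000 * 1"
    using node_moment_row_upper(1)[where m = 1 and c = lo_upper, OF x _ lo_upper_bound[OF x(1) xr]]
    by (simp add: antidiagonal_sum_numeral[of "\<lambda>i k. lo_upper i * node_moment 0 k x"]
      lo_upper_numeral node_moment_0 defs del: One_nat_def)
  have u02: "h2 \<le> 1 * h4 +
      570716981/1000000000 * h3 +
      1628589362009/10000000000000 * h2 +
      309821201325/10000000000000 * h1 +
      44205055168/10000000000000 * 1"
    using node_moment_row_upper(1)[where m = 2 and c = lo_upper, OF x _ lo_upper_bound[OF x(1) xr]]
    by (simp add: antidiagonal_sum_numeral[of "\<lambda>i k. lo_upper i * node_moment 0 k x"]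
      lo_upper_numeral node_moment_0 defs del: One_nat_def)
  have u03: "h3 \<le> 1 * h6 +
      570716981/1000000000 * h5 +
      1628589362009/10000000000000 * h4 +
      309821201325/10000000000000 * h3 +
      44205055168/10000000000000 * h2 +
      5045715127/10000000000000 * h1 +
      479945884/10000000000000 * 1"
    using node_moment_row_upper(1)[where m = 3 and c = lo_upper, OF x _ lo_upper_bound[OF x(1) xr]]
    by (simp add: antidiagonal_sum_numeral[of "\<lambda>i k. lo_upper i * node_moment 0 k x"]
      lo_upper_numeral node_moment_0 defs del: One_nat_def)
  have u04: "h4 \<le> 1 * h8 +
      570716981/1000000000 * h7 +
      1628589362009/10000000000000 * h6 +
      309821201325/10000000000000 * h5 +
      44205055168/10000000000000 * h4 +
      5045715127/10000000000000 * h3 +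
      479945884/10000000000000 * h2 +
      39130467/10000000000000 * h1 +
      2791553/10000000000000 * 1"
    using node_moment_row_upper(1)[where m = 4 and c = lo_upper, OF x _ lo_upper_bound[OF x(1) xr]]
    by (simp add: antidiagonal_sum_numeral[of "\<lambda>i k. lo_upper i * node_moment 0 k x"]
      lo_upper_numeral node_moment_0 defs del: One_nat_def)
  have u05: "h5 \<le> 1 * h10 +
      570716981/1000000000 * h9 +
      1628589362009/10000000000000 * h8 +
      309821201325/10000000000000 * h7 +
      44205055168/10000000000000 * h6 +
      5045715127/10000000000000 * h5 +
      479945884/10000000000000 * h4 +
      39130467/10000000000000 * h3 +
      2791553/10000000000000 * h2 +
      177021/10000000000000 * h1 +
      10103/10000000000000 * 1"
    using node_moment_row_upper(1)[where m = 5 and c = lo_upper, OF x _ lo_upper_bound[OF x(1) xr]]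
    by (simp add: antidiagonal_sum_numeral[of "\<lambda>i k. lo_upper i * node_moment 0 k x"]
      lo_upper_numeral node_moment_0 defs del: One_nat_def)
  have "h1 < 1 - 570716981 / 1000000000"
    using u01 u02 u03 u04 u05 tail0 pos0 by linarith
  then show ?thesis by (simp add: h1_def x_def del: One_nat_def)
qed

text \<open>Now W > 1 at the right end. With rows rounded downwards the unknowns beyond index 5 may
  be replaced by 0.\<close>

lemma node_moment_above_root:
  "node_moment 0 1 (570716984 / 1000000000) > 1 - 570716984 / 1000000000"
proof -
  define x :: real where "x = 570716984 / 1000000000"
  have x: "0 \<le> x" "x < 13/20" and x': "x \<le> 571/1000" and xr: "570716984 / 1000000000 \<le> x"
    by (simp_all add: x_def)
  define h1 where "h1 = node_moment 0 1 x"
  define h2 where "h2 = node_moment 0 2 x"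
  define h3 where "h3 = node_moment 0 3 x"
  define h4 where "h4 = node_moment 0 4 x"
  define h5 where "h5 = node_moment 0 5 x"
  define h6 where "h6 = node_moment 0 6 x"
  define h7 where "h7 = node_moment 0 7 x"
  define h8 where "h8 = node_moment 0 8 x"
  define h9 where "h9 = node_moment 0 9 x"
  define h10 where "h10 = node_moment 0 10 x"
  note defs = h1_def[symmetric] h2_def[symmetric] h3_def[symmetric] h4_def[symmetric]
    h5_def[symmetric] h6_def[symmetric] h7_def[symmetric] h8_def[symmetric] h9_def[symmetric]
    h10_def[symmetric]
  have pos0: "0 \<le> h1" "0 \<le> h2" "0 \<le> h3" "0 \<le> h4" "0 \<le> h5" "0 \<le> h6" "0 \<le> h7" "0 \<le> h8" "0 \<le> h9"
    "0 \<le> h10"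
    using node_moment_nonneg[OF x] by (simp_all add: h1_def h2_def h3_def h4_def h5_def h6_def
      h7_def h8_def h9_def h10_def)
  have tail0: "h6 \<le> 5/10000000000" "h7 \<le> 25/1000000000000" "h8 \<le> 125/100000000000000"
    "h9 \<le> 625/10000000000000000" "h10 \<le> 3125/1000000000000000000"
    using node_moment_tail(1)[OF x(1) x', of 6] node_moment_tail(1)[OF x(1) x', of 7]
      node_moment_tail(1)[OF x(1) x', of 8] node_moment_tail(1)[OF x(1) x', of 9]
      node_moment_tail(1)[OF x(1) x', of 10]
    by (simp_all add: node_bound_numeral defs del: One_nat_def)
  have l01: "h1 \<ge> 1 * h2 +
      570716984/1000000000 * h1 +
      162858937913/1000000000000 * 1"
    using node_moment_row_lower(1)[where m = 1 and c = hi_lower, OF x _ hi_lower_bound[OF xr]]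
    by (simp add: antidiagonal_sum_numeral[of "\<lambda>i k. hi_lower i * node_moment 0 k x"]
      hi_lower_numeral node_moment_0 defs del: One_nat_def)
  have l02: "h2 \<ge> 1 * h4 +
      570716984/1000000000 * h3 +
      162858937913/1000000000000 * h2 +
      30982120621/1000000000000 * h1 +
      44205056096/10000000000000 * 1"
    using node_moment_row_lower(1)[where m = 2 and c = hi_lower, OF x _ hi_lower_bound[OF xr]]
    by (simp add: antidiagonal_sum_numeral[of "\<lambda>i k. hi_lower i * node_moment 0 k x"]
      hi_lower_numeral node_moment_0 defs del: One_nat_def)
  have l03: "h3 \<ge> 1 * h6 +
      570716984/1000000000 * h5 +
      162858937913/1000000000000 * h4 +
      30982120621/1000000000000 * h3 +
      44205056096/10000000000000 * h2 +
      5045715258/10000000000000 * h1 +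
      479945899/10000000000000 * 1"
    using node_moment_row_lower(1)[where m = 3 and c = hi_lower, OF x _ hi_lower_bound[OF xr]]
    by (simp add: antidiagonal_sum_numeral[of "\<lambda>i k. hi_lower i * node_moment 0 k x"]
      hi_lower_numeral node_moment_0 defs del: One_nat_def)
  have l04: "h4 \<ge> 1 * h8 +
      570716984/1000000000 * h7 +
      162858937913/1000000000000 * h6 +
      30982120621/1000000000000 * h5 +
      44205056096/10000000000000 * h4 +
      5045715258/10000000000000 * h3 +
      479945899/10000000000000 * h2 +
      39130468/10000000000000 * h1 +
      2791552/10000000000000 * 1"
    using node_moment_row_lower(1)[where m = 4 and c = hi_lower, OF x _ hi_lower_bound[OF xr]]
    by (simp add: antidiagonal_sum_numeral[of "\<lambda>i k. hi_lower i * node_moment 0 k x"]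
      hi_lower_numeral node_moment_0 defs del: One_nat_def)
  have l05: "h5 \<ge> 1 * h10 +
      570716984/1000000000 * h9 +
      162858937913/1000000000000 * h8 +
      30982120621/1000000000000 * h7 +
      44205056096/10000000000000 * h6 +
      5045715258/10000000000000 * h5 +
      479945899/10000000000000 * h4 +
      39130468/10000000000000 * h3 +
      2791552/10000000000000 * h2 +
      17702/1000000000000 * h1 +
      10102/10000000000000 * 1"
    using node_moment_row_lower(1)[where m = 5 and c = hi_lower, OF x _ hi_lower_bound[OF xr]]
    by (simp add: antidiagonal_sum_numeral[of "\<lambda>i k. hi_lower i * node_moment 0 k x"]
      hi_lower_numeral node_moment_0 defs del: One_nat_def)
  have "h1 > 1 - 570716984 / 1000000000"
    using l01 l02 l03 l04 l05 pos0 by linarith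
  then show ?thesis by (simp add: h1_def x_def del: One_nat_def)
qed

text \<open>The letters \<open>h\<close>, \<open>d\<close>, \<open>e\<close> stand for orders 0, 1,
  2. The enclosures have widths of about 6 / 10^8 and 6 / 10^7, narrow enough for the decimals
  claimed for the constant in the asymptotic formula.\<close>

lemma node_moment_near_root:
  assumes "570716981 / 1000000000 \<le> x" "x \<le> 570716984 / 1000000000"
  shows "node_moment 1 1 x \<in> {1658081903042/1000000000000 .. 1658081965054/1000000000000}"
    and "node_moment 2 1 x \<in> {9022101980448/1000000000000 .. 9022102591219/1000000000000}"
proof -
  have x: "0 \<le> x" "x < 13/20" and x': "x \<le> 571/1000"
    using assms by simp_all
  define h1 where "h1 = node_moment 0 1 x"
  define h2 where "h2 = node_moment 0 2 x"
  define h3 where "h3 = node_moment 0 3 x"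
  define h4 where "h4 = node_moment 0 4 x"
  define h5 where "h5 = node_moment 0 5 x"
  define h6 where "h6 = node_moment 0 6 x"
  define h7 where "h7 = node_moment 0 7 x"
  define h8 where "h8 = node_moment 0 8 x"
  define h9 where "h9 = node_moment 0 9 x"
  define h10 where "h10 = node_moment 0 10 x"
  define d1 where "d1 = node_moment 1 1 x"
  define d2 where "d2 = node_moment 1 2 x"
  define d3 where "d3 = node_moment 1 3 x"
  define d4 where "d4 = node_moment 1 4 x"
  define d5 where "d5 = node_moment 1 5 x"
  define d6 where "d6 = node_moment 1 6 x"
  define d7 where "d7 = node_moment 1 7 x"
  define d8 where "d8 = node_moment 1 8 x"
  define d9 where "d9 = node_moment 1 9 x"
  define d10 where "d10 = node_moment 1 10 x"
  define e1 where "e1 = node_moment 2 1 x"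
  define e2 where "e2 = node_moment 2 2 x"
  define e3 where "e3 = node_moment 2 3 x"
  define e4 where "e4 = node_moment 2 4 x"
  define e5 where "e5 = node_moment 2 5 x"
  define e6 where "e6 = node_moment 2 6 x"
  define e7 where "e7 = node_moment 2 7 x"
  define e8 where "e8 = node_moment 2 8 x"
  define e9 where "e9 = node_moment 2 9 x"
  define e10 where "e10 = node_moment 2 10 x"
  note defs = h1_def[symmetric] h2_def[symmetric] h3_def[symmetric] h4_def[symmetric]
    h5_def[symmetric] h6_def[symmetric] h7_def[symmetric] h8_def[symmetric] h9_def[symmetric]
    h10_def[symmetric] d1_def[symmetric] d2_def[symmetric] d3_def[symmetric] d4_def[symmetric]
    d5_def[symmetric] d6_def[symmetric] d7_def[symmetric] d8_def[symmetric] d9_def[symmetric]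
    d10_def[symmetric] e1_def[symmetric] e2_def[symmetric] e3_def[symmetric] e4_def[symmetric]
    e5_def[symmetric] e6_def[symmetric] e7_def[symmetric] e8_def[symmetric] e9_def[symmetric]
    e10_def[symmetric]
  have pos0: "0 \<le> h1" "0 \<le> h2" "0 \<le> h3" "0 \<le> h4" "0 \<le> h5" "0 \<le> h6" "0 \<le> h7" "0 \<le> h8" "0 \<le> h9"
    "0 \<le> h10"
    using node_moment_nonneg[OF x] by (simp_all add: h1_def h2_def h3_def h4_def h5_def h6_def
      h7_def h8_def h9_def h10_def)
  have tail0: "h6 \<le> 5/10000000000" "h7 \<le> 25/1000000000000" "h8 \<le> 125/100000000000000"
    "h9 \<le> 625/10000000000000000" "h10 \<le> 3125/1000000000000000000"
    using node_moment_tail(1)[OF x(1) x', of 6] node_moment_tail(1)[OF x(1) x', of 7]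
      node_moment_tail(1)[OF x(1) x', of 8] node_moment_tail(1)[OF x(1) x', of 9]
      node_moment_tail(1)[OF x(1) x', of 10]
    by (simp_all add: node_bound_numeral defs del: One_nat_def)
  have pos1: "0 \<le> d1" "0 \<le> d2" "0 \<le> d3" "0 \<le> d4" "0 \<le> d5" "0 \<le> d6" "0 \<le> d7" "0 \<le> d8" "0 \<le> d9"
    "0 \<le> d10"
    using node_moment_nonneg[OF x] by (simp_all add: d1_def d2_def d3_def d4_def d5_def d6_def
      d7_def d8_def d9_def d10_def)
  have tail1: "d6 \<le> 8 * 5/10000000000" "d7 \<le> 8 * 25/1000000000000" "d8 \<le> 8 * 125/100000000000000"
    "d9 \<le> 8 * 625/10000000000000000" "d10 \<le> 8 * 3125/1000000000000000000"
    using node_moment_tail(2)[OF x(1) x', of 6] node_moment_tail(2)[OF x(1) x', of 7]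
      node_moment_tail(2)[OF x(1) x', of 8] node_moment_tail(2)[OF x(1) x', of 9]
      node_moment_tail(2)[OF x(1) x', of 10]
    by (simp_all add: node_bound_numeral defs del: One_nat_def)
  have pos2: "0 \<le> e1" "0 \<le> e2" "0 \<le> e3" "0 \<le> e4" "0 \<le> e5" "0 \<le> e6" "0 \<le> e7" "0 \<le> e8" "0 \<le> e9"
    "0 \<le> e10"
    using node_moment_nonneg[OF x] by (simp_all add: e1_def e2_def e3_def e4_def e5_def e6_def
      e7_def e8_def e9_def e10_def)
  have tail2: "e6 \<le> 120 * 5/10000000000" "e7 \<le> 120 * 25/1000000000000"
    "e8 \<le> 120 * 125/100000000000000" "e9 \<le> 120 * 625/10000000000000000"
    "e10 \<le> 120 * 3125/1000000000000000000"
    using node_moment_tail(3)[OF x(1) x', of 6] node_moment_tail(3)[OF x(1) x', of 7]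
      node_moment_tail(3)[OF x(1) x', of 8] node_moment_tail(3)[OF x(1) x', of 9]
      node_moment_tail(3)[OF x(1) x', of 10]
    by (simp_all add: node_bound_numeral defs del: One_nat_def)
  have u01: "h1 \<le> 1 * h2 +
      570716984/1000000000 * h1 +
      1628589379131/10000000000000 * 1"
    using node_moment_row_upper(1)[where m = 1 and c = hi_upper, OF x _ hi_upper_bound[OF x(1)
      assms(2)]]
    by (simp add: antidiagonal_sum_numeral[of "\<lambda>i k. hi_upper i * node_moment 0 k x"]
      hi_upper_numeral node_moment_0 defs del: One_nat_def)
  have u02: "h2 \<le> 1 * h4 +
      570716984/1000000000 * h3 +
      1628589379131/10000000000000 * h2 +
      309821206211/10000000000000 * h1 +
      44205056097/10000000000000 * 1"
    using node_moment_row_upper(1)[where m = 2 and c = hi_upper, OF x _ hi_upper_bound[OF x(1)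
      assms(2)]]
    by (simp add: antidiagonal_sum_numeral[of "\<lambda>i k. hi_upper i * node_moment 0 k x"]
      hi_upper_numeral node_moment_0 defs del: One_nat_def)
  have u03: "h3 \<le> 1 * h6 +
      570716984/1000000000 * h5 +
      1628589379131/10000000000000 * h4 +
      309821206211/10000000000000 * h3 +
      44205056097/10000000000000 * h2 +
      5045715259/10000000000000 * h1 +
      4799459/100000000000 * 1"
    using node_moment_row_upper(1)[where m = 3 and c = hi_upper, OF x _ hi_upper_bound[OF x(1)
      assms(2)]]
    by (simp add: antidiagonal_sum_numeral[of "\<lambda>i k. hi_upper i * node_moment 0 k x"]
      hi_upper_numeral node_moment_0 defs del: One_nat_def)
  have u04: "h4 \<le> 1 * h8 +
      570716984/1000000000 * h7 +
      1628589379131/10000000000000 * h6 +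
      309821206211/10000000000000 * h5 +
      44205056097/10000000000000 * h4 +
      5045715259/10000000000000 * h3 +
      4799459/100000000000 * h2 +
      39130469/10000000000000 * h1 +
      2791553/10000000000000 * 1"
    using node_moment_row_upper(1)[where m = 4 and c = hi_upper, OF x _ hi_upper_bound[OF x(1)
      assms(2)]]
    by (simp add: antidiagonal_sum_numeral[of "\<lambda>i k. hi_upper i * node_moment 0 k x"]
      hi_upper_numeral node_moment_0 defs del: One_nat_def)
  have u05: "h5 \<le> 1 * h10 +
      570716984/1000000000 * h9 +
      1628589379131/10000000000000 * h8 +
      309821206211/10000000000000 * h7 +
      44205056097/10000000000000 * h6 +
      5045715259/10000000000000 * h5 +
      4799459/100000000000 * h4 +
      39130469/10000000000000 * h3 +
      2791553/10000000000000 * h2 +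
      177021/10000000000000 * h1 +
      10103/10000000000000 * 1"
    using node_moment_row_upper(1)[where m = 5 and c = hi_upper, OF x _ hi_upper_bound[OF x(1)
      assms(2)]]
    by (simp add: antidiagonal_sum_numeral[of "\<lambda>i k. hi_upper i * node_moment 0 k x"]
      hi_upper_numeral node_moment_0 defs del: One_nat_def)
  \<comment> \<open>In rows of order \<open>q > 0\<close> the term \<open>i = 2 * m\<close> meets
    node 0, whose only nonzero moment has order 0. It leaves the coefficient times
    \<open>(2 * m) ^ q\<close>, the last summand of each row.\<close>
  have u11: "d1 \<le> 1 * d2 +
      570716984/1000000000 * d1 +
      570716984/1000000000 * h1 +
      1628589379131/10000000000000 * 2"
    using node_moment_row_upper(2)[where m = 1 and c = hi_upper, OF x _ hi_upper_bound[OF x(1)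
      assms(2)]]
    by (simp add: antidiagonal_sum_numeral[of "\<lambda>i k. hi_upper i * (node_moment 1 k x +
      real i * node_moment 0 k x)"] hi_upper_numeral node_moment_0 defs del: One_nat_def, simp add: distrib_left add_divide_distrib)
  have u12: "d2 \<le> 1 * d4 +
      570716984/1000000000 * d3 +
      570716984/1000000000 * h3 +
      1628589379131/10000000000000 * d2 +
      3257178758262/10000000000000 * h2 +
      309821206211/10000000000000 * d1 +
      929463618633/10000000000000 * h1 +
      44205056097/10000000000000 * 4"
    using node_moment_row_upper(2)[where m = 2 and c = hi_upper, OF x _ hi_upper_bound[OF x(1)
      assms(2)]]
    by (simp add: antidiagonal_sum_numeral[of "\<lambda>i k. hi_upper i * (node_moment 1 k x +
      real i * node_moment 0 k x)"] hi_upper_numeral node_moment_0 defs del: One_nat_def, simp add: distrib_left add_divide_distrib)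
  have u13: "d3 \<le> 1 * d6 +
      570716984/1000000000 * d5 +
      570716984/1000000000 * h5 +
      1628589379131/10000000000000 * d4 +
      3257178758262/10000000000000 * h4 +
      309821206211/10000000000000 * d3 +
      929463618633/10000000000000 * h3 +
      44205056097/10000000000000 * d2 +
      176820224388/10000000000000 * h2 +
      5045715259/10000000000000 * d1 +
      25228576295/10000000000000 * h1 +
      4799459/100000000000 * 6"
    using node_moment_row_upper(2)[where m = 3 and c = hi_upper, OF x _ hi_upper_bound[OF x(1)
      assms(2)]]
    by (simp add: antidiagonal_sum_numeral[of "\<lambda>i k. hi_upper i * (node_moment 1 k x +
      real i * node_moment 0 k x)"] hi_upper_numeral node_moment_0 defs del: One_nat_def, simp add: distrib_left add_divide_distrib)
  have u14: "d4 \<le> 1 * d8 +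
      570716984/1000000000 * d7 +
      570716984/1000000000 * h7 +
      1628589379131/10000000000000 * d6 +
      3257178758262/10000000000000 * h6 +
      309821206211/10000000000000 * d5 +
      929463618633/10000000000000 * h5 +
      44205056097/10000000000000 * d4 +
      176820224388/10000000000000 * h4 +
      5045715259/10000000000000 * d3 +
      25228576295/10000000000000 * h3 +
      4799459/100000000000 * d2 +
      28796754/100000000000 * h2 +
      39130469/10000000000000 * d1 +
      273913283/10000000000000 * h1 +
      2791553/10000000000000 * 8"
    using node_moment_row_upper(2)[where m = 4 and c = hi_upper, OF x _ hi_upper_bound[OF x(1)
      assms(2)]]
    by (simp add: antidiagonal_sum_numeral[of "\<lambda>i k. hi_upper i * (node_moment 1 k x +
      real i * node_moment 0 k x)"] hi_upper_numeral node_moment_0 defs del: One_nat_def, simp add: distrib_left add_divide_distrib)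
  have u15: "d5 \<le> 1 * d10 +
      570716984/1000000000 * d9 +
      570716984/1000000000 * h9 +
      1628589379131/10000000000000 * d8 +
      3257178758262/10000000000000 * h8 +
      309821206211/10000000000000 * d7 +
      929463618633/10000000000000 * h7 +
      44205056097/10000000000000 * d6 +
      176820224388/10000000000000 * h6 +
      5045715259/10000000000000 * d5 +
      25228576295/10000000000000 * h5 +
      4799459/100000000000 * d4 +
      28796754/100000000000 * h4 +
      39130469/10000000000000 * d3 +
      273913283/10000000000000 * h3 +
      2791553/10000000000000 * d2 +
      22332424/10000000000000 * h2 +
      177021/10000000000000 * d1 +
      1593189/10000000000000 * h1 +
      10103/10000000000000 * 10"
    using node_moment_row_upper(2)[where m = 5 and c = hi_upper, OF x _ hi_upper_bound[OF x(1)
      assms(2)]]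
    by (simp add: antidiagonal_sum_numeral[of "\<lambda>i k. hi_upper i * (node_moment 1 k x +
      real i * node_moment 0 k x)"] hi_upper_numeral node_moment_0 defs del: One_nat_def, simp add: distrib_left add_divide_distrib)
  have u21: "e1 \<le> 1 * e2 +
      570716984/1000000000 * e1 +
      1141433968/1000000000 * d1 + 570716984/1000000000 * h1 +
      1628589379131/10000000000000 * 4"
    using node_moment_row_upper(3)[where m = 1 and c = hi_upper, OF x _ hi_upper_bound[OF x(1)
      assms(2)]]
    by (simp add: antidiagonal_sum_numeral[of "\<lambda>i k. hi_upper i * (node_moment 2 k x +
      2 * real i * node_moment 1 k x +
      (real i)\<^sup>2 * node_moment 0 k x)"] hi_upper_numeral node_moment_0 defs del: One_nat_def, simp add: distrib_left add_divide_distrib)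
  have u22: "e2 \<le> 1 * e4 +
      570716984/1000000000 * e3 +
      1141433968/1000000000 * d3 + 570716984/1000000000 * h3 +
      1628589379131/10000000000000 * e2 +
      6514357516524/10000000000000 * d2 + 6514357516524/10000000000000 * h2 +
      309821206211/10000000000000 * e1 +
      1858927237266/10000000000000 * d1 + 2788390855899/10000000000000 * h1 +
      44205056097/10000000000000 * 16"
    using node_moment_row_upper(3)[where m = 2 and c = hi_upper, OF x _ hi_upper_bound[OF x(1)
      assms(2)]]
    by (simp add: antidiagonal_sum_numeral[of "\<lambda>i k. hi_upper i * (node_moment 2 k x +
      2 * real i * node_moment 1 k x +
      (real i)\<^sup>2 * node_moment 0 k x)"] hi_upper_numeral node_moment_0 defs del: One_nat_def, simp add: distrib_left add_divide_distrib)
  have u23: "e3 \<le> 1 * e6 +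
      570716984/1000000000 * e5 +
      1141433968/1000000000 * d5 + 570716984/1000000000 * h5 +
      1628589379131/10000000000000 * e4 +
      6514357516524/10000000000000 * d4 + 6514357516524/10000000000000 * h4 +
      309821206211/10000000000000 * e3 +
      1858927237266/10000000000000 * d3 + 2788390855899/10000000000000 * h3 +
      44205056097/10000000000000 * e2 +
      353640448776/10000000000000 * d2 + 707280897552/10000000000000 * h2 +
      5045715259/10000000000000 * e1 +
      5045715259/1000000000000 * d1 + 126142881475/10000000000000 * h1 +
      4799459/100000000000 * 36"
    using node_moment_row_upper(3)[where m = 3 and c = hi_upper, OF x _ hi_upper_bound[OF x(1)
      assms(2)]]
    by (simp add: antidiagonal_sum_numeral[of "\<lambda>i k. hi_upper i * (node_moment 2 k x +
      2 * real i * node_moment 1 k x +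
      (real i)\<^sup>2 * node_moment 0 k x)"] hi_upper_numeral node_moment_0 defs del: One_nat_def, simp add: distrib_left add_divide_distrib)
  have u24: "e4 \<le> 1 * e8 +
      570716984/1000000000 * e7 +
      1141433968/1000000000 * d7 + 570716984/1000000000 * h7 +
      1628589379131/10000000000000 * e6 +
      6514357516524/10000000000000 * d6 + 6514357516524/10000000000000 * h6 +
      309821206211/10000000000000 * e5 +
      1858927237266/10000000000000 * d5 + 2788390855899/10000000000000 * h5 +
      44205056097/10000000000000 * e4 +
      353640448776/10000000000000 * d4 + 707280897552/10000000000000 * h4 +
      5045715259/10000000000000 * e3 +
      5045715259/1000000000000 * d3 + 126142881475/10000000000000 * h3 +
      4799459/100000000000 * e2 +
      57593508/100000000000 * d2 + 172780524/100000000000 * h2 +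
      39130469/10000000000000 * e1 +
      547826566/10000000000000 * d1 + 1917392981/10000000000000 * h1 +
      2791553/10000000000000 * 64"
    using node_moment_row_upper(3)[where m = 4 and c = hi_upper, OF x _ hi_upper_bound[OF x(1)
      assms(2)]]
    by (simp add: antidiagonal_sum_numeral[of "\<lambda>i k. hi_upper i * (node_moment 2 k x +
      2 * real i * node_moment 1 k x +
      (real i)\<^sup>2 * node_moment 0 k x)"] hi_upper_numeral node_moment_0 defs del: One_nat_def, simp add: distrib_left add_divide_distrib)
  have u25: "e5 \<le> 1 * e10 +
      570716984/1000000000 * e9 +
      1141433968/1000000000 * d9 + 570716984/1000000000 * h9 +
      1628589379131/10000000000000 * e8 +
      6514357516524/10000000000000 * d8 + 6514357516524/10000000000000 * h8 +
      309821206211/10000000000000 * e7 +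
      1858927237266/10000000000000 * d7 + 2788390855899/10000000000000 * h7 +
      44205056097/10000000000000 * e6 +
      353640448776/10000000000000 * d6 + 707280897552/10000000000000 * h6 +
      5045715259/10000000000000 * e5 +
      5045715259/1000000000000 * d5 + 126142881475/10000000000000 * h5 +
      4799459/100000000000 * e4 +
      57593508/100000000000 * d4 + 172780524/100000000000 * h4 +
      39130469/10000000000000 * e3 +
      547826566/10000000000000 * d3 + 1917392981/10000000000000 * h3 +
      2791553/10000000000000 * e2 +
      44664848/10000000000000 * d2 + 178659392/10000000000000 * h2 +
      177021/10000000000000 * e1 +
      3186378/10000000000000 * d1 + 14338701/10000000000000 * h1 +
      10103/10000000000000 * 100"
    using node_moment_row_upper(3)[where m = 5 and c = hi_upper, OF x _ hi_upper_bound[OF x(1)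
      assms(2)]]
    by (simp add: antidiagonal_sum_numeral[of "\<lambda>i k. hi_upper i * (node_moment 2 k x +
      2 * real i * node_moment 1 k x +
      (real i)\<^sup>2 * node_moment 0 k x)"] hi_upper_numeral node_moment_0 defs del: One_nat_def, simp add: distrib_left add_divide_distrib)
  have l01: "h1 \<ge> 1 * h2 +
      570716981/1000000000 * h1 +
      1628589362008/10000000000000 * 1"
    using node_moment_row_lower(1)[where m = 1 and c = lo_lower, OF x _ lo_lower_bound[OF assms(1)]]
    by (simp add: antidiagonal_sum_numeral[of "\<lambda>i k. lo_lower i * node_moment 0 k x"]
      lo_lower_numeral node_moment_0 defs del: One_nat_def)
  have l02: "h2 \<ge> 1 * h4 +
      570716981/1000000000 * h3 +
      1628589362008/10000000000000 * h2 +
      309821201324/10000000000000 * h1 +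
      44205055167/10000000000000 * 1"
    using node_moment_row_lower(1)[where m = 2 and c = lo_lower, OF x _ lo_lower_bound[OF assms(1)]]
    by (simp add: antidiagonal_sum_numeral[of "\<lambda>i k. lo_lower i * node_moment 0 k x"]
      lo_lower_numeral node_moment_0 defs del: One_nat_def)
  have l03: "h3 \<ge> 1 * h6 +
      570716981/1000000000 * h5 +
      1628589362008/10000000000000 * h4 +
      309821201324/10000000000000 * h3 +
      44205055167/10000000000000 * h2 +
      5045715126/10000000000000 * h1 +
      479945883/10000000000000 * 1"
    using node_moment_row_lower(1)[where m = 3 and c = lo_lower, OF x _ lo_lower_bound[OF assms(1)]]
    by (simp add: antidiagonal_sum_numeral[of "\<lambda>i k. lo_lower i * node_moment 0 k x"]
      lo_lower_numeral node_moment_0 defs del: One_nat_def)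
  have l04: "h4 \<ge> 1 * h8 +
      570716981/1000000000 * h7 +
      1628589362008/10000000000000 * h6 +
      309821201324/10000000000000 * h5 +
      44205055167/10000000000000 * h4 +
      5045715126/10000000000000 * h3 +
      479945883/10000000000000 * h2 +
      39130466/10000000000000 * h1 +
      2791552/10000000000000 * 1"
    using node_moment_row_lower(1)[where m = 4 and c = lo_lower, OF x _ lo_lower_bound[OF assms(1)]]
    by (simp add: antidiagonal_sum_numeral[of "\<lambda>i k. lo_lower i * node_moment 0 k x"]
      lo_lower_numeral node_moment_0 defs del: One_nat_def)
  have l05: "h5 \<ge> 1 * h10 +
      570716981/1000000000 * h9 +
      1628589362008/10000000000000 * h8 +
      309821201324/10000000000000 * h7 +
      44205055167/10000000000000 * h6 +
      5045715126/10000000000000 * h5 +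
      479945883/10000000000000 * h4 +
      39130466/10000000000000 * h3 +
      2791552/10000000000000 * h2 +
      17702/1000000000000 * h1 +
      10102/10000000000000 * 1"
    using node_moment_row_lower(1)[where m = 5 and c = lo_lower, OF x _ lo_lower_bound[OF assms(1)]]
    by (simp add: antidiagonal_sum_numeral[of "\<lambda>i k. lo_lower i * node_moment 0 k x"]
      lo_lower_numeral node_moment_0 defs del: One_nat_def)
  have l11: "d1 \<ge> 1 * d2 +
      570716981/1000000000 * d1 +
      570716981/1000000000 * h1 +
      1628589362008/10000000000000 * 2"
    using node_moment_row_lower(2)[where m = 1 and c = lo_lower, OF x _ lo_lower_bound[OF assms(1)]]
    by (simp add: antidiagonal_sum_numeral[of "\<lambda>i k. lo_lower i * (node_moment 1 k x +
      real i * node_moment 0 k x)"] lo_lower_numeral node_moment_0 defs del: One_nat_def, simp add: distrib_left add_divide_distrib)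
  have l12: "d2 \<ge> 1 * d4 +
      570716981/1000000000 * d3 +
      570716981/1000000000 * h3 +
      1628589362008/10000000000000 * d2 +
      3257178724016/10000000000000 * h2 +
      309821201324/10000000000000 * d1 +
      929463603972/10000000000000 * h1 +
      44205055167/10000000000000 * 4"
    using node_moment_row_lower(2)[where m = 2 and c = lo_lower, OF x _ lo_lower_bound[OF assms(1)]]
    by (simp add: antidiagonal_sum_numeral[of "\<lambda>i k. lo_lower i * (node_moment 1 k x +
      real i * node_moment 0 k x)"] lo_lower_numeral node_moment_0 defs del: One_nat_def, simp add: distrib_left add_divide_distrib)
  have l13: "d3 \<ge> 1 * d6 +
      570716981/1000000000 * d5 +
      570716981/1000000000 * h5 +
      1628589362008/10000000000000 * d4 +
      3257178724016/10000000000000 * h4 +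
      309821201324/10000000000000 * d3 +
      929463603972/10000000000000 * h3 +
      44205055167/10000000000000 * d2 +
      176820220668/10000000000000 * h2 +
      5045715126/10000000000000 * d1 +
      2522857563/1000000000000 * h1 +
      479945883/10000000000000 * 6"
    using node_moment_row_lower(2)[where m = 3 and c = lo_lower, OF x _ lo_lower_bound[OF assms(1)]]
    by (simp add: antidiagonal_sum_numeral[of "\<lambda>i k. lo_lower i * (node_moment 1 k x +
      real i * node_moment 0 k x)"] lo_lower_numeral node_moment_0 defs del: One_nat_def, simp add: distrib_left add_divide_distrib)
  have l14: "d4 \<ge> 1 * d8 +
      570716981/1000000000 * d7 +
      570716981/1000000000 * h7 +
      1628589362008/10000000000000 * d6 +
      3257178724016/10000000000000 * h6 +
      309821201324/10000000000000 * d5 +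
      929463603972/10000000000000 * h5 +
      44205055167/10000000000000 * d4 +
      176820220668/10000000000000 * h4 +
      5045715126/10000000000000 * d3 +
      2522857563/1000000000000 * h3 +
      479945883/10000000000000 * d2 +
      2879675298/10000000000000 * h2 +
      39130466/10000000000000 * d1 +
      273913262/10000000000000 * h1 +
      2791552/10000000000000 * 8"
    using node_moment_row_lower(2)[where m = 4 and c = lo_lower, OF x _ lo_lower_bound[OF assms(1)]]
    by (simp add: antidiagonal_sum_numeral[of "\<lambda>i k. lo_lower i * (node_moment 1 k x +
      real i * node_moment 0 k x)"] lo_lower_numeral node_moment_0 defs del: One_nat_def, simp add: distrib_left add_divide_distrib)
  have l15: "d5 \<ge> 1 * d10 +
      570716981/1000000000 * d9 +
      570716981/1000000000 * h9 +
      1628589362008/10000000000000 * d8 +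
      3257178724016/10000000000000 * h8 +
      309821201324/10000000000000 * d7 +
      929463603972/10000000000000 * h7 +
      44205055167/10000000000000 * d6 +
      176820220668/10000000000000 * h6 +
      5045715126/10000000000000 * d5 +
      2522857563/1000000000000 * h5 +
      479945883/10000000000000 * d4 +
      2879675298/10000000000000 * h4 +
      39130466/10000000000000 * d3 +
      273913262/10000000000000 * h3 +
      2791552/10000000000000 * d2 +
      22332416/10000000000000 * h2 +
      17702/1000000000000 * d1 +
      159318/1000000000000 * h1 +
      10102/10000000000000 * 10"
    using node_moment_row_lower(2)[where m = 5 and c = lo_lower, OF x _ lo_lower_bound[OF assms(1)]]
    by (simp add: antidiagonal_sum_numeral[of "\<lambda>i k. lo_lower i * (node_moment 1 k x +
      real i * node_moment 0 k x)"] lo_lower_numeral node_moment_0 defs del: One_nat_def, simp add: distrib_left add_divide_distrib)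
  have l21: "e1 \<ge> 1 * e2 +
      570716981/1000000000 * e1 +
      1141433962/1000000000 * d1 + 570716981/1000000000 * h1 +
      1628589362008/10000000000000 * 4"
    using node_moment_row_lower(3)[where m = 1 and c = lo_lower, OF x _ lo_lower_bound[OF assms(1)]]
    by (simp add: antidiagonal_sum_numeral[of "\<lambda>i k. lo_lower i * (node_moment 2 k x +
      2 * real i * node_moment 1 k x +
      (real i)\<^sup>2 * node_moment 0 k x)"] lo_lower_numeral node_moment_0 defs del: One_nat_def, simp add: distrib_left add_divide_distrib)
  have l22: "e2 \<ge> 1 * e4 +
      570716981/1000000000 * e3 +
      1141433962/1000000000 * d3 + 570716981/1000000000 * h3 +
      1628589362008/10000000000000 * e2 +
      6514357448032/10000000000000 * d2 + 6514357448032/10000000000000 * h2 +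
      309821201324/10000000000000 * e1 +
      1858927207944/10000000000000 * d1 + 2788390811916/10000000000000 * h1 +
      44205055167/10000000000000 * 16"
    using node_moment_row_lower(3)[where m = 2 and c = lo_lower, OF x _ lo_lower_bound[OF assms(1)]]
    by (simp add: antidiagonal_sum_numeral[of "\<lambda>i k. lo_lower i * (node_moment 2 k x +
      2 * real i * node_moment 1 k x +
      (real i)\<^sup>2 * node_moment 0 k x)"] lo_lower_numeral node_moment_0 defs del: One_nat_def, simp add: distrib_left add_divide_distrib)
  have l23: "e3 \<ge> 1 * e6 +
      570716981/1000000000 * e5 +
      1141433962/1000000000 * d5 + 570716981/1000000000 * h5 +
      1628589362008/10000000000000 * e4 +
      6514357448032/10000000000000 * d4 + 6514357448032/10000000000000 * h4 +
      309821201324/10000000000000 * e3 +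
      1858927207944/10000000000000 * d3 + 2788390811916/10000000000000 * h3 +
      44205055167/10000000000000 * e2 +
      353640441336/10000000000000 * d2 + 707280882672/10000000000000 * h2 +
      5045715126/10000000000000 * e1 +
      5045715126/1000000000000 * d1 + 12614287815/1000000000000 * h1 +
      479945883/10000000000000 * 36"
    using node_moment_row_lower(3)[where m = 3 and c = lo_lower, OF x _ lo_lower_bound[OF assms(1)]]
    by (simp add: antidiagonal_sum_numeral[of "\<lambda>i k. lo_lower i * (node_moment 2 k x +
      2 * real i * node_moment 1 k x +
      (real i)\<^sup>2 * node_moment 0 k x)"] lo_lower_numeral node_moment_0 defs del: One_nat_def, simp add: distrib_left add_divide_distrib)
  have l24: "e4 \<ge> 1 * e8 +
      570716981/1000000000 * e7 +
      1141433962/1000000000 * d7 + 570716981/1000000000 * h7 +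
      1628589362008/10000000000000 * e6 +
      6514357448032/10000000000000 * d6 + 6514357448032/10000000000000 * h6 +
      309821201324/10000000000000 * e5 +
      1858927207944/10000000000000 * d5 + 2788390811916/10000000000000 * h5 +
      44205055167/10000000000000 * e4 +
      353640441336/10000000000000 * d4 + 707280882672/10000000000000 * h4 +
      5045715126/10000000000000 * e3 +
      5045715126/1000000000000 * d3 + 12614287815/1000000000000 * h3 +
      479945883/10000000000000 * e2 +
      5759350596/10000000000000 * d2 + 17278051788/10000000000000 * h2 +
      39130466/10000000000000 * e1 +
      547826524/10000000000000 * d1 + 1917392834/10000000000000 * h1 +
      2791552/10000000000000 * 64"
    using node_moment_row_lower(3)[where m = 4 and c = lo_lower, OF x _ lo_lower_bound[OF assms(1)]]
    by (simp add: antidiagonal_sum_numeral[of "\<lambda>i k. lo_lower i * (node_moment 2 k x +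
      2 * real i * node_moment 1 k x +
      (real i)\<^sup>2 * node_moment 0 k x)"] lo_lower_numeral node_moment_0 defs del: One_nat_def, simp add: distrib_left add_divide_distrib)
  have l25: "e5 \<ge> 1 * e10 +
      570716981/1000000000 * e9 +
      1141433962/1000000000 * d9 + 570716981/1000000000 * h9 +
      1628589362008/10000000000000 * e8 +
      6514357448032/10000000000000 * d8 + 6514357448032/10000000000000 * h8 +
      309821201324/10000000000000 * e7 +
      1858927207944/10000000000000 * d7 + 2788390811916/10000000000000 * h7 +
      44205055167/10000000000000 * e6 +
      353640441336/10000000000000 * d6 + 707280882672/10000000000000 * h6 +
      5045715126/10000000000000 * e5 +
      5045715126/1000000000000 * d5 + 12614287815/1000000000000 * h5 +
      479945883/10000000000000 * e4 +
      5759350596/10000000000000 * d4 + 17278051788/10000000000000 * h4 +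
      39130466/10000000000000 * e3 +
      547826524/10000000000000 * d3 + 1917392834/10000000000000 * h3 +
      2791552/10000000000000 * e2 +
      44664832/10000000000000 * d2 + 178659328/10000000000000 * h2 +
      17702/1000000000000 * e1 +
      318636/1000000000000 * d1 + 1433862/1000000000000 * h1 +
      10102/10000000000000 * 100"
    using node_moment_row_lower(3)[where m = 5 and c = lo_lower, OF x _ lo_lower_bound[OF assms(1)]]
    by (simp add: antidiagonal_sum_numeral[of "\<lambda>i k. lo_lower i * (node_moment 2 k x +
      2 * real i * node_moment 1 k x +
      (real i)\<^sup>2 * node_moment 0 k x)"] lo_lower_numeral node_moment_0 defs del: One_nat_def, simp add: distrib_left add_divide_distrib)
  \<comment> \<open>The bounds for indices 6 to 10 are inserted and the constants rounded up to
    multiples of 10^(-13), so that five rows in five unknowns remain.\<close>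
  have ur01: "h1 \<le> 1 * h2 + 570716984/1000000000 * h1 + 1628589379131/10000000000000"
    using u01 by linarith
  have ur02: "h2 \<le> 1 * h4 + 570716984/1000000000 * h3 + 1628589379131/10000000000000 * h2 +
    309821206211/10000000000000 * h1 + 44205056097/10000000000000"
    using u02 by linarith
  have ur03: "h3 \<le> 570716984/1000000000 * h5 + 1628589379131/10000000000000 * h4 +
    309821206211/10000000000000 * h3 + 44205056097/10000000000000 * h2 +
    5045715259/10000000000000 * h1 + 4799509/100000000000"
    using u03 tail0(1) by linarith
  have ur04: "h4 \<le> 309821206211/10000000000000 * h5 + 44205056097/10000000000000 * h4 +
    5045715259/10000000000000 * h3 + 4799459/100000000000 * h2 + 39130469/10000000000000 * h1 +
    2792523/10000000000000"
    using u04 tail0(1) tail0(2) tail0(3) by linarith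
  have ur05: "h5 \<le> 5045715259/10000000000000 * h5 + 4799459/100000000000 * h4 +
    39130469/10000000000000 * h3 + 2791553/10000000000000 * h2 + 177021/10000000000000 * h1 +
    10136/10000000000000"
    using u05 tail0(1) tail0(2) tail0(3) tail0(4) tail0(5) by linarith
  \<comment> \<open>All rows together bound the unknown of index 1; each next bound comes from the
    remaining rows with the earlier bounds inserted.\<close>
  have U01: "h1 \<le> 42928302262/100000000000"
    using ur01 ur02 ur03 ur04 ur05 by linarith
  have U02: "h2 \<le> 21424972766/1000000000000"
    using ur02 ur03 ur04 ur05 U01 by linarith
  have U03: "h3 \<le> 37134193/100000000000"
    using ur03 ur04 ur05 U01 U02 by linarith
  have U04: "h4 \<le> 3189329/1000000000000"
    using ur04 ur05 U01 U02 U03 by linarith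
  have U05: "h5 \<le> 16228/1000000000000"
    using ur05 U01 U02 U03 U04 by linarith
  \<comment> \<open>Moments of order 0 enter with nonnegative coefficients, so their upper bounds
    turn them into constants and five unknowns are left again.\<close>
  have ur11: "d1 \<le> 1 * d2 + 570716984/1000000000 * d1 + 5707169877783/10000000000000"
    using u11 U01 U02 by linarith
  have ur12: "d2 \<le> 1 * d4 + 570716984/1000000000 * d3 + 1628589379131/10000000000000 * d2 +
    309821206211/10000000000000 * d1 + 647727453664/10000000000000"
    using u12 U01 U02 U03 U04 by linarith
  have ur13: "d3 \<le> 570716984/1000000000 * d5 + 1628589379131/10000000000000 * d4 +
    309821206211/10000000000000 * d3 + 44205056097/10000000000000 * d2 +
    5045715259/10000000000000 * d1 + 17853913025/10000000000000"
    using u13 U01 U02 U03 U04 U05 tail0(1) tail1(1) by linarith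
  have ur14: "d4 \<le> 309821206211/10000000000000 * d5 + 44205056097/10000000000000 * d4 +
    5045715259/10000000000000 * d3 + 4799459/100000000000 * d2 + 39130469/10000000000000 * d1 +
    21157269/1000000000000"
    using u14 U01 U02 U03 U04 U05 tail0(1) tail0(2) tail0(3) tail1(1) tail1(2) tail1(3) by linarith
  have ur15: "d5 \<le> 5045715259/10000000000000 * d5 + 4799459/100000000000 * d4 +
    39130469/10000000000000 * d3 + 2791553/10000000000000 * d2 + 177021/10000000000000 * d1 +
    1375114/10000000000000"
    using u15 U01 U02 U03 U04 U05 tail0(1) tail0(2) tail0(3) tail0(4) tail0(5) tail1(1) tail1(2)
      tail1(3) tail1(4) tail1(5) by linarith
  have U11: "d1 \<le> 1658081965054/1000000000000"
    using ur11 ur12 ur13 ur14 ur15 by linarith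
  have U12: "d2 \<le> 141069438967/1000000000000"
    using ur12 ur13 ur14 ur15 U11 by linarith
  have U13: "d3 \<le> 3355608571/1000000000000"
    using ur13 ur14 ur15 U11 U12 by linarith
  have U14: "d4 \<le> 3627637/100000000000"
    using ur14 ur15 U11 U12 U13 by linarith
  have U15: "d5 \<le> 221247/1000000000000"
    using ur15 U11 U12 U13 U14 by linarith
  have ur21: "e1 \<le> 1 * e2 + 570716984/1000000000 * e1 + 27890259402454/10000000000000"
    using u21 U01 U02 U11 U12 by linarith
  have ur22: "e2 \<le> 1 * e4 + 570716984/1000000000 * e3 + 1628589379131/10000000000000 * e2 +
    309821206211/10000000000000 * e1 + 6085511538869/10000000000000"
    using u22 U01 U02 U03 U04 U11 U12 U13 U14 by linarith
  have ur23: "e3 \<le> 570716984/1000000000 * e5 + 1628589379131/10000000000000 * e4 +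
    309821206211/10000000000000 * e3 + 44205056097/10000000000000 * e2 +
    5045715259/10000000000000 * e1 + 227666068522/10000000000000"
    using u23 U01 U02 U03 U04 U05 tail0(1) U11 U12 U13 U14 U15 tail1(1) tail2(1) by linarith
  have ur24: "e4 \<le> 309821206211/10000000000000 * e5 + 44205056097/10000000000000 * e4 +
    5045715259/10000000000000 * e3 + 4799459/100000000000 * e2 + 39130469/10000000000000 * e1 +
    3324600931/10000000000000"
    using u24 U01 U02 U03 U04 U05 tail0(1) tail0(2) tail0(3) U11 U12 U13 U14 U15 tail1(1) tail1(2)
      tail1(3) tail2(1) tail2(2) tail2(3) by linarith
  have ur25: "e5 \<le> 5045715259/10000000000000 * e5 + 4799459/100000000000 * e4 +
    39130469/10000000000000 * e3 + 2791553/10000000000000 * e2 + 177021/10000000000000 * e1 +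
    25411261/10000000000000"
    using u25 U01 U02 U03 U04 U05 tail0(1) tail0(2) tail0(3) tail0(4) tail0(5) U11 U12 U13 U14 U15
      tail1(1) tail1(2) tail1(3) tail1(4) tail1(5) tail2(1) tail2(2) tail2(3) tail2(4) tail2(5) by
      linarith
  \<comment> \<open>Order 2 is the last stage, so only index 1 is solved for.\<close>
  have U21: "e1 \<le> 9022102591219/1000000000000"
    using ur21 ur22 ur23 ur24 ur25 by linarith
  \<comment> \<open>The lower bounds repeat the elimination with rounding down and with 0 for the
    tail.\<close>
  have lr01: "h1 \<ge> 1 * h2 + 570716981/1000000000 * h1 + 1628589362008/10000000000000"
    using l01 by linarith
  have lr02: "h2 \<ge> 1 * h4 + 570716981/1000000000 * h3 + 1628589362008/10000000000000 * h2 +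
    309821201324/10000000000000 * h1 + 44205055167/10000000000000"
    using l02 by linarith
  have lr03: "h3 \<ge> 570716981/1000000000 * h5 + 1628589362008/10000000000000 * h4 +
    309821201324/10000000000000 * h3 + 44205055167/10000000000000 * h2 +
    5045715126/10000000000000 * h1 + 479945883/10000000000000"
    using l03 pos0(6) by linarith
  have lr04: "h4 \<ge> 309821201324/10000000000000 * h5 + 44205055167/10000000000000 * h4 +
    5045715126/10000000000000 * h3 + 479945883/10000000000000 * h2 +
    39130466/10000000000000 * h1 + 2791552/10000000000000"
    using l04 pos0(6) pos0(7) pos0(8) by linarith
  have lr05: "h5 \<ge> 5045715126/10000000000000 * h5 + 479945883/10000000000000 * h4 +
    39130466/10000000000000 * h3 + 2791552/10000000000000 * h2 + 17702/1000000000000 * h1 +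
    10102/10000000000000"
    using l05 pos0(6) pos0(7) pos0(8) pos0(9) pos0(10) by linarith
  have L01: "h1 \<ge> 42928301263/100000000000"
    using lr01 lr02 lr03 lr04 lr05 by linarith
  have L02: "h2 \<ge> 21424971455/1000000000000"
    using lr02 lr03 lr04 lr05 L01 by linarith
  have L03: "h3 \<ge> 371341334/1000000000000"
    using lr03 lr04 lr05 L01 L02 by linarith
  have L04: "h4 \<ge> 318919/100000000000"
    using lr04 lr05 L01 L02 L03 by linarith
  have L05: "h5 \<ge> 16184/1000000000000"
    using lr05 L01 L02 L03 L04 by linarith
  have lr11: "d1 \<ge> 1 * d2 + 570716981/1000000000 * d1 + 5707169773643/10000000000000"
    using l11 L01 L02 by linarith
  have lr12: "d2 \<ge> 1 * d4 + 570716981/1000000000 * d3 + 1628589362008/10000000000000 * d2 +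
    309821201324/10000000000000 * d1 + 647727425947/10000000000000"
    using l12 L01 L02 L03 L04 by linarith
  have lr13: "d3 \<ge> 570716981/1000000000 * d5 + 1628589362008/10000000000000 * d4 +
    309821201324/10000000000000 * d3 + 44205055167/10000000000000 * d2 +
    5045715126/10000000000000 * d1 + 1785387081/1000000000000"
    using l13 L01 L02 L03 L04 L05 pos0(6) pos1(6) by linarith
  have lr14: "d4 \<ge> 309821201324/10000000000000 * d5 + 44205055167/10000000000000 * d4 +
    5045715126/10000000000000 * d3 + 479945883/10000000000000 * d2 +
    39130466/10000000000000 * d1 + 211563056/10000000000000"
    using l14 L01 L02 L03 L04 L05 pos0(6) pos0(7) pos0(8) pos1(6) pos1(7) pos1(8) by linarith
  have lr15: "d5 \<ge> 5045715126/10000000000000 * d5 + 479945883/10000000000000 * d4 +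
    39130466/10000000000000 * d3 + 2791552/10000000000000 * d2 + 17702/1000000000000 * d1 +
    1374723/10000000000000"
    using l15 L01 L02 L03 L04 L05 pos0(6) pos0(7) pos0(8) pos0(9) pos0(10) pos1(6) pos1(7) pos1(8)
      pos1(9) pos1(10) by linarith
  have L11: "d1 \<ge> 1658081903042/1000000000000"
    using lr11 lr12 lr13 lr14 lr15 by linarith
  have L12: "d2 \<ge> 141069427711/1000000000000"
    using lr12 lr13 lr14 lr15 L11 by linarith
  have L13: "d3 \<ge> 3355603865/1000000000000"
    using lr13 lr14 lr15 L11 L12 by linarith
  have L14: "d4 \<ge> 36275356/1000000000000"
    using lr14 lr15 L11 L12 L13 by linarith
  have L15: "d5 \<ge> 221167/1000000000000"
    using lr15 L11 L12 L13 L14 by linarith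
  have lr21: "e1 \<ge> 1 * e2 + 570716981/1000000000 * e1 + 27890258456757/10000000000000"
    using l21 L01 L02 L11 L12 by linarith
  have lr22: "e2 \<ge> 1 * e4 + 570716981/1000000000 * e3 + 1628589362008/10000000000000 * e2 +
    309821201324/10000000000000 * e1 + 6085511163031/10000000000000"
    using l22 L01 L02 L03 L04 L11 L12 L13 L14 by linarith
  have lr23: "e3 \<ge> 570716981/1000000000 * e5 + 1628589362008/10000000000000 * e4 +
    309821201324/10000000000000 * e3 + 44205055167/10000000000000 * e2 +
    5045715126/10000000000000 * e1 + 227665434408/10000000000000"
    using l23 L01 L02 L03 L04 L05 pos0(6) L11 L12 L13 L14 L15 pos1(6) pos2(6) by linarith
  have lr24: "e4 \<ge> 309821201324/10000000000000 * e5 + 44205055167/10000000000000 * e4 +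
    5045715126/10000000000000 * e3 + 479945883/10000000000000 * e2 +
    39130466/10000000000000 * e1 + 3324451427/10000000000000"
    using l24 L01 L02 L03 L04 L05 pos0(6) pos0(7) pos0(8) L11 L12 L13 L14 L15 pos1(6) pos1(7)
      pos1(8) pos2(6) pos2(7) pos2(8) by linarith
  have lr25: "e5 \<ge> 5045715126/10000000000000 * e5 + 479945883/10000000000000 * e4 +
    39130466/10000000000000 * e3 + 2791552/10000000000000 * e2 + 17702/1000000000000 * e1 +
    25404907/10000000000000"
    using l25 L01 L02 L03 L04 L05 pos0(6) pos0(7) pos0(8) pos0(9) pos0(10) L11 L12 L13 L14 L15
      pos1(6) pos1(7) pos1(8) pos1(9) pos1(10) pos2(6) pos2(7) pos2(8) pos2(9) pos2(10) by
      linarith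
  have L21: "e1 \<ge> 9022101980448/1000000000000"
    using lr21 lr22 lr23 lr24 lr25 by linarith
  show "node_moment 1 1 x \<in> {1658081903042/1000000000000 .. 1658081965054/1000000000000}" using
    U11 L11 by (simp add: d1_def del: One_nat_def)
  show "node_moment 2 1 x \<in> {9022101980448/1000000000000 .. 9022102591219/1000000000000}" using
    U21 L21 by (simp add: e1_def del: One_nat_def)
qed

section \<open>The local limit theorem\<close>

lemma fps_power_of_real:
  fixes p :: "nat \<Rightarrow> real"
  shows "fps_nth (Abs_fps (\<lambda>n. complex_of_real (p n)) ^ s) n = of_real (fps_nth (Abs_fps p ^ s) n)"
proof (induction s arbitrary: n)
  case (Suc s)
  then show ?case by (simp add: fps_mult_nth)
qed (simp add: fps_one_nth)

lemma iexp_power: "iexp t ^ n = iexp (real n * t)"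
  by (simp add: exp_of_nat_mult[symmetric] mult_ac)

text \<open>By the half-angle formula it is enough that \<open>sin y \<ge> y / 2\<close> for
  \<open>0 \<le> y \<le> pi / 2\<close>; the cubic Taylor estimate gives this up to
  \<open>8/5\<close>.\<close>

lemma one_minus_cos_ge:
  assumes "\<bar>t\<bar> \<le> pi"
  shows "t\<^sup>2 / 8 \<le> 1 - cos t"
proof -
  define y where "y = \<bar>t\<bar> / 2"
  have y: "0 \<le> y" "y \<le> 8/5" using assms pi_approx by (auto simp: y_def)
  have "\<bar>sin y - (\<Sum>m<3. sin_coeff m * y ^ m)\<bar> \<le> inverse (fact 3) * \<bar>y\<bar> ^ 3"
    by (rule Maclaurin_sin_bound)
  moreover have "(\<Sum>m<3. sin_coeff m * y ^ m) = y"
    by (simp add: eval_nat_numeral sin_coeff_def)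
  ultimately have "\<bar>sin y - y\<bar> \<le> y ^ 3 / 6"
    using y by (simp add: fact_numeral)
  then have "y - y ^ 3 / 6 \<le> sin y" by linarith
  moreover have "y ^ 3 \<le> (8/5)\<^sup>2 * y"
    using y mult_right_mono[OF power_mono[of y "8/5" 2], of y] by (simp add: power3_eq_cube power2_eq_square)
  ultimately have "y / 2 \<le> sin y" using y by (simp add: power2_eq_square)
  then have "(y / 2)\<^sup>2 \<le> (sin y)\<^sup>2" using y by (intro power_mono) auto
  moreover have "cos t = 1 - 2 * (sin y)\<^sup>2"
  proof -
    have "cos t = cos (2 * y)" by (simp add: y_def)
    then show ?thesis by (simp only: cos_double_sin)
  qed
  moreover have "(y / 2)\<^sup>2 = t\<^sup>2 / 16" by (simp add: y_def power2_eq_square)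
  ultimately show ?thesis by simp
qed

lemma integral_iexp_period:
  "(LBINT t. indicator {-pi..pi} t *\<^sub>R iexp (of_int k * t)) = (if k = 0 then complex_of_real (2 * pi) else 0)"
proof (cases "k = 0")
  case True
  have "(LBINT t. indicator {-pi..pi} t *\<^sub>R (1::complex)) = of_real (2 * pi)"
    using integral_FTC_atLeastAtMost[of "-pi" pi "\<lambda>t. of_real t" "\<lambda>_. 1::complex"]
    by (simp add: scaleR_conv_of_real has_vector_derivative_of_real[OF DERIV_ident, simplified])
  then show ?thesis using True by simp
next
  case False
  let ?F = "\<lambda>t. iexp (of_int k * t) / (\<i> * of_int k)"
  have "(?F has_vector_derivative iexp (of_int k * t)) (at t within A)" for t A
  proof -
    have "((\<lambda>t. iexp (of_int k * t)) has_vector_derivative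
        (of_int k) *\<^sub>R (\<i> * iexp (of_int k * t))) (at t within A)"
      by (rule has_vector_derivative_eq_rhs[OF vector_diff_chain_within[of "\<lambda>t. of_int k * t"
            "of_int k" t A iexp "\<i> * iexp (of_int k * t)", unfolded comp_def]])
        (auto intro!: derivative_eq_intros has_vector_derivative_within_subset[OF has_vector_derivative_iexp])
    then have "(?F has_vector_derivative
        ((of_int k) *\<^sub>R (\<i> * iexp (of_int k * t))) / (\<i> * of_int k)) (at t within A)"
      by (rule has_vector_derivative_divide)
    then show ?thesis using False by (simp add: scaleR_conv_of_real)
  qed
  then have "(LBINT t. indicator {-pi..pi} t *\<^sub>R iexp (of_int k * t)) = ?F pi - ?F (-pi)"
    by (intro integral_FTC_atLeastAtMost) (auto intro!: continuous_intros)
  also have "iexp (of_int k * pi) = iexp (of_int k * (-pi))"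
  proof -
    have "iexp (of_int k * pi) = iexp (of_int k * (-pi)) * exp (2 * of_int k * of_real pi * \<i>)"
      unfolding exp_add[symmetric] by (simp add: algebra_simps)
    also have "exp (2 * of_int k * of_real pi * \<i>) = 1"
      using exp_integer_2pi[of "of_int k"] by simp
    finally show ?thesis by simp
  qed
  finally show ?thesis using False by simp
qed

text \<open>Here \<open>fps_nth (P ^ s) n\<close> is the probability that a sum of \<open>s\<close> independent copies equals \<open>n\<close>.\<close>

locale lattice_distribution =
  fixes p :: "nat \<Rightarrow> real" and R :: real
  assumes nonneg: "\<And>n. p n \<ge> 0" and p_0: "p 0 = 0" and p_1: "p 1 > 0" and p_2: "p 2 > 0"
    and p_sums: "p sums 1" and R: "R > 1" and R_summable: "summable (\<lambda>n. p n * R ^ n)"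
begin

abbreviation P :: "real fps" where "P \<equiv> Abs_fps p"

definition mu :: real where "mu = (\<Sum>n. real n * p n)"

definition sigma2 :: real where "sigma2 = (\<Sum>n. (real n)\<^sup>2 * p n) - mu\<^sup>2"

definition phi :: "real \<Rightarrow> complex" where "phi t = (\<Sum>n. of_real (p n) * iexp (real n * t))"

lemma moment_summable: "summable (\<lambda>n. real n ^ q * p n)"
  using summable_power_moment[OF nonneg R_summable, of 1 q] R by simp

lemma p_summable: "summable p"
  using p_sums by (rule sums_summable)

section \<open>Generating function and Fourier inversion\<close>

lemma power_nonneg: "fps_nth (P ^ s) n \<ge> 0"
proof (induction s arbitrary: n)
  case (Suc s)
  then show ?case by (auto simp: fps_mult_nth intro!: sum_nonneg mult_nonneg_nonneg nonneg)
qed (simp add: fps_one_nth)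

lemma conv_radius: "fps_conv_radius P \<ge> ereal R"
  unfolding fps_conv_radius_def using R_summable R
  by (intro conv_radius_geI_ex') (auto intro!: summable_power_moment[of p R _ 0, simplified] simp: nonneg)

lemma eval_power:
  assumes "0 \<le> z" "z < R"
  shows "(\<lambda>n. fps_nth (P ^ s) n * z ^ n) sums (eval_fps P z ^ s)"
proof -
  have z: "ereal (norm z) < fps_conv_radius P"
    using assms conv_radius by (intro less_le_trans[OF _ conv_radius]) auto
  then have "ereal (norm z) < fps_conv_radius (P ^ s)"
    using fps_conv_radius_power[where f = P and n = s] by (rule less_le_trans)
  then show ?thesis using sums_eval_fps eval_fps_power[OF z] by metis
qed

lemma eval_1: "eval_fps P 1 = 1"
  using p_sums by (simp add: eval_fps_def sums_iff)

lemma power_le_eval: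
  assumes "0 \<le> z" "z < R"
  shows "fps_nth (P ^ s) n * z ^ n \<le> eval_fps P z ^ s"
proof -
  have "(\<Sum>k\<in>{n}. fps_nth (P ^ s) k * z ^ k) \<le> eval_fps P z ^ s"
    using eval_power[OF assms, of s]
    by (intro sum_le_suminf[of "\<lambda>n. fps_nth (P ^ s) n * z ^ n" "{n}", THEN order_trans])
      (auto simp: sums_iff power_nonneg assms)
  then show ?thesis by simp
qed

lemma power_sums_1: "fps_nth (P ^ s) sums 1"
  using eval_power[of 1 s] R by (simp add: eval_1)

text \<open>As \<open>R > 1\<close>, the unit circle lies inside the disc of convergence, so
  evaluation at \<open>iexp t\<close> commutes with powers.\<close>

lemma phi_power_sums: "(\<lambda>n. of_real (fps_nth (P ^ s) n) * iexp (real n * t)) sums (phi t ^ s)"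
proof -
  let ?Q = "Abs_fps (\<lambda>n. complex_of_real (p n))"
  let ?z = "iexp t"
  have "fps_conv_radius ?Q = fps_conv_radius P"
    unfolding fps_conv_radius_def conv_radius_def by (simp add: nonneg)
  then have z: "ereal (norm ?z) < fps_conv_radius ?Q"
    using conv_radius R by (auto intro: less_le_trans[of _ "ereal R"])
  have "eval_fps ?Q ?z = phi t"
    by (simp add: eval_fps_def phi_def iexp_power)
  moreover have "ereal (norm ?z) < fps_conv_radius (?Q ^ s)"
    using z fps_conv_radius_power[where f = ?Q and n = s] by (rule less_le_trans)
  ultimately have "(\<lambda>n. fps_nth (?Q ^ s) n * ?z ^ n) sums (phi t ^ s)"
    using sums_eval_fps eval_fps_power[OF z] by metis
  then show ?thesis by (simp add: fps_power_of_real iexp_power)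
qed

lemma phi_sums: "(\<lambda>n. of_real (p n) * iexp (real n * t)) sums phi t"
  using phi_power_sums[of 1 t] by simp

lemma phi_measurable [measurable]: "phi \<in> borel_measurable borel"
  unfolding phi_def by measurable

text \<open>The exponentials are orthogonal over a period, and integration term by term is
  legitimate because the coefficients of \<open>P ^ s\<close> are nonnegative with sum 1.\<close>

lemma coeff_Fourier:
  "(LBINT t. indicator {-pi..pi} t *\<^sub>R (phi t ^ s * iexp (- real n * t))) =
    of_real (2 * pi * fps_nth (P ^ s) n)"
proof -
  let ?q = "fps_nth (P ^ s)"
  let ?f = "\<lambda>m t. indicator {-pi..pi} t *\<^sub>R (of_real (?q m) * iexp (of_int (int m - int n) * t))"
  have f_int: "integrable lborel (?f m)" for m
    by (rule borel_integrable_compact) (auto intro!: continuous_intros)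
  have normf: "norm (?f m t) = ?q m * indicator {-pi..pi} t" for m t
    by (simp add: norm_mult power_nonneg indicator_def)
  have "(LBINT t. (\<Sum>m. ?f m t)) = (\<Sum>m. LBINT t. ?f m t)"
  proof (rule integral_suminf[OF f_int])
    show "AE t in lborel. summable (\<lambda>m. norm (?f m t))"
      unfolding normf using power_sums_1[of s] by (intro AE_I2 summable_mult2) (simp add: sums_iff)
    show "summable (\<lambda>m. LBINT t. norm (?f m t))"
      unfolding normf using power_sums_1[of s] by (simp add: summable_mult2 sums_iff)
  qed
  also have "(\<lambda>m. LBINT t. ?f m t) = (\<lambda>m. if m = n then of_real (2 * pi * ?q n) else 0)"
  proof
    fix m
    have "(LBINT t. ?f m t) = of_real (?q m) * (LBINT t. indicator {-pi..pi} t *\<^sub>R iexp (of_int (int m - int n) * t))"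
      by (simp only: integral_mult_right_zero[symmetric] mult_scaleR_right)
    then show "(LBINT t. ?f m t) = (if m = n then of_real (2 * pi * ?q n) else 0)"
      unfolding integral_iexp_period by simp
  qed
  also have "(\<Sum>m. if m = n then complex_of_real (2 * pi * ?q n) else 0) = of_real (2 * pi * ?q n)"
    using sums_unique[OF sums_single[of n "\<lambda>_. complex_of_real (2 * pi * ?q n)"]] by simp
  also have "(\<lambda>t. \<Sum>m. ?f m t) = (\<lambda>t. indicator {-pi..pi} t *\<^sub>R (phi t ^ s * iexp (- real n * t)))"
  proof
    fix t
    have "(\<lambda>m. indicator {-pi..pi} t *\<^sub>R ((of_real (?q m) * iexp (real m * t)) * iexp (- real n * t))) sums
        (indicator {-pi..pi} t *\<^sub>R (phi t ^ s * iexp (- real n * t)))"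
      by (intro sums_scaleR_right sums_mult2 phi_power_sums)
    moreover have "iexp (real m * t) * iexp (- real n * t) = iexp (of_int (int m - int n) * t)" for m
      unfolding exp_add[symmetric] by (simp add: algebra_simps)
    ultimately show "(\<Sum>m. ?f m t) = indicator {-pi..pi} t *\<^sub>R (phi t ^ s * iexp (- real n * t))"
      by (simp add: sums_iff mult.assoc)
  qed
  finally show ?thesis .
qed

section \<open>Decay and expansion of the characteristic function\<close>

text \<open>The masses at the neighbouring points 1 and 2 alone give the decay: their contribution
  has the modulus of \<open>p 1 + p 2 * cis t\<close>, which falls short of \<open>a\<close> by at
  least \<open>c * t^2\<close>, while the remaining mass adds at most \<open>1 - a\<close>.\<close>

lemma phi_bound:
  obtains c where "c > 0" "\<And>t. \<bar>t\<bar> \<le> pi \<Longrightarrow> norm (phi t) \<le> exp (- c * t\<^sup>2)"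
proof
  define a where "a = p 1 + p 2"
  \<comment> \<open>With this \<open>c\<close> the middle term \<open>2 * a * c * t^2\<close> of the
    square of \<open>a - c * t^2\<close> equals the loss \<open>2 * p 1 * p 2 * (t^2 / 8)\<close>
    given by the cosine estimate.\<close>
  define c where "c = p 1 * p 2 / (8 * a)"
  have a: "a > 0" using p_1 p_2 by (simp add: a_def)
  show "c > 0" using p_1 p_2 a by (simp add: c_def)
  fix t :: real assume t: "\<bar>t\<bar> \<le> pi"
  let ?r = "\<lambda>n. if n = 1 \<or> n = 2 then 0 else p n"
  have "(\<lambda>n. if n \<in> {1, 2::nat} then of_real (p n) * iexp (real n * t) else 0) sums
      (\<Sum>n\<in>{1, 2}. of_real (p n) * iexp (real n * t))"
    by (rule sums_If_finite_set) simp
  from sums_diff[OF phi_sums[of t] this]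
  have "(\<lambda>n. of_real (p n) * iexp (real n * t) -
      (if n \<in> {1, 2::nat} then of_real (p n) * iexp (real n * t) else 0)) sums
      (phi t - (of_real (p 1) * iexp t + of_real (p 2) * iexp (2 * t)))"
    by simp
  moreover have "(\<lambda>n. of_real (p n) * iexp (real n * t) -
      (if n \<in> {1, 2::nat} then of_real (p n) * iexp (real n * t) else 0)) =
      (\<lambda>n. of_real (?r n) * iexp (real n * t))"
    by auto
  ultimately have tail: "(\<lambda>n. of_real (?r n) * iexp (real n * t)) sums
      (phi t - (of_real (p 1) * iexp t + of_real (p 2) * iexp (2 * t)))"
    by simp
  have "(\<lambda>n. if n \<in> {1, 2::nat} then p n else 0) sums (\<Sum>n\<in>{1, 2}. p n)"
    by (rule sums_If_finite_set) simp
  from sums_diff[OF p_sums this] have "(\<lambda>n. p n - (if n \<in> {1, 2::nat} then p n else 0)) sums (1 - a)"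
    by (simp add: a_def)
  moreover have "(\<lambda>n. p n - (if n \<in> {1, 2::nat} then p n else 0)) = ?r" by auto
  ultimately have r: "?r sums (1 - a)" by simp
  have norm_r: "norm (of_real (?r n) * iexp (real n * t)) = ?r n" for n
    by (simp add: norm_mult nonneg)
  have "norm (\<Sum>n. of_real (?r n) * iexp (real n * t)) \<le> (\<Sum>n. norm (of_real (?r n) * iexp (real n * t)))"
    by (rule summable_norm) (unfold norm_r, use r in \<open>simp add: sums_iff\<close>)
  then have "norm (phi t - (of_real (p 1) * iexp t + of_real (p 2) * iexp (2 * t))) \<le> 1 - a"
    unfolding norm_r using r tail by (simp add: sums_iff)
  moreover have "norm (of_real (p 1) * iexp t + of_real (p 2) * iexp (2 * t)) \<le> a - c * t\<^sup>2"
  proof -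
    have "iexp (2 * t) = iexp t * iexp t" unfolding exp_add[symmetric] by (simp add: algebra_simps)
    then have "of_real (p 1) * iexp t + of_real (p 2) * iexp (2 * t) =
        iexp t * (of_real (p 1) + of_real (p 2) * cis t)"
      by (simp add: cis_conv_exp algebra_simps)
    then have "norm (of_real (p 1) * iexp t + of_real (p 2) * iexp (2 * t)) =
        norm (of_real (p 1) + of_real (p 2) * cis t)"
      by (simp add: norm_mult)
    also have "\<dots> \<le> a - c * t\<^sup>2"
    proof (rule power2_le_imp_le)
      have "(norm (of_real (p 1) + of_real (p 2) * cis t))\<^sup>2 =
          (p 1 + p 2 * cos t)\<^sup>2 + (p 2 * sin t)\<^sup>2"
        by (simp add: cmod_power2)
      also have "\<dots> = (p 1)\<^sup>2 + (p 2)\<^sup>2 * ((sin t)\<^sup>2 + (cos t)\<^sup>2) + 2 * p 1 * p 2 * cos t"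
        by (simp only: power2_eq_square algebra_simps)
      also have "\<dots> = a\<^sup>2 - 2 * p 1 * p 2 * (1 - cos t)"
        by (simp add: a_def power2_eq_square algebra_simps)
      also have "\<dots> \<le> a\<^sup>2 - 2 * p 1 * p 2 * (t\<^sup>2 / 8)"
        using one_minus_cos_ge[OF t] p_1 p_2 by simp
      also have "2 * p 1 * p 2 * (t\<^sup>2 / 8) = 2 * a * (c * t\<^sup>2)"
        using a by (simp add: c_def)
      also have "a\<^sup>2 - 2 * a * (c * t\<^sup>2) \<le> (a - c * t\<^sup>2)\<^sup>2"
        using zero_le_power2[of "c * t\<^sup>2"] unfolding power2_diff by linarith
      finally show "(norm (of_real (p 1) + of_real (p 2) * cis t))\<^sup>2 \<le> (a - c * t\<^sup>2)\<^sup>2" .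
      \<comment> \<open>Comparing squares requires \<open>a - c * t^2 \<ge> 0\<close>; this follows
        from \<open>t^2 \<le> 16\<close> and \<open>2 * p 1 * p 2 \<le> a^2\<close>.\<close>
      have "t\<^sup>2 \<le> pi\<^sup>2" using t by (metis abs_le_square_iff abs_of_pos pi_gt_zero)
      also have "\<dots> \<le> 4\<^sup>2" using pi_less_4 by (intro power_mono) auto
      finally have "t\<^sup>2 \<le> 16" by simp
      then have "c * t\<^sup>2 \<le> c * 16" using \<open>c > 0\<close> by (intro mult_left_mono) auto
      also have "c * 16 = 2 * (p 1 * p 2) / a" by (simp add: c_def)
      also have "\<dots> \<le> a"
        using a p_1 p_2 zero_le_power2[of "p 1"] zero_le_power2[of "p 2"]
        by (simp add: divide_le_eq a_def power2_eq_square algebra_simps)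
      finally show "0 \<le> a - c * t\<^sup>2" by simp
    qed
    finally show ?thesis .
  qed
  moreover have "norm (phi t) \<le> norm (phi t - (of_real (p 1) * iexp t + of_real (p 2) * iexp (2 * t))) +
      norm (of_real (p 1) * iexp t + of_real (p 2) * iexp (2 * t))"
    by (metis diff_add_cancel norm_triangle_ineq)
  ultimately have "norm (phi t) \<le> 1 - c * t\<^sup>2" by linarith
  also have "\<dots> \<le> exp (- c * t\<^sup>2)" using exp_ge_add_one_self[of "- c * t\<^sup>2"] by simp
  finally show "norm (phi t) \<le> exp (- c * t\<^sup>2)" .
qed

lemma variance_sums: "(\<lambda>n. (real n - mu)\<^sup>2 * p n) sums sigma2"
proof -
  have 1: "(\<lambda>n. real n * p n) sums mu"
    using moment_summable[of 1] by (simp add: mu_def sums_iff)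
  have 2: "(\<lambda>n. (real n)\<^sup>2 * p n) sums (sigma2 + mu\<^sup>2)"
    using moment_summable[of 2] by (simp add: sigma2_def sums_iff)
  have "(\<lambda>n. (real n)\<^sup>2 * p n - 2 * mu * (real n * p n) + mu\<^sup>2 * p n) sums
      (sigma2 + mu\<^sup>2 - 2 * mu * mu + mu\<^sup>2 * 1)"
    by (intro sums_add sums_diff sums_mult 1 2 p_sums)
  then show ?thesis by (simp add: power2_eq_square algebra_simps)
qed

lemma mean_sums: "(\<lambda>n. (real n - mu) * p n) sums 0"
proof -
  have "(\<lambda>n. real n * p n) sums mu"
    using moment_summable[of 1] by (simp add: mu_def sums_iff)
  from sums_diff[OF this sums_mult[OF p_sums, of mu]] show ?thesis by (simp add: algebra_simps)
qed

lemma mu_pos: "mu > 0"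
proof -
  have "(\<Sum>n\<in>{1}. real n * p n) \<le> mu"
    unfolding mu_def using moment_summable[of 1] by (intro sum_le_suminf) (auto simp: nonneg)
  then show ?thesis using p_1 by simp
qed

text \<open>Two distinct points carry mass, and the mean cannot coincide with both.\<close>

lemma sigma2_pos: "sigma2 > 0"
proof -
  have "(\<Sum>n\<in>{1,2}. (real n - mu)\<^sup>2 * p n) \<le> (\<Sum>n. (real n - mu)\<^sup>2 * p n)"
    using variance_sums by (intro sum_le_suminf) (auto simp: nonneg sums_iff)
  also have "\<dots> = sigma2" using variance_sums by (simp add: sums_iff)
  finally have "(1 - mu)\<^sup>2 * p 1 + (2 - mu)\<^sup>2 * p 2 \<le> sigma2" by simp
  moreover have "(1 - mu)\<^sup>2 * p 1 + (2 - mu)\<^sup>2 * p 2 > 0"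
  proof (cases "mu = 1")
    case False
    then have "(1 - mu)\<^sup>2 * p 1 > 0" using p_1 by simp
    then show ?thesis using p_2 by (intro add_pos_nonneg) auto
  qed (use p_2 in simp)
  ultimately show ?thesis by linarith
qed

text \<open>Characteristic function of the centred variable, which has no linear term at 0.\<close>

definition psi :: "real \<Rightarrow> complex" where "psi t = phi t * iexp (- mu * t)"

lemma norm_psi: "norm (psi t) = norm (phi t)"
  by (simp add: psi_def norm_mult)

lemma norm_phi_le_1: "norm (phi t) \<le> 1"
proof -
  have n: "norm (of_real (p n) * iexp (real n * t)) = p n" for n
    by (simp add: norm_mult nonneg)
  have "norm (phi t) \<le> (\<Sum>n. norm (of_real (p n) * iexp (real n * t)))"
    unfolding phi_def by (rule summable_norm) (simp only: n p_summable)
  also have "\<dots> = 1" unfolding n using p_sums by (simp add: sums_iff)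
  finally show ?thesis .
qed

text \<open>The Taylor remainder of \<open>iexp\<close> at each support point is summed against
  \<open>p\<close>; \<open>K\<close> is one sixth of the third absolute central moment.\<close>

lemma psi_approx:
  obtains K where "\<And>t. norm (psi t - of_real (1 - sigma2 * t\<^sup>2 / 2)) \<le> K * \<bar>t\<bar> ^ 3"
proof
  define K where "K = (\<Sum>n. \<bar>real n - mu\<bar> ^ 3 * p n) / 6"
  fix t
  let ?d = "\<lambda>n. real n - mu"
  have sm: "summable (\<lambda>n. \<bar>?d n\<bar> ^ 3 * p n)"
  proof (rule summable_comparison_test')
    show "summable (\<lambda>n. 4 * (real n ^ 3 * p n) + 4 * mu ^ 3 * p n)"
      by (intro summable_add summable_mult moment_summable p_summable)
    fix n :: nat
    have "\<bar>?d n\<bar> ^ 3 \<le> (real n + mu) ^ 3"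
      using mu_pos by (intro power_mono) auto
    also have "\<dots> \<le> 4 * (real n ^ 3) + 4 * mu ^ 3"
    proof -
      \<comment> \<open>This is the identity
        \<open>4 * (a^3 + b^3) - (a + b)^3 = 3 * (a + b) * (a - b)^2\<close>.\<close>
      have "0 \<le> 3 * (real n + mu) * (real n - mu)\<^sup>2" using mu_pos by simp
      then show ?thesis by (simp add: power2_eq_square power3_eq_cube algebra_simps)
    qed
    finally show "norm (\<bar>?d n\<bar> ^ 3 * p n) \<le> 4 * (real n ^ 3 * p n) + 4 * mu ^ 3 * p n"
      using mult_right_mono[OF _ nonneg[of n]] nonneg[of n] by (fastforce simp: algebra_simps)
  qed
  have psi: "(\<lambda>n. of_real (p n) * iexp (?d n * t)) sums psi t"
  proof -
    have "iexp (real n * t) * iexp (- mu * t) = iexp (?d n * t)" for n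
      unfolding exp_add[symmetric] by (simp add: algebra_simps)
    then show ?thesis
      using sums_mult2[OF phi_sums, of t "iexp (- mu * t)"] by (simp add: psi_def mult.assoc)
  qed
  have "(\<lambda>n. p n * 1 - (?d n)\<^sup>2 * p n * (t\<^sup>2 / 2)) sums (1 * 1 - sigma2 * (t\<^sup>2 / 2))"
    by (intro sums_diff sums_mult2 variance_sums p_sums)
  from sums_add[OF sums_of_real[OF this] sums_mult[OF sums_of_real[OF mean_sums], of "\<i> * of_real t"]]
  have "(\<lambda>n. of_real (p n * 1 - (?d n)\<^sup>2 * p n * (t\<^sup>2 / 2)) + \<i> * of_real t * of_real (?d n * p n)) sums
      (of_real (1 - sigma2 * t\<^sup>2 / 2) :: complex)"
    by simp
  from sums_diff[OF psi this]
  have diff: "(\<lambda>n. of_real (p n) * iexp (?d n * t) - (of_real (p n * 1 - (?d n)\<^sup>2 * p n * (t\<^sup>2 / 2)) +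
      \<i> * of_real t * of_real (?d n * p n))) sums (psi t - of_real (1 - sigma2 * t\<^sup>2 / 2))" .
  let ?e = "\<lambda>n. of_real (p n) * iexp (?d n * t) - (of_real (p n * 1 - (?d n)\<^sup>2 * p n * (t\<^sup>2 / 2)) +
      \<i> * of_real t * of_real (?d n * p n))"
  have e: "norm (?e n) \<le> \<bar>?d n\<bar> ^ 3 * p n * (\<bar>t\<bar> ^ 3 / 6)" for n
  proof -
    define x where "x = ?d n * t"
    have "(\<Sum>k\<le>2. (\<i> * of_real x) ^ k / fact k) = 1 + \<i> * of_real x + (\<i> * of_real x)\<^sup>2 / 2"
      by (simp add: eval_nat_numeral)
    also have "(\<i> * of_real x)\<^sup>2 = - of_real (x\<^sup>2)"
      by (simp add: power_mult_distrib)
    finally have taylor: "(\<Sum>k\<le>2. (\<i> * of_real x) ^ k / fact k) =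
        of_real (1 - x\<^sup>2 / 2) + \<i> * of_real x"
      by simp
    have "p n * 1 - (?d n)\<^sup>2 * p n * (t\<^sup>2 / 2) = p n * (1 - x\<^sup>2 / 2)"
      by (simp add: x_def power2_eq_square field_simps)
    moreover have "\<i> * of_real t * of_real (?d n * p n) = of_real (p n) * (\<i> * complex_of_real x)"
      by (simp add: x_def)
    ultimately have "?e n = of_real (p n) * iexp x -
        (of_real (p n * (1 - x\<^sup>2 / 2)) + of_real (p n) * (\<i> * of_real x))"
      by (simp only: x_def)
    also have "\<dots> = of_real (p n) * (iexp x - (\<Sum>k\<le>2. (\<i> * of_real x) ^ k / fact k))"
      unfolding taylor by (simp add: algebra_simps)
    also have "norm \<dots> = p n * norm (iexp x - (\<Sum>k\<le>2. (\<i> * of_real x) ^ k / fact k))"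
      by (simp only: norm_mult norm_of_real) (simp add: nonneg)
    also have "\<dots> \<le> p n * (\<bar>x\<bar> ^ Suc 2 / fact (Suc 2))"
      by (intro mult_left_mono iexp_approx1 nonneg)
    also have "\<dots> = \<bar>?d n\<bar> ^ 3 * p n * (\<bar>t\<bar> ^ 3 / 6)"
    proof -
      have "\<bar>x\<bar> ^ Suc 2 / fact (Suc 2) = \<bar>x\<bar> ^ 3 / 6"
        by (simp add: eval_nat_numeral)
      moreover have "\<bar>x\<bar> ^ 3 = \<bar>?d n\<bar> ^ 3 * \<bar>t\<bar> ^ 3"
        by (simp only: x_def abs_mult power_mult_distrib)
      ultimately show ?thesis by (simp only: mult_ac times_divide_eq_right)
    qed
    finally show ?thesis .
  qed
  have "norm (psi t - of_real (1 - sigma2 * t\<^sup>2 / 2)) = norm (\<Sum>n. ?e n)"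
    using diff by (simp add: sums_iff)
  also have "\<dots> \<le> (\<Sum>n. \<bar>?d n\<bar> ^ 3 * p n * (\<bar>t\<bar> ^ 3 / 6))"
    by (rule norm_suminf_le[OF e]) (intro summable_mult2 sm)
  also have "\<dots> = K * \<bar>t\<bar> ^ 3"
    using suminf_mult2[OF sm, of "\<bar>t\<bar> ^ 3 / 6"] by (simp add: K_def)
  finally show "norm (psi t - of_real (1 - sigma2 * t\<^sup>2 / 2)) \<le> K * \<bar>t\<bar> ^ 3" .
qed

text \<open>For numbers of modulus at most 1, the \<open>m\<close>-th powers differ by at most
  \<open>m\<close> times the difference of the bases, here of order \<open>m * m ^ (-3/2)\<close>.
  The comparison sequence has the form \<open>(1 - c / m) ^ m\<close>.\<close>

lemma psi_power_tendsto:
  assumes s: "filterlim s at_top sequentially"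
  shows "(\<lambda>k. psi (u / sqrt (real (s k))) ^ s k) \<longlonglongrightarrow> of_real (exp (- sigma2 * u\<^sup>2 / 2))"
proof -
  obtain K where K: "\<And>t. norm (psi t - of_real (1 - sigma2 * t\<^sup>2 / 2)) \<le> K * \<bar>t\<bar> ^ 3"
    using psi_approx by blast
  let ?t = "\<lambda>m::nat. u / sqrt (real m)"
  let ?w = "\<lambda>m::nat. 1 - sigma2 * (?t m)\<^sup>2 / 2"
  have w_eq: "?w m = 1 + (- sigma2 * u\<^sup>2 / 2) / real m" for m
    by (simp add: power_divide)
  have main: "(\<lambda>m. psi (?t m) ^ m) \<longlonglongrightarrow> of_real (exp (- sigma2 * u\<^sup>2 / 2))"
  proof (rule Lim_transform)
    have "(\<lambda>m. ?w m ^ m) \<longlonglongrightarrow> exp (- sigma2 * u\<^sup>2 / 2)"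
      unfolding w_eq by (rule tendsto_exp_limit_sequentially)
    then show "(\<lambda>m. complex_of_real (?w m) ^ m) \<longlonglongrightarrow> of_real (exp (- sigma2 * u\<^sup>2 / 2))"
      by (metis (no_types, lifting) ext of_real_power tendsto_of_real)
    have "\<forall>\<^sub>F m in sequentially. norm (psi (?t m) ^ m - complex_of_real (?w m) ^ m) \<le> K * \<bar>u\<bar> ^ 3 / sqrt (real m)"
    proof -
      have "(\<lambda>m. (sigma2 * u\<^sup>2 / 2) / real m) \<longlonglongrightarrow> 0" by (rule lim_const_over_n)
      then have "\<forall>\<^sub>F m in sequentially. (sigma2 * u\<^sup>2 / 2) / real m < 1" by (rule order_tendstoD) simp
      then show ?thesis using eventually_gt_at_top[of 0]
      proof eventually_elim
        case (elim m)
        have "0 \<le> (sigma2 * u\<^sup>2 / 2) / real m" using sigma2_pos by simp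
        with elim have w1: "\<bar>?w m\<bar> \<le> 1" unfolding w_eq by (auto simp: abs_le_iff)
        have "norm (psi (?t m) ^ m - complex_of_real (?w m) ^ m) \<le>
            real m * norm (psi (?t m) - complex_of_real (?w m))"
          by (rule norm_power_diff) (use w1 norm_psi norm_phi_le_1 in \<open>simp_all del: of_real_diff\<close>)
        also have "\<dots> \<le> real m * (K * \<bar>?t m\<bar> ^ 3)"
          using K[of "?t m"] by (intro mult_left_mono) (simp_all add: norm_minus_commute)
        also have "\<dots> = K * \<bar>u\<bar> ^ 3 / sqrt (real m)"
        proof -
          have "sqrt (real m) ^ 3 = real m * sqrt (real m)" by (simp add: power3_eq_cube)
          then show ?thesis using elim by (simp add: power_divide)
        qed
        finally show ?case .
      qed
    qed
    moreover have "(\<lambda>m. K * \<bar>u\<bar> ^ 3 / sqrt (real m)) \<longlonglongrightarrow> 0"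
      by (intro tendsto_divide_0[OF tendsto_const] filterlim_at_top_imp_at_infinity
          filterlim_compose[OF sqrt_at_top] filterlim_real_sequentially)
    ultimately have "(\<lambda>m. psi (?t m) ^ m - complex_of_real (?w m) ^ m) \<longlonglongrightarrow> 0"
      by (rule Lim_null_comparison)
    then show "(\<lambda>m. psi (?t m) ^ m - complex_of_real (?w m) ^ m) \<longlonglongrightarrow> 0" .
  qed
  from filterlim_compose[OF this s] show ?thesis by simp
qed

section \<open>Scaled Fourier integrals and the local limit\<close>

text \<open>The Fourier integrand after the substitution \<open>t = u / sqrt s\<close>. The
  parameter \<open>d\<close> is the deviation \<open>n - s * mu\<close>; it enters only as a phase,
  so the modulus does not depend on \<open>n\<close>.\<close>

definition scaled_integrand :: "nat \<Rightarrow> real \<Rightarrow> real \<Rightarrow> complex"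
  where "scaled_integrand s d u = indicator {-pi..pi} (u / sqrt (real s)) *\<^sub>R
    (psi (u / sqrt (real s)) ^ s * iexp (- d * (u / sqrt (real s))))"

lemma scaled_integrand_measurable [measurable]:
  "scaled_integrand s d \<in> borel_measurable borel"
  unfolding scaled_integrand_def psi_def by measurable

lemma coeff_scaled:
  assumes "s > 0"
  shows "(LBINT u. scaled_integrand s (real n - real s * mu) u) =
    of_real (2 * pi * (sqrt (real s) * fps_nth (P ^ s) n))"
proof -
  let ?f = "\<lambda>t. indicator {-pi..pi} t *\<^sub>R (phi t ^ s * iexp (- real n * t))"
  have f: "?f t = indicator {-pi..pi} t *\<^sub>R (psi t ^ s * iexp (- (real n - real s * mu) * t))" for t
  proof -
    have "iexp (- mu * t) ^ s * iexp (- (real n - real s * mu) * t) = iexp (- real n * t)"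
      unfolding iexp_power exp_add[symmetric] by (simp add: algebra_simps)
    then show ?thesis by (simp add: psi_def power_mult_distrib mult.assoc)
  qed
  have "scaled_integrand s (real n - real s * mu) u = ?f (0 + 1 / sqrt (real s) * u)" for u
  proof -
    have arg: "0 + 1 / sqrt (real s) * u = u / sqrt (real s)" by simp
    show ?thesis unfolding scaled_integrand_def arg by (rule f[symmetric])
  qed
  moreover have "(LBINT t. ?f t) = \<bar>1 / sqrt (real s)\<bar> *\<^sub>R (LBINT u. ?f (0 + 1 / sqrt (real s) * u))"
    by (rule lborel_integral_real_affine) (use assms in simp)
  ultimately have "(LBINT t. ?f t) =
      \<bar>1 / sqrt (real s)\<bar> *\<^sub>R (LBINT u. scaled_integrand s (real n - real s * mu) u)"
    by (simp only:)
  then have "of_real (2 * pi * fps_nth (P ^ s) n) =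
      (1 / sqrt (real s)) *\<^sub>R (LBINT u. scaled_integrand s (real n - real s * mu) u)"
    unfolding coeff_Fourier by simp
  then show ?thesis using assms by (simp add: scaleR_conv_of_real field_simps)
qed

lemma gaussian_integrable: "c > 0 \<Longrightarrow> integrable lborel (\<lambda>u::real. exp (- c * u\<^sup>2))"
  and gaussian_integral: "c > 0 \<Longrightarrow> (LBINT u. exp (- c * u\<^sup>2)) = sqrt (pi / c)"
proof -
  assume c: "c > 0"
  define \<tau> where "\<tau> = sqrt (1 / (2 * c))"
  have \<tau>: "\<tau> > 0" "\<tau>\<^sup>2 = 1 / (2 * c)" using c by (simp_all add: \<tau>_def)
  have eq: "exp (- c * u\<^sup>2) = sqrt (pi / c) * normal_density 0 \<tau> u" for u
    using c by (simp add: normal_density_def \<tau>(2) real_sqrt_divide)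
  show "integrable lborel (\<lambda>u::real. exp (- c * u\<^sup>2))"
    unfolding eq using \<tau> by (intro integrable_mult_right integrable_normal_density) auto
  show "(LBINT u. exp (- c * u\<^sup>2)) = sqrt (pi / c)"
    unfolding eq using \<tau> by simp
qed

text \<open>Dominated convergence: the decay of \<open>phi\<close> yields a Gaussian majorant
  independent of the number of summands, and bounded deviations make the phase tend to 1
  pointwise.\<close>

lemma scaled_integrand_limits:
  fixes s :: "nat \<Rightarrow> nat"
  assumes s: "filterlim s at_top sequentially" and d: "\<And>k. \<bar>d k\<bar> \<le> C"
  shows "(\<lambda>k. LBINT u. scaled_integrand (s k) (d k) u) \<longlonglongrightarrow> of_real (sqrt (2 * pi / sigma2))"
    and "(\<lambda>k. LBINT u. norm (scaled_integrand (s k) (d k) u)) \<longlonglongrightarrow> sqrt (2 * pi / sigma2)"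
proof -
  obtain c where c: "c > 0" "\<And>t. \<bar>t\<bar> \<le> pi \<Longrightarrow> norm (phi t) \<le> exp (- c * t\<^sup>2)"
    using phi_bound by blast
  have bound: "norm (scaled_integrand m e u) \<le> exp (- c * u\<^sup>2)" if "m > 0" for m e u
  proof (cases "\<bar>u / sqrt (real m)\<bar> \<le> pi")
    case True
    have "norm (scaled_integrand m e u) \<le> norm (psi (u / sqrt (real m))) ^ m"
      by (simp add: scaled_integrand_def norm_mult norm_power indicator_def)
    also have "\<dots> \<le> exp (- c * (u / sqrt (real m))\<^sup>2) ^ m"
      unfolding norm_psi by (intro power_mono c(2)[OF True]) simp
    also have "\<dots> = exp (- c * u\<^sup>2)"
      using that by (simp flip: exp_of_nat_mult add: power_divide)
    finally show ?thesis .
  next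
    case False
    then have "u / sqrt (real m) \<notin> {-pi..pi}" by (auto simp: abs_le_iff)
    then show ?thesis by (simp add: scaled_integrand_def)
  qed
  have s_pos: "\<forall>\<^sub>F k in sequentially. s k > 0"
    using s unfolding filterlim_at_top by (auto elim!: allE[of _ 1] eventually_mono)
  have scale: "(\<lambda>k. u / sqrt (real (s k))) \<longlonglongrightarrow> 0" for u
    by (intro tendsto_divide_0[OF tendsto_const] filterlim_at_top_imp_at_infinity
        filterlim_compose[OF sqrt_at_top] filterlim_compose[OF filterlim_real_sequentially] s)
  have lim: "(\<lambda>k. scaled_integrand (s k) (d k) u) \<longlonglongrightarrow> of_real (exp (- (sigma2 / 2) * u\<^sup>2))" for u
  proof -
    have "\<forall>\<^sub>F k in sequentially. \<bar>u / sqrt (real (s k))\<bar> < pi"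
      using order_tendstoD(2)[OF tendsto_rabs[OF scale[of u]], of pi] by simp
    then have ind: "(\<lambda>k. indicator {-pi..pi} (u / sqrt (real (s k))) :: real) \<longlonglongrightarrow> 1"
    proof (intro tendsto_eventually, elim eventually_mono)
      fix k assume "\<bar>u / sqrt (real (s k))\<bar> < pi"
      then have "- pi \<le> u / sqrt (real (s k)) \<and> u / sqrt (real (s k)) \<le> pi" by linarith
      then show "indicator {-pi..pi} (u / sqrt (real (s k))) = (1::real)" by simp
    qed
    have "(\<lambda>k. d k * (u / sqrt (real (s k)))) \<longlonglongrightarrow> 0"
    proof (rule Lim_null_comparison)
      show "\<forall>\<^sub>F k in sequentially. norm (d k * (u / sqrt (real (s k)))) \<le> C * \<bar>u / sqrt (real (s k))\<bar>"
        using d by (intro always_eventually allI) (simp only: real_norm_def abs_mult, intro mult_right_mono, auto)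
      show "(\<lambda>k. C * \<bar>u / sqrt (real (s k))\<bar>) \<longlonglongrightarrow> 0"
        using tendsto_mult[OF tendsto_const[of C] tendsto_rabs[OF scale[of u]]] by simp
    qed
    then have "(\<lambda>k. iexp (- (d k * (u / sqrt (real (s k)))))) \<longlonglongrightarrow> iexp (- 0)"
      by (intro tendsto_intros)
    from tendsto_scaleR[OF ind tendsto_mult[OF psi_power_tendsto[OF s, of u] this]]
    show ?thesis by (simp add: scaled_integrand_def)
  qed
  have int: "integrable lborel (\<lambda>u. exp (- c * u\<^sup>2))" by (rule gaussian_integrable[OF c(1)])
  have val: "(LBINT u. exp (- (sigma2 / 2) * u\<^sup>2)) = sqrt (2 * pi / sigma2)"
    using gaussian_integral[of "sigma2 / 2"] sigma2_pos by (simp add: mult.commute)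
  \<comment> \<open>The majorant is available only for \<open>s k > 0\<close>, hence the shift of
    the sequence by \<open>N\<close>.\<close>
  obtain N where N: "\<And>k. k \<ge> N \<Longrightarrow> s k > 0"
    using s_pos unfolding eventually_sequentially by blast
  let ?g = "\<lambda>k u. scaled_integrand (s (k + N)) (d (k + N)) u"
  have "(\<lambda>k. LBINT u. ?g k u) \<longlonglongrightarrow> (LBINT u. complex_of_real (exp (- (sigma2 / 2) * u\<^sup>2)))"
  proof (rule integral_dominated_convergence[where w = "\<lambda>u. exp (- c * u\<^sup>2)"])
    show "AE u in lborel. (\<lambda>k. ?g k u) \<longlonglongrightarrow> complex_of_real (exp (- (sigma2 / 2) * u\<^sup>2))"
      by (intro AE_I2 LIMSEQ_ignore_initial_segment[OF lim])
  qed (use int N bound in auto)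
  then show "(\<lambda>k. LBINT u. scaled_integrand (s k) (d k) u) \<longlonglongrightarrow> of_real (sqrt (2 * pi / sigma2))"
    by - (rule LIMSEQ_offset[where k = N], simp only: integral_complex_of_real val)
  have "(\<lambda>k. LBINT u. norm (?g k u)) \<longlonglongrightarrow> (LBINT u. norm (complex_of_real (exp (- (sigma2 / 2) * u\<^sup>2))))"
  proof (rule integral_dominated_convergence[where w = "\<lambda>u. exp (- c * u\<^sup>2)"])
    show "AE u in lborel. (\<lambda>k. norm (?g k u)) \<longlonglongrightarrow> norm (complex_of_real (exp (- (sigma2 / 2) * u\<^sup>2)))"
      by (intro AE_I2 tendsto_norm LIMSEQ_ignore_initial_segment[OF lim])
  qed (use int N bound in auto)
  then show "(\<lambda>k. LBINT u. norm (scaled_integrand (s k) (d k) u)) \<longlonglongrightarrow> sqrt (2 * pi / sigma2)"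
    using val by - (rule LIMSEQ_offset[where k = N], simp)
qed

text \<open>A bounded deviation is negligible on the scale \<open>sqrt s\<close>, so the limit is
  the peak of the normal density.\<close>

lemma local_limit:
  fixes s n :: "nat \<Rightarrow> nat"
  assumes s: "filterlim s at_top sequentially" and n: "\<And>k. \<bar>real (n k) - real (s k) * mu\<bar> \<le> C"
  shows "(\<lambda>k. sqrt (real (s k)) * fps_nth (P ^ s k) (n k)) \<longlonglongrightarrow> 1 / sqrt (2 * pi * sigma2)"
proof -
  have pos: "\<forall>\<^sub>F k in sequentially. s k > 0"
    using s unfolding filterlim_at_top by (auto elim!: allE[of _ 1] eventually_mono)
  have "(\<lambda>k. complex_of_real (2 * pi * (sqrt (real (s k)) * fps_nth (P ^ s k) (n k)))) \<longlonglongrightarrow>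
      of_real (sqrt (2 * pi / sigma2))"
    by (rule Lim_transform_eventually[OF scaled_integrand_limits(1)[OF s,
          of "\<lambda>k. real (n k) - real (s k) * mu" C, OF n]])
      (use pos in \<open>auto elim!: eventually_mono simp: coeff_scaled\<close>)
  then have "(\<lambda>k. 2 * pi * (sqrt (real (s k)) * fps_nth (P ^ s k) (n k))) \<longlonglongrightarrow> sqrt (2 * pi / sigma2)"
    by (simp only: tendsto_of_real_iff)
  from tendsto_divide[OF this tendsto_const[of "2 * pi"]]
  have "(\<lambda>k. sqrt (real (s k)) * fps_nth (P ^ s k) (n k)) \<longlonglongrightarrow> sqrt (2 * pi / sigma2) / (2 * pi)"
    by simp
  also have "sqrt (2 * pi / sigma2) / (2 * pi) = 1 / sqrt (2 * pi * sigma2)"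
    using sigma2_pos by (simp add: real_sqrt_divide real_sqrt_mult field_simps)
  finally show ?thesis .
qed

text \<open>Taking the modulus inside the integral removes the phase and with it \<open>n\<close>.
  The limiting integrand is positive, so the bound still tends to the sharp peak value.\<close>

lemma local_upper:
  obtains B :: "nat \<Rightarrow> real" where "\<And>s n. s > 0 \<Longrightarrow> sqrt (real s) * fps_nth (P ^ s) n \<le> B s"
    and "B \<longlonglongrightarrow> 1 / sqrt (2 * pi * sigma2)"
proof
  define B where "B s = (LBINT u. norm (scaled_integrand s 0 u)) / (2 * pi)" for s
  fix s n :: nat assume s: "s > 0"
  have "2 * pi * (sqrt (real s) * fps_nth (P ^ s) n) =
      norm (complex_of_real (2 * pi * (sqrt (real s) * fps_nth (P ^ s) n)))"
    using power_nonneg[of s n] by (simp only: norm_of_real) simp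
  also have "\<dots> = norm (LBINT u. scaled_integrand s (real n - real s * mu) u)"
    by (simp only: coeff_scaled[OF s])
  also have "\<dots> \<le> (LBINT u. norm (scaled_integrand s (real n - real s * mu) u))"
    by (rule integral_norm_bound)
  also have "\<dots> = (LBINT u. norm (scaled_integrand s 0 u))"
    by (simp add: scaled_integrand_def norm_mult)
  finally show "sqrt (real s) * fps_nth (P ^ s) n \<le> B s"
    by (simp add: B_def field_simps)
next
  have "(\<lambda>k. LBINT u. norm (scaled_integrand k 0 u)) \<longlonglongrightarrow> sqrt (2 * pi / sigma2)"
    by (rule scaled_integrand_limits(2)[of "\<lambda>k. k" "\<lambda>_. 0" 0]) (auto intro: filterlim_ident)
  from tendsto_divide[OF this tendsto_const[of "2 * pi"]]
  have "(\<lambda>s. (LBINT u. norm (scaled_integrand s 0 u)) / (2 * pi)) \<longlonglongrightarrow> sqrt (2 * pi / sigma2) / (2 * pi)"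
    by simp
  also have "sqrt (2 * pi / sigma2) / (2 * pi) = 1 / sqrt (2 * pi * sigma2)"
    using sigma2_pos by (simp add: real_sqrt_divide real_sqrt_mult field_simps)
  finally show "(\<lambda>s. (LBINT u. norm (scaled_integrand s 0 u)) / (2 * pi)) \<longlonglongrightarrow> 1 / sqrt (2 * pi * sigma2)" .
qed

section \<open>Small numbers of summands and the maximum\<close>

lemma eval_has_derivative: "(eval_fps P has_real_derivative mu) (at 1)"
proof -
  have r: "ereal (norm (1::real)) < fps_conv_radius P"
    using conv_radius R by (auto intro: less_le_trans[of _ "ereal R"])
  have "(\<lambda>n. real n * p n) sums mu"
    using moment_summable[of 1] by (simp add: mu_def sums_iff)
  then have "(\<lambda>n. real (Suc n) * p (Suc n)) sums mu"
    by (subst sums_Suc_iff) simp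
  then have "eval_fps (fps_deriv P) 1 = mu"
    by (simp add: eval_fps_def sums_iff)
  then show ?thesis using has_field_derivative_eval_fps[OF r, of UNIV] by simp
qed

text \<open>Chernoff's bound: a sum of \<open>s\<close> copies has mean \<open>s * mu\<close>, which stays below \<open>n\<close> by a factor.\<close>

lemma few_summands:
  assumes a: "0 < a" "a * mu < 1"
  obtains \<delta> where "\<delta> > 0" "\<And>s n. real s \<le> a * real n \<Longrightarrow> fps_nth (P ^ s) n \<le> exp (- \<delta> * real n)"
proof -
  \<comment> \<open>\<open>?F\<close> vanishes at 1 with derivative \<open>1 - a * mu > 0\<close>,
    hence is positive at some \<open>z\<close> slightly above 1; its value there is the exponential
    rate.\<close>
  let ?F = "\<lambda>z. ln z - a * ln (eval_fps P z)"
  have "(?F has_real_derivative (1 - a * mu)) (at 1)"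
    by (auto intro!: derivative_eq_intros eval_has_derivative simp: eval_1)
  from DERIV_pos_inc_right[OF this] a obtain d where d: "d > 0"
    "\<And>h. 0 < h \<Longrightarrow> h < d \<Longrightarrow> ?F 1 < ?F (1 + h)" by auto
  define z where "z = 1 + min d (R - 1) / 2"
  have z: "1 < z" "z < R" using d(1) R by (auto simp: z_def min_def field_simps)
  have F: "?F z > 0"
    using d(2)[of "min d (R - 1) / 2"] d(1) R by (simp add: z_def eval_1)
  \<comment> \<open>This makes the logarithm nonnegative, so that \<open>s\<close> may be replaced
    by its upper bound \<open>a * n\<close> in the exponent.\<close>
  have E: "eval_fps P z \<ge> 1"
  proof -
    have sz: "(\<lambda>n. p n * z ^ n) sums eval_fps P z" using eval_power[of z 1] z by simp
    have "p n * 1 \<le> p n * z ^ n" for n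
      using z nonneg[of n] by (intro mult_left_mono) auto
    then show ?thesis using sums_le[OF _ p_sums sz] by simp
  qed
  have "fps_nth (P ^ s) n \<le> exp (- ?F z * real n)" if "real s \<le> a * real n" for s n
  proof -
    have "fps_nth (P ^ s) n * z ^ n \<le> eval_fps P z ^ s"
      using z by (intro power_le_eval) auto
    also have "\<dots> = exp (real s * ln (eval_fps P z))"
      using E by (simp add: exp_of_nat_mult)
    also have "\<dots> \<le> exp (a * real n * ln (eval_fps P z))"
      using that E by (auto intro!: mult_right_mono)
    finally have "fps_nth (P ^ s) n \<le> exp (a * real n * ln (eval_fps P z)) / z ^ n"
      using z by (simp add: field_simps)
    also have "z ^ n = exp (real n * ln z)" using z by (simp add: exp_of_nat_mult)
    finally show ?thesis by (simp add: exp_diff[symmetric] algebra_simps)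
  qed
  with F show ?thesis by (rule that)
qed

text \<open>For the lower bound, \<open>s\<close> is \<open>n / mu\<close> rounded down, so the
  deviation is at most \<open>mu\<close>. For the upper bound a maximising \<open>s\<close> is
  either at most \<open>a * n\<close>, with \<open>a\<close> below \<open>1 / mu\<close>, or larger;
  then the uniform bound of order \<open>1 / sqrt s\<close> applies, and arbitrarily large
  \<open>s\<close> do no harm.\<close>

lemma max_asymptotics:
  fixes M :: "nat \<Rightarrow> real"
  assumes lower: "\<And>s n. s \<ge> 1 \<Longrightarrow> fps_nth (P ^ s) n \<le> M n"
    and attained: "\<And>n. \<exists>s\<ge>1. M n \<le> fps_nth (P ^ s) n"
  shows "(\<lambda>n. sqrt (real n) * M n) \<longlonglongrightarrow> sqrt (mu / (2 * pi * sigma2))"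
proof -
  define \<kappa> where "\<kappa> = 1 / sqrt (2 * pi * sigma2)"
  have \<kappa>: "\<kappa> > 0" using sigma2_pos by (simp add: \<kappa>_def)
  have lam: "sqrt (mu / (2 * pi * sigma2)) = \<kappa> * sqrt mu"
    by (simp add: \<kappa>_def real_sqrt_divide)
  show ?thesis unfolding lam
  proof (rule order_tendstoI)
    fix y assume y: "y < \<kappa> * sqrt mu"
    define s where "s n = nat \<lfloor>real n / mu\<rfloor>" for n
    have s_bounds: "real (s n) \<le> real n / mu" "real n / mu - 1 \<le> real (s n)" for n
      using mu_pos by (simp_all add: s_def of_nat_nat)
    have quot: "(\<lambda>n. real (s n) / real n) \<longlonglongrightarrow> 1 / mu"
    proof (rule tendsto_sandwich)
      have "(\<lambda>n. 1 / mu - 1 / real n) \<longlonglongrightarrow> 1 / mu - 0"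
        by (intro tendsto_diff tendsto_const lim_1_over_n)
      then show "(\<lambda>n. 1 / mu - 1 / real n) \<longlonglongrightarrow> 1 / mu" by simp
      show "\<forall>\<^sub>F n in sequentially. 1 / mu - 1 / real n \<le> real (s n) / real n"
        using eventually_gt_at_top[of 0]
      proof eventually_elim
        case (elim n)
        have "(real n / mu - 1) / real n \<le> real (s n) / real n"
          by (intro divide_right_mono s_bounds) simp
        then show ?case using elim by (simp add: diff_divide_distrib)
      qed
      show "\<forall>\<^sub>F n in sequentially. real (s n) / real n \<le> 1 / mu"
        using eventually_gt_at_top[of 0]
      proof eventually_elim
        case (elim n)
        have "real (s n) / real n \<le> (real n / mu) / real n"
          by (intro divide_right_mono s_bounds) simp
        then show ?case using elim by simp
      qed
    qed simp
    have s_top: "filterlim s at_top sequentially"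
    proof -
      have "filterlim (\<lambda>n. - 1 + 1 / mu * real n) at_top sequentially"
        using mu_pos by (intro filterlim_tendsto_add_at_top[OF tendsto_const]
            filterlim_tendsto_pos_mult_at_top[OF tendsto_const] filterlim_real_sequentially) auto
      then have "filterlim (\<lambda>n. real (s n)) at_top sequentially"
        by (rule filterlim_at_top_mono) (use s_bounds(2) in \<open>auto simp: algebra_simps\<close>)
      then show ?thesis by (simp add: filterlim_sequentially_iff_filterlim_real)
    qed
    have "\<bar>real n - real (s n) * mu\<bar> \<le> mu" for n
      using s_bounds[of n] mu_pos by (simp add: field_simps abs_le_iff)
    from local_limit[OF s_top this]
    \<comment> \<open>Dividing by \<open>sqrt (s / n)\<close> converts the normalisation
      \<open>sqrt s\<close> into \<open>sqrt n\<close>.\<close>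
    have "(\<lambda>n. sqrt (real (s n)) * fps_nth (P ^ s n) n / sqrt (real (s n) / real n)) \<longlonglongrightarrow>
        \<kappa> / sqrt (1 / mu)"
      unfolding \<kappa>_def using mu_pos by (intro tendsto_divide tendsto_real_sqrt quot) auto
    also have "\<kappa> / sqrt (1 / mu) = \<kappa> * sqrt mu" by (simp add: real_sqrt_divide)
    finally have "\<forall>\<^sub>F n in sequentially.
        y < sqrt (real (s n)) * fps_nth (P ^ s n) n / sqrt (real (s n) / real n)"
      using y by (rule order_tendstoD)
    moreover have "\<forall>\<^sub>F n in sequentially. 1 \<le> s n"
      using s_top unfolding filterlim_at_top by blast
    ultimately show "\<forall>\<^sub>F n in sequentially. y < sqrt (real n) * M n"
    proof eventually_elim
      case (elim n)
      have "sqrt (real (s n)) * fps_nth (P ^ s n) n / sqrt (real (s n) / real n) =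
          sqrt (real n) * fps_nth (P ^ s n) n"
        using elim(2) by (simp add: real_sqrt_divide)
      also have "\<dots> \<le> sqrt (real n) * M n"
        by (intro mult_left_mono lower elim) simp
      finally show ?case using elim(1) by linarith
    qed
  next
    fix y assume y: "\<kappa> * sqrt mu < y"
    \<comment> \<open>One slack \<open>x\<close> serves both for the excess of \<open>B\<close> over
      \<open>\<kappa>\<close> and for the gap between \<open>a\<close> and \<open>1 / mu\<close>;
      the bound it produces tends to \<open>\<kappa> * sqrt mu < y\<close> as \<open>x\<close> tends
      to 0.\<close>
    have "((\<lambda>x. (\<kappa> + x) * sqrt (mu / (1 - x))) \<longlongrightarrow> (\<kappa> + 0) * sqrt (mu / (1 - 0))) (at_right 0)"
      by (intro tendsto_intros) auto
    then have "\<forall>\<^sub>F x in at_right 0. (\<kappa> + x) * sqrt (mu / (1 - x)) < y"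
      using y by (intro order_tendstoD(2)) auto
    moreover have "\<forall>\<^sub>F x in at_right (0::real). x < 1"
      by (rule eventually_at_rightI[of 0 1]) auto
    moreover have "\<forall>\<^sub>F x in at_right (0::real). 0 < x"
      by (rule eventually_at_right_less)
    ultimately have "\<forall>\<^sub>F x in at_right 0. (\<kappa> + x) * sqrt (mu / (1 - x)) < y \<and> x < 1 \<and> 0 < x"
      by eventually_elim auto
    then obtain x where x: "(\<kappa> + x) * sqrt (mu / (1 - x)) < y" "x < 1" "0 < x"
      using eventually_happens[of _ "at_right (0::real)"] by auto
    define a where "a = (1 - x) / mu"
    have a: "0 < a" "a * mu < 1" using x mu_pos by (simp_all add: a_def)
    obtain \<delta> where \<delta>: "\<delta> > 0"
      "\<And>s n. real s \<le> a * real n \<Longrightarrow> fps_nth (P ^ s) n \<le> exp (- \<delta> * real n)"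
      using few_summands[OF a] by blast
    obtain B where B: "\<And>s n. s > 0 \<Longrightarrow> sqrt (real s) * fps_nth (P ^ s) n \<le> B s" "B \<longlonglongrightarrow> \<kappa>"
      unfolding \<kappa>_def using local_upper by blast
    have "\<forall>\<^sub>F s in sequentially. B s < \<kappa> + x"
      using B(2) x(3) by (intro order_tendstoD(2)) auto
    then obtain s0 where s0: "\<And>s. s \<ge> s0 \<Longrightarrow> B s < \<kappa> + x"
      unfolding eventually_sequentially by blast
    have "(\<lambda>n. sqrt (real n) * exp (- \<delta> * real n)) \<longlonglongrightarrow> 0"
    proof (rule Lim_null_comparison)
      show "(\<lambda>n. 1 / \<delta> * (1 / sqrt (real n))) \<longlonglongrightarrow> 0"
        by (intro tendsto_mult_right_zero tendsto_divide_0[OF tendsto_const]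
            filterlim_at_top_imp_at_infinity filterlim_compose[OF sqrt_at_top] filterlim_real_sequentially)
      show "\<forall>\<^sub>F n in sequentially. norm (sqrt (real n) * exp (- \<delta> * real n)) \<le>
          1 / \<delta> * (1 / sqrt (real n))"
        using eventually_gt_at_top[of 0]
      proof eventually_elim
        case (elim n)
        have "\<delta> * real n \<le> exp (\<delta> * real n)"
          using exp_ge_add_one_self[of "\<delta> * real n"] by linarith
        then have "exp (- \<delta> * real n) \<le> 1 / (\<delta> * real n)"
          using \<delta>(1) elim by (simp add: exp_minus field_simps)
        then have "sqrt (real n) * exp (- \<delta> * real n) \<le> sqrt (real n) * (1 / (\<delta> * real n))"
          by (intro mult_left_mono) auto
        also have "\<dots> = 1 / \<delta> * (1 / sqrt (real n))"
          using elim \<delta>(1) by (simp add: frac_eq_eq)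
        finally show ?case by simp
      qed
    qed
    then have "\<forall>\<^sub>F n in sequentially. sqrt (real n) * exp (- \<delta> * real n) < y"
    proof (rule order_tendstoD(2))
      have "0 < \<kappa> * sqrt mu" using \<kappa> mu_pos by simp
      then show "0 < y" using y by linarith
    qed
    moreover have "\<forall>\<^sub>F n in sequentially. real n \<ge> real s0 / a"
      using filterlim_real_sequentially unfolding filterlim_at_top by blast
    ultimately show "\<forall>\<^sub>F n in sequentially. sqrt (real n) * M n < y"
    proof eventually_elim
      case (elim n)
      obtain s where s: "s \<ge> 1" "M n \<le> fps_nth (P ^ s) n" using attained by blast
      have "sqrt (real n) * M n \<le> sqrt (real n) * fps_nth (P ^ s) n"
        by (intro mult_left_mono s) simp
      also have "\<dots> < y"
      proof (cases "real s \<le> a * real n")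
        case True
        have "sqrt (real n) * fps_nth (P ^ s) n \<le> sqrt (real n) * exp (- \<delta> * real n)"
          by (intro mult_left_mono \<delta>(2) True) simp
        then show ?thesis using elim(1) by linarith
      next
        case False
        have "real s0 \<le> a * real n" using elim(2) a by (simp add: field_simps)
        then have "s \<ge> s0" using False by linarith
        then have "sqrt (real s) * fps_nth (P ^ s) n \<le> \<kappa> + x"
          using B(1)[of s n] s0[of s] s(1) by fastforce
        then have q: "fps_nth (P ^ s) n \<le> (\<kappa> + x) / sqrt (real s)"
          using s(1) by (simp add: field_simps)
        have "sqrt (real n) * fps_nth (P ^ s) n \<le> sqrt (real n) * ((\<kappa> + x) / sqrt (real s))"
          by (intro mult_left_mono q) simp
        also have "\<dots> = (\<kappa> + x) * sqrt (real n / real s)"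
          by (simp add: real_sqrt_divide)
        also have "\<dots> \<le> (\<kappa> + x) * sqrt (1 / a)"
        proof (intro mult_left_mono real_sqrt_le_mono)
          show "real n / real s \<le> 1 / a"
            using False a s(1) by (simp add: field_simps)
        qed (use \<kappa> x in auto)
        also have "1 / a = mu / (1 - x)" by (simp add: a_def)
        finally show ?thesis using x(1) by linarith
      qed
      finally show ?case .
    qed
  qed
qed

end

section \<open>The maximal number of representations\<close>

lemma w2_moment_sums:
  assumes "0 \<le> x" "x < 13/20"
  shows "(\<lambda>n. real n ^ q * (w2_coeff n * x ^ n)) sums (x + node_moment q 1 x)"
proof -
  have "(\<lambda>n. if n = 1 then x else 0) sums x" using sums_single[of 1 "\<lambda>_. x"] by simp
  from sums_add[OF this node_moment_sums[OF assms, of q 1]]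
  have "(\<lambda>n. (if n = 1 then x else 0) + real n ^ q * (open_node_coeff 2 n * x ^ n)) sums
      (x + node_moment q 1 x)"
    by simp
  moreover have "(\<lambda>n. (if n = 1 then x else 0) + real n ^ q * (open_node_coeff 2 n * x ^ n)) =
      (\<lambda>n. real n ^ q * (w2_coeff n * x ^ n))"
    by (auto simp: w2_coeff_eq algebra_simps)
  ultimately show ?thesis by simp
qed

lemma w2_coeff_1_pos: "w2_coeff 1 > 0"
  using open_node_coeff_nonneg[of 2 1] by (simp add: w2_coeff_eq)

lemma w2_coeff_2_pos: "w2_coeff 2 > 0"
proof -
  have "w2_coeff 2 = (\<Sum>i\<le>2. open_node_coeff (2 * (2 - i)) (2 - i) / fact i)"
    using open_node_coeff_rec[of 2 2] by (simp add: w2_coeff_eq)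
  also have "\<dots> \<ge> (\<Sum>i\<in>{2}. open_node_coeff (2 * (2 - i)) (2 - i) / fact i)"
    by (rule sum_mono2) (auto intro!: divide_nonneg_nonneg open_node_coeff_nonneg)
  finally show ?thesis by (simp add: open_node_coeff_0)
qed

text \<open>The index 0 may be added because its coefficient vanishes; for nonnegative terms
  unordered and ordinary summation agree.\<close>

lemma has_sum_w2_iff:
  assumes "x > 0"
  shows "((\<lambda>n. real (W2 1 n) / fact n * x ^ n) has_sum S) {1..} \<longleftrightarrow>
    (\<lambda>n. w2_coeff n * x ^ n) sums S"
proof -
  have "((\<lambda>n. real (W2 1 n) / fact n * x ^ n) has_sum S) {1..} \<longleftrightarrow>
      ((\<lambda>n. w2_coeff n * x ^ n) has_sum S) UNIV"
    unfolding w2_coeff_def[symmetric] by (rule has_sum_cong_neutral) (auto simp: not_le)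
  also have "\<dots> \<longleftrightarrow> (\<lambda>n. w2_coeff n * x ^ n) sums S"
    using assms by (auto intro: has_sum_imp_sums sums_nonneg_imp_has_sum simp: w2_coeff_nonneg)
  finally show ?thesis .
qed

text \<open>The linear term alone increases strictly; this yields uniqueness of \<theta>.\<close>

lemma w2_sums_strict_mono:
  assumes "0 < x" "x < y" "(\<lambda>n. w2_coeff n * x ^ n) sums a" "(\<lambda>n. w2_coeff n * y ^ n) sums b"
  shows "a < b"
proof -
  have d: "(\<lambda>n. w2_coeff n * (y ^ n - x ^ n)) sums (b - a)"
    using sums_diff[OF assms(4,3)] by (simp add: algebra_simps)
  have "(\<Sum>n\<in>{1}. w2_coeff n * (y ^ n - x ^ n)) \<le> b - a"
    using d assms(1,2)
    by (intro sum_le_suminf[THEN order_trans[OF _ eq_refl]])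
      (auto simp: sums_iff w2_coeff_nonneg power_mono)
  moreover have "w2_coeff 1 * (y - x) > 0" using w2_coeff_1_pos assms(2) by simp
  ultimately show ?thesis by simp
qed

text \<open>W is continuous on the interval, which lies inside the radius \<open>13/20\<close>, and
  crosses 1 between the end points.\<close>

lemma w2_root_exists:
  obtains \<theta> :: real where "570716981 / 1000000000 \<le> \<theta>" "\<theta> \<le> 570716984 / 1000000000"
    "\<theta> + node_moment 0 1 \<theta> = 1"
proof -
  let ?lo = "570716981 / 1000000000 :: real" and ?hi = "570716984 / 1000000000 :: real"
  have cont: "isCont (\<lambda>x. x + node_moment 0 1 x) x" if "?lo \<le> x" "x \<le> ?hi" for x
  proof -
    have "isCont (\<lambda>x. \<Sum>n. open_node_coeff (2 * 1) n * x ^ n) x"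
      by (rule isCont_powser[OF open_node_summable_bound(1)]) (use that in auto)
    then show ?thesis by (auto simp: node_moment_def intro!: continuous_intros)
  qed
  have "\<exists>x\<ge>?lo. x \<le> ?hi \<and> x + node_moment 0 1 x = 1"
    by (rule IVT) (use node_moment_below_root node_moment_above_root cont in auto)
  then show ?thesis using that by blast
qed

text \<open>Tilting by \<open>x ^ n\<close> commutes with convolution. It carries the comparison of
  \<open>M2\<close> with powers of W over to the probability distribution.\<close>

lemma fps_power_rescale:
  fixes a :: "nat \<Rightarrow> real"
  shows "fps_nth (Abs_fps (\<lambda>n. a n * x ^ n) ^ s) n = fps_nth (Abs_fps a ^ s) n * x ^ n"
proof (induction s arbitrary: n)
  case (Suc s)
  have "a i * x ^ i * (fps_nth (Abs_fps a ^ s) (n - i) * x ^ (n - i)) =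
      a i * fps_nth (Abs_fps a ^ s) (n - i) * x ^ n" if "i \<in> {0..n}" for i
  proof -
    have "x ^ i * x ^ (n - i) = x ^ n" using that by (simp flip: power_add)
    then show ?thesis by (simp add: mult_ac)
  qed
  then show ?case
    by (simp only: power_Suc fps_mult_nth fps_nth_Abs_fps Suc.IH sum_distrib_right) (rule sum.cong; simp)
qed (simp add: fps_one_nth)

theorem theorem4:
  shows "\<exists>\<theta> \<nu> :: real.
    \<theta> > 0 \<and> ((\<lambda>n. real (W2 1 n) / fact n * \<theta> ^ n) has_sum 1) {1..} \<and>
    (\<forall>x>0. ((\<lambda>n. real (W2 1 n) / fact n * x ^ n) has_sum 1) {1..} \<longrightarrow> x = \<theta>) \<and>
    \<nu> = 1 / \<theta> \<and> 1.7521819 \<le> \<nu> \<and> \<nu> < 1.7521820 \<and>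
    (\<forall>n\<ge>1. real (M2 n) / fact n \<le> \<nu> ^ n) \<and>
    (\<forall>c::real. (\<forall>n\<ge>1. real (M2 n) / fact n \<le> c ^ n) \<longrightarrow> \<nu> \<le> c) \<and>
    (\<exists>L::real. \<bar>L - 0.2769343\<bar> < 0.00000005 \<and>
       (\<lambda>n. real (M2 n) / fact n) \<sim>[sequentially]
         (\<lambda>n. L * real n powr (-1/2) * \<nu> ^ n))"
proof -
  obtain \<theta> :: real where \<theta>: "570716981 / 1000000000 \<le> \<theta>" "\<theta> \<le> 570716984 / 1000000000"
    "\<theta> + node_moment 0 1 \<theta> = 1"
    by (rule w2_root_exists)
  have \<theta>0: "0 < \<theta>" "\<theta> < 13/20" using \<theta> by auto
  note moments = w2_moment_sums[OF less_imp_le[OF \<theta>0(1)] \<theta>0(2)]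
  have sum1: "(\<lambda>n. w2_coeff n * \<theta> ^ n) sums 1" using moments[of 0] \<theta>(3) by simp
  define \<nu> where "\<nu> = 1 / \<theta>"
  have \<nu>: "\<nu> > 0" "\<theta> * \<nu> = 1" using \<theta>0 by (simp_all add: \<nu>_def)
  \<comment> \<open>At \<open>(13/20) / \<theta> > 1\<close> the tilted series is W at
    \<open>13/20\<close>, where the supersolution ensures convergence.\<close>
  interpret lattice_distribution "\<lambda>n. w2_coeff n * \<theta> ^ n" "(13/20) / \<theta>"
  proof
    have "(\<lambda>n. w2_coeff n * \<theta> ^ n * (13 / 20 / \<theta>) ^ n) =
        (\<lambda>n. open_node_coeff 2 n * (13/20) ^ n + (if n = 1 then 13/20 else 0))"
      using \<theta>0 by (auto simp: w2_coeff_eq power_divide algebra_simps)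
    moreover have "summable (\<lambda>n. if n = 1 then 13/20 else (0::real))"
      using sums_single[of 1 "\<lambda>_. 13/20 :: real"] by (simp add: sums_iff)
    ultimately show "summable (\<lambda>n. w2_coeff n * \<theta> ^ n * (13 / 20 / \<theta>) ^ n)"
      using open_node_summable_bound(1)[of 1] by (simp add: summable_add)
  qed (use \<theta>0 sum1 w2_coeff_1_pos w2_coeff_2_pos in \<open>auto simp: w2_coeff_nonneg\<close>)
  define M where "M n = real (M2 n) / fact n * \<theta> ^ n" for n
  have M2_eq: "real (M2 n) / fact n = M n * \<nu> ^ n" for n
    using \<nu>(2) by (simp add: M_def mult.assoc flip: power_mult_distrib)
  have M_nonneg: "M n \<ge> 0" for n using \<theta>0 by (simp add: M_def)
  have M_lower: "fps_nth (P ^ s) n \<le> M n" if "s \<ge> 1" for s n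
    unfolding fps_power_rescale M_def using \<theta>0
    by (intro mult_right_mono w2_fps_power_le_M2 that) auto
  have M_attained: "\<exists>s\<ge>1. M n \<le> fps_nth (P ^ s) n" for n
  proof -
    obtain s where "s \<ge> 1" "real (M2 n) / fact n \<le> fps_nth (w2_fps ^ s) n"
      using M2_le_w2_fps_power by blast
    then show ?thesis
      unfolding fps_power_rescale M_def using \<theta>0
      by (intro exI[of _ s] conjI mult_right_mono) auto
  qed
  define L where "L = sqrt (mu / (2 * pi * sigma2))"
  have lim: "(\<lambda>n. sqrt (real n) * M n) \<longlonglongrightarrow> L"
    unfolding L_def by (rule max_asymptotics[OF M_lower M_attained])
  have L_pos: "L > 0" using mu_pos sigma2_pos by (simp add: L_def)
  have mu_eq: "mu = \<theta> + node_moment 1 1 \<theta>"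
    unfolding mu_def using moments[of 1] by (simp add: sums_iff)
  have sigma2_eq: "sigma2 = \<theta> + node_moment 2 1 \<theta> - mu\<^sup>2"
    unfolding sigma2_def using moments[of 2] by (simp add: sums_iff)
  note near = node_moment_near_root[OF \<theta>(1,2)]
  have mu_bounds: "2.22879888 \<le> mu" "mu \<le> 2.22879895"
    using near(1) \<theta>(1,2) unfolding mu_eq by auto
  have "2.22879888\<^sup>2 \<le> mu\<^sup>2" "mu\<^sup>2 \<le> 2.22879895\<^sup>2"
    using mu_bounds by (intro power_mono; simp)+
  then have sigma2_bounds: "4.625274 \<le> sigma2" "sigma2 \<le> 4.6252753"
    using near(2) \<theta>(1,2) unfolding sigma2_eq by (simp_all add: power2_eq_square)
  \<comment> \<open>Squared and cleared of the denominator, both estimates become inequalities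
    between \<open>mu\<close> and a multiple of \<open>pi * sigma2\<close>. The target interval has
    relative width about 3.6 / 10^7.\<close>
  have L_bounds: "0.27693425 < L" "L < 0.27693435"
  proof -
    have "2 * pi * sigma2 \<le> 2 * 3.1415926535899 * 4.6252753"
      using pi_approx sigma2_bounds sigma2_pos by (intro mult_mono) auto
    then have "0.27693425\<^sup>2 * (2 * pi * sigma2) < mu"
      using mu_bounds by (simp add: power2_eq_square)
    then have "0.27693425\<^sup>2 < mu / (2 * pi * sigma2)"
      using sigma2_pos by (simp add: less_divide_eq)
    then show "0.27693425 < L" unfolding L_def by (rule real_less_rsqrt)
    have "2 * 3.141592653588 * 4.625274 \<le> 2 * pi * sigma2"
      using pi_approx sigma2_bounds by (intro mult_mono) auto
    then have "mu < 0.27693435\<^sup>2 * (2 * pi * sigma2)"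
      using mu_bounds by (simp add: power2_eq_square)
    then have "mu / (2 * pi * sigma2) < 0.27693435\<^sup>2"
      using sigma2_pos by (simp add: divide_less_eq)
    then show "L < 0.27693435" unfolding L_def by (rule real_less_lsqrt[rotated -1]) auto
  qed
  show ?thesis
  proof (rule exI[of _ \<theta>], rule exI[of _ \<nu>], intro exI[of _ L] conjI allI impI)
    show "((\<lambda>n. real (W2 1 n) / fact n * \<theta> ^ n) has_sum 1) {1..}"
      using has_sum_w2_iff[OF \<theta>0(1)] sum1 by blast
    show "x = \<theta>" if "0 < x" "((\<lambda>n. real (W2 1 n) / fact n * x ^ n) has_sum 1) {1..}" for x
    proof -
      have "(\<lambda>n. w2_coeff n * x ^ n) sums 1" using that has_sum_w2_iff by blast
      with sum1 show ?thesis
        using w2_sums_strict_mono[of x \<theta> 1 1] w2_sums_strict_mono[of \<theta> x 1 1] that(1) \<theta>0(1)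
        by (meson less_irrefl linorder_neqE_linordered_idom)
    qed
    show "1.7521819 \<le> \<nu>" "\<nu> < 1.7521820"
      using \<theta> by (simp_all add: \<nu>_def field_simps)
    show "real (M2 n) / fact n \<le> \<nu> ^ n" for n
    proof -
      obtain s where "M n \<le> fps_nth (P ^ s) n" using M_attained by blast
      also have "\<dots> \<le> 1" using power_le_eval[of 1 s n] R by (simp add: eval_1)
      finally show ?thesis
        unfolding M2_eq using \<nu>(1) by (simp add: mult_left_le_one_le M_nonneg)
    qed
    \<comment> \<open>If \<open>c < \<nu>\<close>, then \<open>M n \<le> (c * \<theta>) ^ n\<close>
      decays geometrically, which contradicts the positive limit \<open>L\<close> of
      \<open>sqrt n * M n\<close>.\<close>
    show "\<nu> \<le> c" if c: "\<forall>n\<ge>1. real (M2 n) / fact n \<le> c ^ n" for c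
    proof (rule ccontr)
      assume "\<not> \<nu> \<le> c"
      \<comment> \<open>The instance \<open>n = 1\<close> forces \<open>c \<ge> 0\<close>, so
        \<open>c * \<theta>\<close> is a nonnegative ratio below 1.\<close>
      have "0 \<le> real (M2 1) / fact 1" by simp
      also have "\<dots> \<le> c ^ 1" using c by blast
      finally have c0: "0 \<le> c" by simp
      have c1: "c * \<theta> < 1" using \<open>\<not> \<nu> \<le> c\<close> \<theta>0 by (simp add: \<nu>_def field_simps)
      have "(\<lambda>n. sqrt (real n) * M n) \<longlonglongrightarrow> 0"
      proof (rule Lim_null_comparison)
        show "(\<lambda>n. real n * (c * \<theta>) ^ n) \<longlonglongrightarrow> 0"
          by (rule powser_times_n_limit_0) (use c0 c1 \<theta>0 in auto)
        show "\<forall>\<^sub>F n in sequentially. norm (sqrt (real n) * M n) \<le> real n * (c * \<theta>) ^ n"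
          using eventually_ge_at_top[of 1]
        proof eventually_elim
          case (elim n)
          have "sqrt (real n) * M n \<le> real n * (c * \<theta>) ^ n"
          proof (intro mult_mono)
            show "sqrt (real n) \<le> real n"
              using elim by (intro real_le_lsqrt) (auto simp: power2_eq_square)
            show "M n \<le> (c * \<theta>) ^ n"
              unfolding M_def power_mult_distrib using c elim \<theta>0 by (intro mult_right_mono) auto
          qed (auto simp: M_nonneg)
          then show ?case by (simp add: M_nonneg)
        qed
      qed
      from LIMSEQ_unique[OF this lim] L_pos show False by simp
    qed
    show "\<bar>L - 0.2769343\<bar> < 0.00000005" unfolding abs_less_iff using L_bounds by simp
    show "(\<lambda>n. real (M2 n) / fact n) \<sim>[sequentially] (\<lambda>n. L * real n powr (-1/2) * \<nu> ^ n)"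
    proof (rule asymp_equivI')
      have "(\<lambda>n. sqrt (real n) * M n / L) \<longlonglongrightarrow> L / L"
        using L_pos by (intro tendsto_divide lim tendsto_const) auto
      then have "(\<lambda>n. sqrt (real n) * M n / L) \<longlonglongrightarrow> 1" using L_pos by simp
      moreover have "sqrt (real n) * M n / L =
          real (M2 n) / fact n / (L * real n powr (-1/2) * \<nu> ^ n)" if "n > 0" for n
        unfolding M2_eq using that \<nu>(1)
        by (simp add: powr_minus_divide powr_half_sqrt field_simps)
      ultimately show "(\<lambda>n. real (M2 n) / fact n / (L * real n powr (-1/2) * \<nu> ^ n)) \<longlonglongrightarrow> 1"
        by (rule Lim_transform_eventually[rotated, OF eventually_mono[OF eventually_gt_at_top[of 0]], rotated])
          auto
    qed
  qed (use \<theta>0 in \<open>auto simp: \<nu>_def\<close>)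
qed

end
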